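(* Let $n\ge 2$ and let $\Omega\subset\mathbb{H}^n$ be a bounded domain whose boundary $\partial\Omega$ is of class $C^{2,\alpha}$ for some $0<\alpha<1$. Assume that there exist a positive constant $c$ and a solution $u\in C^1(\mathbb{H}^n)$ to the overdetermined problem $$\begin{cases}-\Delta u=\mathcal{X}_{\Omega} & \text{in }\mathbb{H}^n,\\ u\equiv 0 & \text{on }\partial\Omega,\\ u(x)\to -c & \text{as } d^{\mathbb{H}^n}(x,o)\to\infty,\end{cases}$$ where $d^{\mathbb{H}^n}(x,o)$ denotes the distance of $x$ from a fixed point $o\in\mathbb{H}^n$. Then $\Omega$ is a geodesic ball.
   Context: $\mathbb{H}^n$ is the $n$-dimensional hyperbolic space (constant curvature $-1$), $\Delta$ its Laplace--Beltrami operator, and $\mathcal{X}_\Omega$ the characteristic function of $\Omega$. A domain is a connected open set. The equation is understood in the weak sense on $\mathbb{H}^n$; equivalently, $-\Delta u=1$ in $\Omega$, $-\Delta u=0$ in $\mathbb{H}^n\setminus\overline{\Omega}$, and $u$ is $C^1$ across $\partial\Omega$. *)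

theory Defs
  imports "HOL-Analysis.Analysis"
begin

section \<open>Function spaces on open sets\<close>

text \<open>\<open>Ck_on k S f\<close> says that \<open>f\<close> is of class $C^k$ on the open set \<open>S\<close>. The recursion
  differentiates in all constant directions \<open>v\<close>; for open \<open>S\<close> the derivative \<^term>\<open>at x\<close> used
  here agrees with the one within \<open>S\<close>.\<close>

primrec Ck_on ::
  "nat \<Rightarrow> 'a::euclidean_space set \<Rightarrow> ('a \<Rightarrow> 'b::real_normed_vector) \<Rightarrow> bool" where
  "Ck_on 0 S f \<longleftrightarrow> continuous_on S f"
| "Ck_on (Suc k) S f \<longleftrightarrow>
     f differentiable_on S \<and> (\<forall>v. Ck_on k S (\<lambda>x. frechet_derivative f (at x) v))"

definition locally_Holder_on ::
  "real \<Rightarrow> 'a::metric_space set \<Rightarrow> ('a \<Rightarrow> 'b::metric_space) \<Rightarrow> bool" where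
  "locally_Holder_on \<alpha> S f \<longleftrightarrow>
     (\<forall>K. compact K \<and> K \<subseteq> S \<longrightarrow>
        (\<exists>C. \<forall>x\<in>K. \<forall>y\<in>K. dist (f x) (f y) \<le> C * dist x y powr \<alpha>))"

text \<open>The class $C^{k,\alpha}(S)$, with the Hoelder condition on compact subsets of the open set
  \<open>S\<close>.\<close>

primrec Ck_Holder_on ::
  "nat \<Rightarrow> real \<Rightarrow> 'a::euclidean_space set \<Rightarrow> ('a \<Rightarrow> 'b::real_normed_vector) \<Rightarrow> bool" where
  "Ck_Holder_on 0 \<alpha> S f \<longleftrightarrow> locally_Holder_on \<alpha> S f"
| "Ck_Holder_on (Suc k) \<alpha> S f \<longleftrightarrow>
     f differentiable_on S \<and> (\<forall>v. Ck_Holder_on k \<alpha> S (\<lambda>x. frechet_derivative f (at x) v))"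

text \<open>Boundary of class $C^{k,\alpha}$ in the sense of Gilbarg and Trudinger (Section 6.2): near
  each boundary point a $C^{k,\alpha}$ diffeomorphism \<open>\<psi>\<close> flattens the boundary, with \<open>\<Omega>\<close> on the
  positive side only.\<close>

definition Ck_Holder_boundary :: "nat \<Rightarrow> real \<Rightarrow> 'a::euclidean_space set \<Rightarrow> bool" where
  "Ck_Holder_boundary k \<alpha> \<Omega> \<longleftrightarrow>
     (\<forall>p\<in>frontier \<Omega>. \<exists>r>0. \<exists>(\<psi>::'a \<Rightarrow> 'a). \<exists>e\<in>Basis.
        inj_on \<psi> (ball p r) \<and> open (\<psi> ` ball p r) \<and>
        Ck_Holder_on k \<alpha> (ball p r) \<psi> \<and>
        Ck_Holder_on k \<alpha> (\<psi> ` ball p r) (inv_into (ball p r) \<psi>) \<and>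
        \<psi> ` (ball p r \<inter> \<Omega>) \<subseteq> {y. 0 < y \<bullet> e} \<and>
        \<psi> ` (ball p r \<inter> frontier \<Omega>) \<subseteq> {y. y \<bullet> e = 0})"


section \<open>Hyperbolic space: the Poincare ball model\<close>

text \<open>The unit ball of an $n$-dimensional Euclidean space with the metric
  $g_x = \lambda(x)^2 \langle\cdot,\cdot\rangle$, $\lambda(x) = 2/(1-|x|^2)$, of constant curvature
  $-1$. The identity is a global chart, so openness, connectedness, and $C^k$ and $C^{k,\alpha}$
  regularity are the Euclidean ones.\<close>

definition hyp_space :: "'a::euclidean_space set" where
  "hyp_space = ball 0 1"

definition conformal_factor :: "'a::euclidean_space \<Rightarrow> real" where
  "conformal_factor x = 2 / (1 - (norm x)\<^sup>2)"

definition hyp_metric :: "'a::euclidean_space \<Rightarrow> 'a \<Rightarrow> 'a \<Rightarrow> real" where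
  "hyp_metric x v w = (conformal_factor x)\<^sup>2 * (v \<bullet> w)"

text \<open>The distance of the ball model: the standard closed formula for the Riemannian distance
  induced by \<^const>\<open>hyp_metric\<close>.\<close>

definition hyp_dist :: "'a::euclidean_space \<Rightarrow> 'a \<Rightarrow> real" where
  "hyp_dist x y =
     arcosh (1 + 2 * (norm (x - y))\<^sup>2 / ((1 - (norm x)\<^sup>2) * (1 - (norm y)\<^sup>2)))"

definition hyp_ball :: "'a::euclidean_space \<Rightarrow> real \<Rightarrow> 'a set" where
  "hyp_ball p r = {x \<in> hyp_space. hyp_dist p x < r}"

definition hyp_bounded :: "'a::euclidean_space set \<Rightarrow> bool" where
  "hyp_bounded S \<longleftrightarrow> (\<exists>p\<in>hyp_space. \<exists>R. \<forall>x\<in>S. hyp_dist p x \<le> R)"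

text \<open>Riemannian volume: the density is $\sqrt{\det g} = \lambda^n$.\<close>

definition hyp_vol :: "'a::euclidean_space measure" where
  "hyp_vol = density (restrict_space lborel hyp_space)
               (\<lambda>x. ennreal (conformal_factor x ^ DIM('a)))"

text \<open>Riemannian gradient: the vector representing the differential of \<open>u\<close> at \<open>x\<close> with respect to
  \<open>hyp_metric x\<close>.\<close>

definition hyp_grad :: "('a::euclidean_space \<Rightarrow> real) \<Rightarrow> 'a \<Rightarrow> 'a" where
  "hyp_grad u x =
     (1 / (conformal_factor x)\<^sup>2) *\<^sub>R (\<Sum>b\<in>Basis. frechet_derivative u (at x) b *\<^sub>R b)"

text \<open>Test functions: $C_c^\infty(\mathbb{H}^n)$. Values outside \<^const>\<open>hyp_space\<close> are
  irrelevant.\<close>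

definition hyp_test_function :: "('a::euclidean_space \<Rightarrow> real) \<Rightarrow> bool" where
  "hyp_test_function \<phi> \<longleftrightarrow>
     (\<forall>k. Ck_on k hyp_space \<phi>) \<and>
     (\<exists>K. compact K \<and> K \<subseteq> hyp_space \<and> (\<forall>x\<in>hyp_space - K. \<phi> x = 0))"

text \<open>$-\Delta u = f$ weakly on $\mathbb{H}^n$, where $\Delta$ is the Laplace--Beltrami operator and
  \<open>u\<close> is $C^1$: Green's formula $\int (-\Delta u)\varphi\,dV = \int g(\nabla u,\nabla\varphi)\,dV$
  for compactly supported \<open>\<phi>\<close>.\<close>

definition weak_hyp_poisson ::
  "('a::euclidean_space \<Rightarrow> real) \<Rightarrow> ('a \<Rightarrow> real) \<Rightarrow> bool" where
  "weak_hyp_poisson u f \<longleftrightarrow>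
     (\<forall>\<phi>. hyp_test_function \<phi> \<longrightarrow>
        (LINT x|hyp_vol. hyp_metric x (hyp_grad u x) (hyp_grad \<phi> x)) =
        (LINT x|hyp_vol. f x * \<phi> x))"

end

theory Submission
  imports Defs
begin

text \<open>The theorem holds because \<open>u + c\<close> is the Green potential of \<open>\<Omega>\<close> and \<open>\<Omega>\<close> is exactly the set
  where \<open>u > 0\<close>. This turns the overdetermined problem into a symmetry question for a set determined
  by its own potential, which the method of moving planes answers in integral form.

  Potential. Testing the weak equation with smooth radial functions, truncated versions of the Green
  function, expresses the difference of two weighted spherical averages of \<open>u\<close> about a point as an
  integral over \<open>\<Omega>\<close> (\<open>average_poisson\<close>). Letting one average concentrate at the centre and the other
  escape to infinity gives \<open>green_representation\<close>. Since the truncated kernels are monotone in the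
  truncation, inequalities for them suffice and no singular integral has to be estimated. The same
  identity on small balls yields the mean value inequalities behind \<open>u_pos\<close> and \<open>u_nonpos\<close>, hence
  \<open>\<Omega>_eq\<close>.

  Reflections. A hyperbolic reflection preserves \<open>cosh_dist\<close> and the volume
  (\<open>integral_reflection\<close>), and any two points are exchanged by the reflection in their bisector
  (\<open>bisector\<close>). If the cap of \<open>\<Omega>\<close> cut off by a plane reflects into \<open>\<Omega>\<close>, then the difference of the
  potential at a point of the cap and at its mirror image is an integral with negative integrand over
  the part of \<open>\<Omega>\<close> not covered by the reflected cap. Either this part is a null set and \<open>u\<close> is
  symmetric, or the difference is bounded above by a negative multiple of the height over the plane (\<open>hopf\<close>),
  which contains both the strong maximum principle and the Hopf boundary lemma.

  Moving planes. Let \<open>p\<close> be a maximum point of \<open>u\<close> and consider a plane with \<open>p\<close> on its far side. It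
  is reached from the boundary of the ball by planes orthogonal to the same diameter. Along the way the cap always reflects into \<open>\<Omega>\<close> (\<open>moving_planes\<close>). A symmetric
  position is impossible, because it would reflect \<open>p\<close> to a maximum point in the cap. Applied to
  the bisector of two points, this says that \<open>\<Omega>\<close> contains with a point every point that is closer to \<open>p\<close>
  (\<open>closer_point_in\<close>), so \<open>\<Omega>\<close> is a ball about \<open>p\<close>.\<close>

section \<open>Calculus of continuously differentiable functions\<close>

lemma frechet_derivative_cong_open:
  assumes "open S" "x \<in> S" "\<And>y. y \<in> S \<Longrightarrow> f y = g y"
  shows "frechet_derivative f (at x) = frechet_derivative g (at x)"
proof -
  have "(f has_derivative D) (at x) \<longleftrightarrow> (g has_derivative D) (at x)" for D
    using has_derivative_transform_within_open[OF _ assms(1,2)] assms(3) by metis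
  then show ?thesis unfolding frechet_derivative_def by presburger
qed

lemma Ck_on_cong:
  assumes "open S" "\<And>y. y \<in> S \<Longrightarrow> f y = g y"
  shows "Ck_on k S f \<longleftrightarrow> Ck_on k S g"
  using assms(2)
proof (induction k arbitrary: f g)
  case 0
  then show ?case using continuous_on_cong[of S S f g] by simp
next
  case (Suc k)
  have "f differentiable_on S \<longleftrightarrow> g differentiable_on S"
    unfolding differentiable_on_def
    using Suc.prems differentiable_transform_within[of f _ S 1 g] differentiable_transform_within[of g _ S 1 f] by auto
  moreover have "Ck_on k S (\<lambda>x. frechet_derivative f (at x) v) \<longleftrightarrow>
      Ck_on k S (\<lambda>x. frechet_derivative g (at x) v)" for v
    by (rule Suc.IH) (use frechet_derivative_cong_open[OF assms(1) _ Suc.prems] in auto)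
  ultimately show ?case by simp
qed

text \<open>This trades the choice of \<open>frechet_derivative\<close> for a derivative known in advance.\<close>

lemma Ck_on_SucI:
  assumes "open S" "\<And>x. x \<in> S \<Longrightarrow> (f has_derivative f' x) (at x)"
    "\<And>v. Ck_on k S (\<lambda>x. f' x v)"
  shows "Ck_on (Suc k) S f"
proof -
  have "f differentiable_on S"
    using assms(2) by (meson differentiable_at_imp_differentiable_on differentiable_def)
  moreover have "Ck_on k S (\<lambda>x. frechet_derivative f (at x) v)" for v
  proof (subst Ck_on_cong[OF assms(1)])
    show "frechet_derivative f (at y) v = f' y v" if "y \<in> S" for y
      using frechet_derivative_at[OF assms(2)[OF that]] by simp
  qed (rule assms(3))
  ultimately show ?thesis by simp
qed

lemma Ck_on_SucD:
  assumes "open S" "Ck_on (Suc k) S f"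
  shows "\<And>x. x \<in> S \<Longrightarrow> (f has_derivative frechet_derivative f (at x)) (at x)"
    "\<And>v. Ck_on k S (\<lambda>x. frechet_derivative f (at x) v)"
  using assms by (auto simp: differentiable_on_eq_differentiable_at frechet_derivative_works)

lemma Ck_on_mono1: "open S \<Longrightarrow> Ck_on (Suc k) S f \<Longrightarrow> Ck_on k S f"
proof (induction k arbitrary: f)
  case 0
  then show ?case by (simp add: differentiable_imp_continuous_on)
qed simp

lemma Ck_on_imp_continuous_on: "open S \<Longrightarrow> Ck_on k S f \<Longrightarrow> continuous_on S f"
  by (induction k) (auto simp: differentiable_imp_continuous_on)

lemma Ck_on_subset: "open S \<Longrightarrow> open T \<Longrightarrow> T \<subseteq> S \<Longrightarrow> Ck_on k S f \<Longrightarrow> Ck_on k T f"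
  by (induction k arbitrary: f) (auto intro: continuous_on_subset differentiable_on_subset)

lemma Ck_on_Un:
  assumes "open S" "open T" "Ck_on k S f" "Ck_on k T f"
  shows "Ck_on k (S \<union> T) f"
  using assms
  by (induction k arbitrary: f)
     (auto intro!: continuous_on_open_Un simp: differentiable_on_eq_differentiable_at open_Un)

lemma Ck_on_const: "Ck_on k S (\<lambda>x. c)"
  by (induction k arbitrary: c) auto

lemma Ck_on_bounded_linear:
  assumes "open S" "bounded_linear f"
  shows "Ck_on k S f"
proof (cases k)
  case 0
  then show ?thesis using assms by (simp add: linear_continuous_on)
next
  case (Suc j)
  show ?thesis unfolding Suc
    by (rule Ck_on_SucI[OF assms(1) bounded_linear_imp_has_derivative[OF assms(2)]])
       (rule Ck_on_const)
qed

lemma Ck_on_add: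
  assumes "open S" "Ck_on k S f" "Ck_on k S g"
  shows "Ck_on k S (\<lambda>x. f x + g x)"
  using assms(2,3)
proof (induction k arbitrary: f g)
  case 0
  then show ?case by (auto intro: continuous_intros)
next
  case (Suc k)
  show ?case
    by (rule Ck_on_SucI[OF assms(1)
          has_derivative_add[OF Ck_on_SucD(1)[OF assms(1) Suc.prems(1)]
            Ck_on_SucD(1)[OF assms(1) Suc.prems(2)]]])
       (auto intro!: Suc.IH Ck_on_SucD(2)[OF assms(1) Suc.prems(1)]
            Ck_on_SucD(2)[OF assms(1) Suc.prems(2)])
qed

lemma Ck_on_mult:
  fixes f g :: "'a::euclidean_space \<Rightarrow> real"
  assumes "open S" "Ck_on k S f" "Ck_on k S g"
  shows "Ck_on k S (\<lambda>x. f x * g x)"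
  using assms(2,3)
proof (induction k arbitrary: f g)
  case 0
  then show ?case by (auto intro: continuous_intros)
next
  case (Suc k)
  show ?case
    by (rule Ck_on_SucI[OF assms(1)
          has_derivative_mult[OF Ck_on_SucD(1)[OF assms(1) Suc.prems(1)]
            Ck_on_SucD(1)[OF assms(1) Suc.prems(2)]]])
       (assumption | intro Ck_on_add[OF assms(1)] Suc.IH Ck_on_SucD(2)[OF assms(1) Suc.prems(1)]
            Ck_on_SucD(2)[OF assms(1) Suc.prems(2)]
          Ck_on_mono1[OF assms(1) Suc.prems(1)] Ck_on_mono1[OF assms(1) Suc.prems(2)])+
qed

lemma Ck_on_compose:
  fixes f :: "'a::euclidean_space \<Rightarrow> real" and g :: "real \<Rightarrow> real"
  assumes "open S" "open U" "f ` S \<subseteq> U" "Ck_on k S f" "Ck_on k U g"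
  shows "Ck_on k S (\<lambda>x. g (f x))"
  using assms(4,5)
proof (induction k arbitrary: g)
  case 0
  then show ?case using continuous_on_compose2[of U g S f] assms(3) by simp
next
  case (Suc k)
  have lin: "frechet_derivative g (at t) r = frechet_derivative g (at t) 1 * r" if "t \<in> U" for t r
  proof -
    have "g differentiable (at t)"
      using Suc.prems(2) that assms(2) by (simp add: differentiable_on_eq_differentiable_at)
    from linear_scale[OF linear_frechet_derivative[OF this], of r 1] show ?thesis by simp
  qed
  show ?case
  proof (rule Ck_on_SucI[OF assms(1)])
    fix x assume "x \<in> S"
    then have x: "f x \<in> U" using assms(3) by auto
    have "((\<lambda>x. g (f x)) has_derivative (\<lambda>v. frechet_derivative g (at (f x)) (frechet_derivative f (at x) v))) (at x)"
      by (rule has_derivative_compose[OF Ck_on_SucD(1)[OF assms(1) Suc.prems(1) \<open>x \<in> S\<close>]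
            Ck_on_SucD(1)[OF assms(2) Suc.prems(2) x]])
    moreover have "(\<lambda>v. frechet_derivative g (at (f x)) (frechet_derivative f (at x) v)) =
        (\<lambda>v. frechet_derivative g (at (f x)) 1 * frechet_derivative f (at x) v)"
      by (rule ext, rule lin[OF x])
    ultimately show "((\<lambda>x. g (f x)) has_derivative (\<lambda>v. frechet_derivative g (at (f x)) 1 * frechet_derivative f (at x) v)) (at x)"
      by simp
  next
    fix v
    show "Ck_on k S (\<lambda>x. frechet_derivative g (at (f x)) 1 * frechet_derivative f (at x) v)"
      by (rule Ck_on_mult[OF assms(1) Suc.IH[OF Ck_on_mono1[OF assms(1) Suc.prems(1)]
          Ck_on_SucD(2)[OF assms(2) Suc.prems(2)]] Ck_on_SucD(2)[OF assms(1) Suc.prems(1)]])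
  qed
qed

lemma Ck_on_SucI_real:
  fixes f :: "real \<Rightarrow> real"
  assumes "open S" "\<And>x. x \<in> S \<Longrightarrow> (f has_real_derivative f' x) (at x)" "Ck_on k S f'"
  shows "Ck_on (Suc k) S f"
proof (rule Ck_on_SucI[OF assms(1)])
  show "(f has_derivative (\<lambda>h. f' x * h)) (at x)" if "x \<in> S" for x
    using assms(2)[OF that] by (simp add: has_field_derivative_def)
qed (intro Ck_on_mult Ck_on_const assms)

lemma Ck_on_powr: "Ck_on k {0<..} (\<lambda>t::real. t powr r)"
proof (induction k arbitrary: r)
  case 0
  then show ?case by (auto intro!: continuous_intros)
next
  case (Suc k)
  show ?case
    by (rule Ck_on_SucI_real[where f' = "\<lambda>t. r * t powr (r - 1)"])
       (simp, rule has_real_derivative_powr, simp, rule Ck_on_mult[OF open_greaterThan Ck_on_const Suc.IH])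
qed

section \<open>A smooth step function\<close>

text \<open>The family is closed under differentiation up to linear combinations, so that smoothness of all
  members follows by one induction on the order. The member with index 0 is the classical flat
  function.\<close>

definition flat :: "nat \<Rightarrow> real \<Rightarrow> real" where
  "flat j t = (if t \<le> 0 then 0 else exp (- inverse t) * inverse t ^ j)"

lemma flat_tendsto_0: "(flat j \<longlongrightarrow> 0) (at_right 0)"
proof -
  have 1: "((\<lambda>x::real. x ^ j / exp x) \<longlongrightarrow> 0) at_top" by (rule tendsto_power_div_exp_0)
  have "((\<lambda>t::real. inverse t ^ j / exp (inverse t)) \<longlongrightarrow> 0) (at_right 0)"
    by (rule filterlim_compose[OF 1 filterlim_inverse_at_top_right])
  then show ?thesis
  proof (rule Lim_transform_eventually)
    show "\<forall>\<^sub>F t in at_right 0. inverse t ^ j / exp (inverse t) = flat j t"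
      using eventually_at_right_less[of "0::real"]
      by eventually_elim (simp add: flat_def exp_minus field_simps)
  qed
qed

lemma flat_has_derivative:
  "(flat j has_real_derivative (flat (j + 2) t - real j * flat (j + 1) t)) (at t)"
proof -
  consider "t < 0" | "t = 0" | "t > 0" by linarith
  then show ?thesis
  proof cases
    case 1
    have "(flat j has_real_derivative 0) (at t)"
      by (rule has_field_derivative_transform_within_open[where f = "\<lambda>_. 0" and S = "{..<0}"])
         (use 1 in \<open>auto simp: flat_def\<close>)
    then show ?thesis using 1 by (simp add: flat_def)
  next
    case 2
    have "((\<lambda>h. flat j h / h) \<longlongrightarrow> 0) (at_right 0)"
      by (rule Lim_transform_eventually[OF flat_tendsto_0[of "Suc j"]])
         (use eventually_at_right_less[of "0::real"] in \<open>eventually_elim, simp add: flat_def field_simps\<close>)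
    moreover have "((\<lambda>h. flat j h / h) \<longlongrightarrow> 0) (at_left 0)"
      by (rule Lim_transform_eventually[OF tendsto_const])
         (auto simp: flat_def eventually_at_left_field intro!: exI[of _ "-1"])
    ultimately have "((\<lambda>h. flat j h / h) \<longlongrightarrow> 0) (at 0)" by (simp add: filterlim_split_at)
    then show ?thesis using 2 by (simp add: DERIV_def flat_def)
  next
    case 3
    have "((\<lambda>t. exp (- inverse t) * inverse t ^ j) has_real_derivative
        (flat (j + 2) t - real j * flat (j + 1) t)) (at t)"
    proof -
      have "real j * inverse t ^ (j - Suc 0) * inverse t = real j * inverse t ^ j"
        by (cases j) auto
      then show ?thesis using 3
        by (auto intro!: derivative_eq_intros simp: flat_def power2_eq_square algebra_simps)
    qed
    then show ?thesis
      by (rule has_field_derivative_transform_within_open[where S = "{0<..}"])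
         (use 3 in \<open>auto simp: flat_def\<close>)
  qed
qed

lemma flat_smooth: "Ck_on k UNIV (flat j)"
proof (induction k arbitrary: j)
  case 0
  then show ?case by (auto intro!: DERIV_isCont[OF flat_has_derivative] simp: continuous_on_eq_continuous_at)
next
  case (Suc k)
  have "Ck_on k UNIV (\<lambda>t. flat (j + 2) t + (- real j) * flat (j + 1) t)"
    by (intro Ck_on_add Ck_on_mult Ck_on_const Suc.IH open_UNIV)
  then show ?case
    by (intro Ck_on_SucI_real[where f' = "\<lambda>t. flat (j + 2) t + (- real j) * flat (j + 1) t"])
       (use flat_has_derivative[of j] in auto)
qed

text \<open>Vanishing on the right is what makes the antiderivative compactly supported on that side.\<close>

lemma smooth_antiderivative:
  fixes g :: "real \<Rightarrow> real"
  assumes g: "\<And>k. Ck_on k UNIV g" and z: "\<And>t. t \<ge> T \<Longrightarrow> g t = 0"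
  obtains F where "\<And>t. (F has_real_derivative - g t) (at t)" "\<And>k. Ck_on k UNIV F"
    "\<And>t. t \<ge> T \<Longrightarrow> F t = 0"
proof -
  have cont: "continuous_on A g" for A
    using Ck_on_imp_continuous_on[OF open_UNIV g[of 0]] continuous_on_subset by blast
  define F where "F t = integral {t..max t T} g" for t
  have F_eq: "F t = integral {a..b} g - integral {a..t} g" if "a < t" "t < b" "T < b" for a b t
  proof -
    have "integral {a..b} g = integral {a..t} g + integral {t..b} g"
      using that by (simp add: Henstock_Kurzweil_Integration.integral_combine integrable_continuous_real cont)
    also have "integral {t..b} g = integral {t..max t T} g + integral {max t T..b} g"
      using that by (simp add: Henstock_Kurzweil_Integration.integral_combine integrable_continuous_real cont)
    also have "integral {max t T..b} g = integral {max t T..b} (\<lambda>_. 0)"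
      by (rule integral_cong) (simp add: z)
    finally show ?thesis by (simp add: F_def)
  qed
  have der: "(F has_real_derivative - g t) (at t)" for t
  proof -
    define a b where "a = t - 1" and "b = max t T + 1"
    have "((\<lambda>t. integral {a..t} g) has_real_derivative g t) (at t within {a..b})"
      by (rule integral_has_real_derivative[OF cont]) (auto simp: a_def b_def)
    then have "((\<lambda>t. integral {a..t} g) has_real_derivative g t) (at t)"
      by (subst (asm) at_within_interior) (auto simp: a_def b_def)
    then have "((\<lambda>t. integral {a..b} g - integral {a..t} g) has_real_derivative - g t) (at t)"
      by (auto intro!: derivative_eq_intros)
    then show ?thesis
      by (rule has_field_derivative_transform_within_open[where S = "{a<..<b}"])
         (auto simp: a_def b_def intro!: F_eq[symmetric])
  qed
  have "Ck_on k UNIV F" for k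
  proof (cases k)
    case 0
    then show ?thesis by (auto intro!: DERIV_isCont[OF der] simp: continuous_on_eq_continuous_at)
  next
    case (Suc j)
    have "Ck_on j UNIV (\<lambda>t. (-1) * g t)" by (intro Ck_on_mult Ck_on_const g open_UNIV)
    then show ?thesis unfolding Suc by (intro Ck_on_SucI_real[where f' = "\<lambda>t. (-1) * g t"]) (use der in auto)
  qed
  moreover have "F t = 0" if "t \<ge> T" for t using that by (simp add: F_def max_def)
  ultimately show ?thesis using that der by blast
qed

text \<open>The quotient of flat functions is the usual smooth transition from 0 (left of 1) to 1
  (right of 2).\<close>

definition step :: "real \<Rightarrow> real" where
  "step t = flat 0 (t - 1) / (flat 0 (t - 1) + flat 0 (2 - t))"

lemma flat_nonneg: "flat j t \<ge> 0" by (simp add: flat_def)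
lemma flat_pos: "t > 0 \<Longrightarrow> flat j t > 0" by (simp add: flat_def)

lemma step_denom_pos: "flat 0 (t - 1) + flat 0 (2 - t) > 0"
  using flat_nonneg[of 0 "t-1"] flat_nonneg[of 0 "2-t"] flat_pos[of "t-1" 0] flat_pos[of "2-t" 0]
  by (cases "t > 1") auto

lemma step_0: "t \<le> 1 \<Longrightarrow> step t = 0" by (simp add: step_def flat_def)
lemma step_1: "t \<ge> 2 \<Longrightarrow> step t = 1" using step_denom_pos[of t] by (simp add: step_def flat_def)

lemma step_smooth: "Ck_on k UNIV step"
proof -
  have lin: "Ck_on k UNIV (\<lambda>t::real. t + - 1)" "Ck_on k UNIV (\<lambda>t::real. 2 + (-1) * t)" for k
    by (intro Ck_on_add Ck_on_mult Ck_on_const open_UNIV Ck_on_bounded_linear bounded_linear_ident)+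
  have 1: "Ck_on k UNIV (\<lambda>t. flat 0 (t + - 1))" "Ck_on k UNIV (\<lambda>t. flat 0 (2 + (-1) * t))"
    by (rule Ck_on_compose[OF open_UNIV open_UNIV _ lin(1) flat_smooth], simp)
       (rule Ck_on_compose[OF open_UNIV open_UNIV _ lin(2) flat_smooth], simp)
  have "Ck_on k UNIV (\<lambda>t. flat 0 (t + - 1) * (flat 0 (t + - 1) + flat 0 (2 + (-1) * t)) powr (-1))"
    by (intro Ck_on_mult 1 open_UNIV Ck_on_compose[OF open_UNIV _ _ _ Ck_on_powr] Ck_on_add)
       (use step_denom_pos in auto)
  also have "(\<lambda>t. flat 0 (t + - 1) * (flat 0 (t + - 1) + flat 0 (2 + (-1) * t)) powr (-1)) = step"
    using step_denom_pos by (simp add: step_def fun_eq_iff powr_minus_divide less_imp_le)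
  finally show ?thesis .
qed

lemma flat0_mono: "s \<le> t \<Longrightarrow> flat 0 s \<le> flat 0 t"
  unfolding flat_def using le_imp_inverse_le[of s t] by (cases "s \<le> 0") simp_all

lemma step_mono: "s \<le> t \<Longrightarrow> step s \<le> step t"
proof -
  assume st: "s \<le> t"
  have "flat 0 (s - 1) * flat 0 (2 - t) \<le> flat 0 (t - 1) * flat 0 (2 - s)"
    by (intro mult_mono flat0_mono flat_nonneg) (use st in auto)
  then show ?thesis using step_denom_pos[of s] step_denom_pos[of t]
    by (simp add: step_def field_simps)
qed

section \<open>The divergence theorem for compactly supported fields\<close>

lemma lborel_integral_translation:
  fixes g :: "'a::euclidean_space \<Rightarrow> real"
  assumes "g \<in> borel_measurable borel"
  shows "integral\<^sup>L lborel (\<lambda>x. g (h + x)) = integral\<^sup>L lborel g"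
proof -
  have "integral\<^sup>L lborel g = integral\<^sup>L (distr lborel borel ((+) h)) g"
    by (simp add: lborel_distr_plus)
  also have "\<dots> = integral\<^sup>L lborel (\<lambda>x. g (h + x))"
    by (subst integral_distr) (use assms in auto)
  finally show ?thesis by simp
qed

text \<open>The difference quotients of \<open>g\<close> have integral zero by translation invariance. By the mean value
  theorem they are bounded uniformly and converge to the directional derivative, and they live on a
  common bounded set, so dominated convergence applies.\<close>

lemma integral_directional_derivative_eq_0_UNIV:
  fixes g :: "'a::euclidean_space \<Rightarrow> real"
  assumes der: "\<And>x. (g has_derivative g' x) (at x)"
    and cont: "continuous_on UNIV (\<lambda>x. g' x b)"
    and K: "compact K" "\<And>x. x \<notin> K \<Longrightarrow> g x = 0"
  shows "integral\<^sup>L lborel (\<lambda>x. g' x b) = 0"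
proof -
  have g_cont: "continuous_on UNIV g"
    using der has_derivative_continuous by (metis continuous_at_imp_continuous_on)
  then have g_meas[measurable]: "g \<in> borel_measurable borel" by (rule borel_measurable_continuous_onI)
  have g'_meas[measurable]: "(\<lambda>x. g' x b) \<in> borel_measurable borel"
    by (rule borel_measurable_continuous_onI[OF cont])
  have g'0: "g' x b = 0" if "x \<notin> K" for x
  proof -
    have "(g has_derivative (\<lambda>_. 0)) (at x)"
      by (rule has_derivative_transform_within_open[where f = "\<lambda>_. 0" and s = "- K"])
         (use that K compact_imp_closed in auto)
    then have "g' x = (\<lambda>_. 0)" using der has_derivative_unique by blast
    then show ?thesis by simp
  qed
  have "bounded ((\<lambda>x. g' x b) ` K)"
    by (intro compact_imp_bounded compact_continuous_image K continuous_on_subset[OF cont]) auto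
  then obtain B where B: "B > 0" "\<And>x. x \<in> K \<Longrightarrow> \<bar>g' x b\<bar> \<le> B"
    unfolding bounded_pos by auto
  have B': "\<bar>g' x b\<bar> \<le> B" for x using B g'0[of x] by (cases "x \<in> K") auto
  obtain r where r: "\<And>x. x \<in> K \<Longrightarrow> norm x \<le> r"
    using compact_imp_bounded[OF K(1)] unfolding bounded_iff by auto
  define q where "q k x = (g (b /\<^sub>R real (Suc k) + x) - g x) * real (Suc k)" for k x
  have mvt: "\<exists>z. 0 < z \<and> z < 1 / real (Suc k) \<and> q k x = g' (x + z *\<^sub>R b) b" for k x
  proof -
    have "((\<lambda>t. g (x + t *\<^sub>R b)) has_real_derivative g' (x + t *\<^sub>R b) b) (at t)" for t
    proof -
      have 1: "((\<lambda>t. x + t *\<^sub>R b) has_derivative (\<lambda>t. t *\<^sub>R b)) (at t)"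
        by (auto intro!: derivative_eq_intros)
      have "((\<lambda>t. g (x + t *\<^sub>R b)) has_derivative (\<lambda>h. g' (x + t *\<^sub>R b) (h *\<^sub>R b))) (at t)"
        by (rule has_derivative_compose[OF 1 der])
      moreover have "(\<lambda>h. g' (x + t *\<^sub>R b) (h *\<^sub>R b)) = (\<lambda>h. g' (x + t *\<^sub>R b) b * h)"
        using linear_scale[OF has_derivative_linear[OF der]] by (auto simp: mult.commute)
      ultimately show ?thesis by (simp add: has_field_derivative_def)
    qed
    then have "\<exists>z>0. z < 1 / real (Suc k) \<and> g (x + (1 / real (Suc k)) *\<^sub>R b) - g (x + 0 *\<^sub>R b)
        = (1 / real (Suc k) - 0) * g' (x + z *\<^sub>R b) b"
      by (intro MVT2[of 0 "1 / real (Suc k)" "\<lambda>t. g (x + t *\<^sub>R b)" "\<lambda>t. g' (x + t *\<^sub>R b) b"]) simp_all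
    then obtain z where z: "0 < z" "z < 1 / real (Suc k)"
      and eq: "g (x + (1 / real (Suc k)) *\<^sub>R b) - g (x + 0 *\<^sub>R b) = (1 / real (Suc k) - 0) * g' (x + z *\<^sub>R b) b"
      by blast
    have "q k x = (g (x + (1 / real (Suc k)) *\<^sub>R b) - g (x + 0 *\<^sub>R b)) * real (Suc k)"
      by (simp add: q_def divide_inverse add.commute)
    also have "\<dots> = g' (x + z *\<^sub>R b) b" unfolding eq by simp
    finally show ?thesis using z by blast
  qed
  have lim: "(\<lambda>k. q k x) \<longlonglongrightarrow> g' x b" for x
  proof -
    obtain z where z: "\<And>k. 0 < z k" "\<And>k. z k < 1 / real (Suc k)" "\<And>k. q k x = g' (x + z k *\<^sub>R b) b"
      using mvt[of _ x] by metis
    have "z \<longlonglongrightarrow> 0"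
    proof (rule tendsto_sandwich[of "\<lambda>_. 0" _ _ "\<lambda>k. inverse (real (Suc k))"])
      show "(\<lambda>k. inverse (real (Suc k))) \<longlonglongrightarrow> 0" by (rule LIMSEQ_inverse_real_of_nat)
    qed (use z(1,2) in \<open>auto intro!: always_eventually less_imp_le simp: inverse_eq_divide\<close>)
    then have "(\<lambda>k. x + z k *\<^sub>R b) \<longlonglongrightarrow> x + 0 *\<^sub>R b" by (intro tendsto_intros)
    then have "(\<lambda>k. g' (x + z k *\<^sub>R b) b) \<longlonglongrightarrow> g' (x + 0 *\<^sub>R b) b"
      using cont by (intro isCont_tendsto_compose[of _ "\<lambda>x. g' x b"]) (auto simp: continuous_on_eq_continuous_at)
    then show ?thesis using z(3) by simp
  qed
  define w where "w x = B * indicator (cball 0 (r + norm b)) x" for x :: 'a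
  have bound: "norm (q k x) \<le> w x" for k x
  proof (cases "norm x \<le> r + norm b")
    case True
    then show ?thesis using mvt[of k x] B' by (auto simp: w_def)
  next
    case False
    have "norm (b /\<^sub>R real (Suc k)) \<le> norm b"
      by (simp add: field_simps)
    moreover have "norm x - norm (b /\<^sub>R real (Suc k)) \<le> norm (b /\<^sub>R real (Suc k) + x)"
      using norm_triangle_ineq2[of x "- (b /\<^sub>R real (Suc k))"] by (simp add: add.commute)
    ultimately have "norm (b /\<^sub>R real (Suc k) + x) > r" "norm x > r"
      using False norm_ge_zero[of b] by linarith+
    then have "g (b /\<^sub>R real (Suc k) + x) = 0" "g x = 0" using r K(2) by (metis not_less)+
    then show ?thesis using B by (simp add: q_def w_def)
  qed
  have "integrable lborel w" unfolding w_def
    by (intro integrable_mult_right) (auto intro!: integrable_real_indicator emeasure_lborel_cball_finite)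
  have conv: "(\<lambda>k. integral\<^sup>L lborel (q k)) \<longlonglongrightarrow> integral\<^sup>L lborel (\<lambda>x. g' x b)"
  proof (rule integral_dominated_convergence[where w = w])
    show "q k \<in> borel_measurable lborel" for k unfolding q_def by measurable
  qed (use \<open>integrable lborel w\<close> lim bound in auto)
  have g_int: "integrable lborel (\<lambda>x. g (h + x))" for h
  proof -
    have "integrable lborel g"
    proof -
      obtain C where C: "\<And>x. x \<in> K \<Longrightarrow> \<bar>g x\<bar> \<le> C"
        using compact_imp_bounded[OF compact_continuous_image[OF continuous_on_subset[OF g_cont] K(1)]]
        unfolding bounded_iff by auto
      show ?thesis
        by (rule integrableI_bounded_set[of K _ _ C])
           (use C K emeasure_compact_finite borel_compact[OF K(1)] in auto)
    qed
    then have "integrable (distr lborel borel ((+) h)) g" by (simp add: lborel_distr_plus)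
    then show ?thesis by (subst (asm) integrable_distr_eq) auto
  qed
  have "integral\<^sup>L lborel (q k) = 0" for k
    unfolding q_def using g_int[of "b /\<^sub>R real (Suc k)"] g_int[of 0]
    by (simp add: lborel_integral_translation Bochner_Integration.integral_diff)
  then show ?thesis using conv LIMSEQ_unique[OF _ tendsto_const] by auto
qed

lemma integral_directional_derivative_eq_0:
  fixes g :: "'a::euclidean_space \<Rightarrow> real"
  assumes S: "open S" and der: "\<And>x. x \<in> S \<Longrightarrow> (g has_derivative g' x) (at x)"
    and cont: "continuous_on S (\<lambda>x. g' x b)"
    and K: "compact K" "K \<subseteq> S" "\<And>x. x \<in> S - K \<Longrightarrow> g x = 0"
  shows "integral\<^sup>L lborel (\<lambda>x. indicator S x * g' x b) = 0"
proof -
  define G where "G x = (if x \<in> S then g x else 0)" for x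
  define G' where "G' x = (if x \<in> S then g' x else (\<lambda>_. 0))" for x
  have o: "open (- K)" using K compact_imp_closed by auto
  have derG0: "(G has_derivative (\<lambda>_. 0)) (at x)" if "x \<notin> K" for x
    by (rule has_derivative_transform_within_open[where f = "\<lambda>_. 0" and s = "- K"])
       (use that K o in \<open>auto simp: G_def\<close>)
  have derG: "(G has_derivative G' x) (at x)" for x
  proof (cases "x \<in> S")
    case True
    show ?thesis
      by (rule has_derivative_transform_within_open[where f = g and s = S])
         (use True der S in \<open>auto simp: G_def G'_def\<close>)
  next
    case False
    then show ?thesis using derG0[of x] K(2) by (auto simp: G'_def)
  qed
  have z: "G' x b = 0" if "x \<notin> K" for x
    using has_derivative_unique[OF derG derG0[OF that]] by simp
  have "continuous_on (S \<union> - K) (\<lambda>x. G' x b)"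
  proof (rule continuous_on_open_Un[OF S o])
    show "continuous_on S (\<lambda>x. G' x b)" using cont by (rule continuous_on_eq) (simp add: G'_def)
    show "continuous_on (- K) (\<lambda>x. G' x b)" by (rule continuous_on_eq[OF continuous_on_const[of _ 0]]) (simp add: z)
  qed
  moreover have "S \<union> - K = UNIV" using K by auto
  ultimately have "integral\<^sup>L lborel (\<lambda>x. G' x b) = 0"
    by (intro integral_directional_derivative_eq_0_UNIV[OF derG _ K(1)]) (use K in \<open>auto simp: G_def\<close>)
  moreover have "(\<lambda>x. G' x b) = (\<lambda>x. indicator S x * g' x b)" by (auto simp: G'_def indicator_def)
  ultimately show ?thesis by simp
qed

section \<open>Hyperbolic volume\<close>

lemma hyp_space_open: "open hyp_space" by (simp add: hyp_space_def)

lemma hyp_spaceD: "x \<in> hyp_space \<Longrightarrow> (norm x)\<^sup>2 < 1" 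
  by (simp add: hyp_space_def abs_square_less_1)

lemma space_hyp_vol [simp]: "space hyp_vol = hyp_space"
  by (simp add: hyp_vol_def space_restrict_space)

lemma sets_hyp_vol: "sets hyp_vol = sets (restrict_space borel hyp_space)"
  by (simp add: hyp_vol_def sets_restrict_space)

lemma sets_hyp_vol_iff: "A \<in> sets hyp_vol \<longleftrightarrow> A \<in> sets borel \<and> A \<subseteq> hyp_space"
  unfolding sets_hyp_vol by (subst sets_restrict_space_iff) (auto simp: hyp_space_open borel_open)

lemma measurable_hyp_vol_cong: "measurable hyp_vol N = measurable (restrict_space borel hyp_space) N"
  by (rule measurable_cong_sets[OF sets_hyp_vol refl])

lemma continuous_imp_measurable_hyp_vol:
  fixes f :: "_ \<Rightarrow> 'b::topological_space"
  shows "continuous_on hyp_space f \<Longrightarrow> f \<in> borel_measurable hyp_vol"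
  unfolding measurable_hyp_vol_cong by (rule borel_measurable_continuous_on_restrict)

lemma conformal_factor_pos: "x \<in> hyp_space \<Longrightarrow> conformal_factor x > 0"
  using hyp_spaceD[of x] by (simp add: conformal_factor_def)

lemma continuous_conformal_factor: "continuous_on hyp_space conformal_factor"
  unfolding conformal_factor_def by (intro continuous_intros) (use hyp_spaceD in force)

lemma conformal_factor_power_measurable:
  "(\<lambda>x. conformal_factor x ^ k) \<in> borel_measurable (restrict_space borel hyp_space)"
  by (intro borel_measurable_continuous_on_restrict continuous_intros continuous_conformal_factor)

lemma hyp_vol_integral:
  fixes f :: "'a::euclidean_space \<Rightarrow> real"
  assumes "f \<in> borel_measurable hyp_vol"
  shows "integral\<^sup>L hyp_vol f = integral\<^sup>L lborel (\<lambda>x. indicator hyp_space x * (conformal_factor x ^ DIM('a) * f x))"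
    "integrable hyp_vol f \<longleftrightarrow> integrable lborel (\<lambda>x. indicator hyp_space x * (conformal_factor x ^ DIM('a) * f x))"
proof -
  have [measurable]: "f \<in> borel_measurable (restrict_space lborel hyp_space)"
    "(\<lambda>x. conformal_factor x ^ DIM('a)) \<in> borel_measurable (restrict_space lborel (hyp_space :: 'a set))"
    using assms conformal_factor_power_measurable
    by (simp_all add: measurable_hyp_vol_cong cong: measurable_cong_sets sets_restrict_space_cong)
  have ae: "AE x in restrict_space lborel (hyp_space :: 'a set). 0 \<le> conformal_factor x ^ DIM('a)"
    using less_imp_le[OF conformal_factor_pos] by (intro AE_I2 zero_le_power) (simp add: space_restrict_space)
  show "integral\<^sup>L hyp_vol f = integral\<^sup>L lborel (\<lambda>x. indicator hyp_space x * (conformal_factor x ^ DIM('a) * f x))"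
    unfolding hyp_vol_def
    by (subst integral_density[OF _ _ ae]) (auto simp: integral_restrict_space hyp_space_open)
  show "integrable hyp_vol f \<longleftrightarrow> integrable lborel (\<lambda>x. indicator hyp_space x * (conformal_factor x ^ DIM('a) * f x))"
    unfolding hyp_vol_def
    by (subst integrable_density[OF _ _ ae]) (auto simp: integrable_restrict_space hyp_space_open)
qed

lemma emeasure_hyp_vol:
  fixes A :: "'a::euclidean_space set"
  assumes "A \<in> sets hyp_vol"
  shows "emeasure hyp_vol A = (\<integral>\<^sup>+ x. ennreal (conformal_factor x ^ DIM('a)) * indicator A x \<partial>lborel)"
proof -
  have [measurable]: "(\<lambda>x. ennreal (conformal_factor x ^ DIM('a))) \<in> borel_measurable (restrict_space lborel (hyp_space :: 'a set))"
    using conformal_factor_power_measurable[of "DIM('a)", where 'a = 'a]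
    by (simp cong: measurable_cong_sets sets_restrict_space_cong)
  have [measurable]: "A \<in> sets borel" and A: "A \<subseteq> hyp_space" using assms by (auto simp: sets_hyp_vol_iff)
  have "emeasure hyp_vol A = (\<integral>\<^sup>+ x. ennreal (conformal_factor x ^ DIM('a)) * indicator A x \<partial>(restrict_space lborel hyp_space))"
    unfolding hyp_vol_def
    by (subst emeasure_density) (use assms in \<open>auto simp: hyp_vol_def\<close>)
  also have "\<dots> = (\<integral>\<^sup>+ x. ennreal (conformal_factor x ^ DIM('a)) * indicator A x * indicator hyp_space x \<partial>lborel)"
    by (subst nn_integral_restrict_space) (auto simp: hyp_space_open)
  also have "\<dots> = (\<integral>\<^sup>+ x. ennreal (conformal_factor x ^ DIM('a)) * indicator A x \<partial>lborel)"
    by (rule nn_integral_cong) (use A in \<open>auto simp: indicator_def\<close>)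
  finally show ?thesis .
qed

lemma emeasure_hyp_vol_compact_finite:
  fixes K :: "'a::euclidean_space set"
  assumes "compact K" "K \<subseteq> hyp_space"
  shows "emeasure hyp_vol K < \<infinity>"
proof -
  have K: "K \<in> sets borel" using compact_imp_closed[OF assms(1)] by (rule borel_closed)
  have "bounded ((\<lambda>x. conformal_factor x ^ DIM('a)) ` K)"
    by (intro compact_imp_bounded compact_continuous_image assms continuous_intros
        continuous_on_subset[OF continuous_conformal_factor])
  then obtain B where B: "\<And>x. x \<in> K \<Longrightarrow> conformal_factor x ^ DIM('a) \<le> B"
    unfolding bounded_iff by (auto simp: abs_le_iff)
  have "emeasure hyp_vol K = (\<integral>\<^sup>+ x. ennreal (conformal_factor x ^ DIM('a)) * indicator K x \<partial>lborel)"
    by (rule emeasure_hyp_vol) (use K assms in \<open>auto simp: sets_hyp_vol_iff\<close>)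
  also have "\<dots> \<le> (\<integral>\<^sup>+ x. ennreal B * indicator K x \<partial>lborel)"
    by (rule nn_integral_mono) (use B in \<open>auto simp: indicator_def intro!: ennreal_leI\<close>)
  also have "\<dots> = ennreal B * emeasure lborel K" by (rule nn_integral_cmult_indicator) (use K in auto)
  also have "\<dots> < \<infinity>" using emeasure_compact_finite[OF assms(1)] by (auto simp: ennreal_mult_less_top)
  finally show ?thesis .
qed

lemma hyp_integrable_compact_support:
  fixes f :: "'a::euclidean_space \<Rightarrow> real"
  assumes "f \<in> borel_measurable hyp_vol" "compact K" "K \<subseteq> hyp_space"
    and "\<And>x. x \<in> K \<Longrightarrow> \<bar>f x\<bar> \<le> B" "\<And>x. x \<in> hyp_space - K \<Longrightarrow> f x = 0"
  shows "integrable hyp_vol f"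
  by (rule integrableI_bounded_set[of K _ _ B])
     (use assms emeasure_hyp_vol_compact_finite[OF assms(2,3)] compact_imp_closed[OF assms(2)]
      in \<open>auto simp: sets_hyp_vol_iff intro!: AE_I2\<close>)

lemma hyp_integrable_continuous:
  fixes f :: "'a::euclidean_space \<Rightarrow> real"
  assumes "continuous_on hyp_space f" "compact K" "K \<subseteq> hyp_space"
    and "\<And>x. x \<in> hyp_space - K \<Longrightarrow> f x = 0"
  shows "integrable hyp_vol f"
proof -
  have "bounded (f ` K)"
    by (intro compact_imp_bounded compact_continuous_image assms continuous_on_subset[OF assms(1)])
  then obtain B where "\<And>x. x \<in> K \<Longrightarrow> \<bar>f x\<bar> \<le> B" unfolding bounded_iff by auto
  then show ?thesis
    by (intro hyp_integrable_compact_support[OF continuous_imp_measurable_hyp_vol[OF assms(1)] assms(2,3)] assms(4))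
qed

text \<open>The density is at least 1, so the claim reduces to Lebesgue measure.\<close>

lemma emeasure_hyp_vol_open_pos:
  fixes U :: "'a::euclidean_space set"
  assumes "open U" "U \<subseteq> hyp_space" "U \<noteq> {}"
  shows "emeasure hyp_vol U > 0"
proof -
  have U: "U \<in> sets hyp_vol" using assms by (simp add: sets_hyp_vol_iff)
  have "(\<integral>\<^sup>+ x. indicator U x \<partial>lborel) \<le> (\<integral>\<^sup>+ x. ennreal (conformal_factor x ^ DIM('a)) * indicator U x \<partial>lborel)"
  proof (rule nn_integral_mono)
    fix x :: 'a
    show "indicator U x \<le> ennreal (conformal_factor x ^ DIM('a)) * indicator U x"
    proof (cases "x \<in> U")
      case True
      then have "(norm x)\<^sup>2 < 1" using assms hyp_spaceD by auto
      then have "conformal_factor x \<ge> 1" by (simp add: conformal_factor_def field_simps)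
      then show ?thesis using True by simp
    qed simp
  qed
  then have "emeasure lborel U \<le> emeasure hyp_vol U" using U assms(1) by (simp add: emeasure_hyp_vol)
  moreover have "emeasure lborel U \<noteq> 0"
    using assms open_not_negligible[OF assms(1,3)] by (simp add: negligible_iff_emeasure0 borel_open emeasure_completion)
  ultimately show ?thesis by (metis leD not_gr_zero)
qed

lemma hyp_integral_pos:
  fixes f :: "'a::euclidean_space \<Rightarrow> real"
  assumes int: "integrable hyp_vol f" and nonneg: "\<And>x. x \<in> hyp_space \<Longrightarrow> 0 \<le> f x"
    and U: "A \<in> sets hyp_vol" "emeasure hyp_vol A > 0" "\<And>x. x \<in> A \<Longrightarrow> f x > 0"
  shows "integral\<^sup>L hyp_vol f > 0"
proof -
  have "integral\<^sup>L hyp_vol f \<ge> 0" by (rule Bochner_Integration.integral_nonneg) (use nonneg in auto)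
  moreover have "integral\<^sup>L hyp_vol f \<noteq> 0"
  proof
    assume "integral\<^sup>L hyp_vol f = 0"
    then have "AE x in hyp_vol. f x = 0"
      using integral_nonneg_eq_0_iff_AE[OF int AE_I2] nonneg by auto
    then have "AE x in hyp_vol. x \<notin> A" by eventually_elim (use U in force)
    then have "A \<in> null_sets hyp_vol" using U(1) by (simp add: AE_iff_null_sets)
    then show False using U(2) by auto
  qed
  ultimately show ?thesis by linarith
qed

section \<open>Functions of the hyperbolic distance\<close>

text \<open>Working with the hyperbolic cosine of the distance keeps everything rational in the coordinates;
  in particular it is smooth on the diagonal, where the distance is not.\<close>

definition cosh_dist :: "'a::euclidean_space \<Rightarrow> 'a \<Rightarrow> real" where
  "cosh_dist x y = 1 + 2 * (norm (x - y))\<^sup>2 / ((1 - (norm x)\<^sup>2) * (1 - (norm y)\<^sup>2))"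

text \<open>The two components of the point of the hyperboloid that corresponds to \<open>x\<close> are
  \<open>conformal_factor x - 1\<close> and \<open>conformal_factor x *\<^sub>R x\<close>. \<open>cosh_dist x y\<close> is minus their Lorentz
  product, and \<open>dist_dir x y\<close> is the gradient of \<open>cosh_dist x\<close> at \<open>y\<close> up to the factor
  \<open>conformal_factor y\<close>.\<close>

definition dist_dir :: "'a::euclidean_space \<Rightarrow> 'a \<Rightarrow> 'a" where
  "dist_dir x y = (cosh_dist x y + conformal_factor x - 1) *\<^sub>R y - conformal_factor x *\<^sub>R x"

lemma cosh_dist_commute: "cosh_dist x y = cosh_dist y x"
  by (simp add: cosh_dist_def norm_minus_commute mult.commute)

lemma hyp_dist_eq_arcosh: "hyp_dist x y = arcosh (cosh_dist x y)"
  by (simp add: hyp_dist_def cosh_dist_def)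

lemma cosh_dist_ge_1: "x \<in> hyp_space \<Longrightarrow> y \<in> hyp_space \<Longrightarrow> cosh_dist x y \<ge> 1"
  using hyp_spaceD[of x] hyp_spaceD[of y] by (auto simp: cosh_dist_def)

lemma cosh_dist_self [simp]: "cosh_dist x x = 1"
  by (simp add: cosh_dist_def)

lemma cosh_dist_gt_1:
  assumes "x \<in> hyp_space" "y \<in> hyp_space" "x \<noteq> y" shows "cosh_dist x y > 1"
proof -
  have "(1 - (norm x)\<^sup>2) * (1 - (norm y)\<^sup>2) > 0"
    using hyp_spaceD[of x] hyp_spaceD[of y] assms by (intro mult_pos_pos) auto
  then show ?thesis using assms by (simp add: cosh_dist_def divide_pos_pos)
qed

lemma hyp_space_denom: "x \<in> hyp_space \<Longrightarrow> 1 - x \<bullet> x > 0"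
  using hyp_spaceD[of x] by (simp add: power2_norm_eq_inner)

lemma cosh_dist_conformal:
  "cosh_dist x y = 1 + conformal_factor x * conformal_factor y * (norm (x - y))\<^sup>2 / 2"
  by (simp add: cosh_dist_def conformal_factor_def)

lemma cosh_dist_lorentz:
  assumes "x \<in> hyp_space" "y \<in> hyp_space"
  shows "cosh_dist x y = (conformal_factor x - 1) * (conformal_factor y - 1)
    - conformal_factor x * conformal_factor y * (x \<bullet> y)"
proof -
  define P Q p where "P = 1 - x \<bullet> x" and "Q = 1 - y \<bullet> y" and "p = x \<bullet> y"
  have "P > 0" "Q > 0" using assms hyp_space_denom by (auto simp: P_def Q_def)
  then have "1 + 2 * ((1 - P) + (1 - Q) - 2 * p) / (P * Q) = (2 / P - 1) * (2 / Q - 1) - 2 / P * (2 / Q) * p"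
    by (simp add: field_simps)
  moreover have "(norm (x - y))\<^sup>2 = (1 - P) + (1 - Q) - 2 * p"
    by (simp add: P_def Q_def p_def power2_norm_eq_inner inner_diff inner_commute)
  ultimately show ?thesis
    by (simp add: cosh_dist_def conformal_factor_def power2_norm_eq_inner[of x] power2_norm_eq_inner[of y]
        P_def Q_def p_def)
qed

lemma norm_via_conformal:
  "x \<in> hyp_space \<Longrightarrow> x \<bullet> x = 1 - 2 / conformal_factor x"
  using hyp_space_denom[of x] by (simp add: conformal_factor_def power2_norm_eq_inner field_simps)

text \<open>With the derivative of \<open>cosh_dist\<close> below, the first identity is the eikonal equation
  $|\nabla \cosh d|^2 = \sinh^2 d$; the second one enters the divergence of the same field.\<close>

lemma dist_dir_inner_self:
  assumes "x \<in> hyp_space" "y \<in> hyp_space"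
  shows "dist_dir x y \<bullet> dist_dir x y = (cosh_dist x y)\<^sup>2 - 1"
    and "y \<bullet> dist_dir x y = cosh_dist x y - (cosh_dist x y + conformal_factor x - 1) / conformal_factor y"
proof -
  define l m s p where "l = conformal_factor x" and "m = conformal_factor y"
    and "s = cosh_dist x y" and "p = x \<bullet> y"
  have pos: "l > 0" "m > 0" using assms conformal_factor_pos by (auto simp: l_def m_def)
  have s: "s = (l - 1) * (m - 1) - l * m * p" using cosh_dist_lorentz[OF assms] by (simp add: l_def m_def s_def p_def)
  then have p: "p = ((l - 1) * (m - 1) - s) / (l * m)" using pos by (simp add: field_simps)
  have xx: "x \<bullet> x = 1 - 2 / l" "y \<bullet> y = 1 - 2 / m"
    using norm_via_conformal assms by (auto simp: l_def m_def)
  have "dist_dir x y \<bullet> dist_dir x y = (s + l - 1)\<^sup>2 * (y \<bullet> y) - 2 * (s + l - 1) * l * p + l\<^sup>2 * (x \<bullet> x)"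
    unfolding dist_dir_def l_def[symmetric] s_def[symmetric] p_def
    by (simp add: inner_diff inner_commute power2_eq_square algebra_simps)
  also have "\<dots> = (s + l - 1)\<^sup>2 * (1 - 2 / m) - 2 * (s + l - 1) * l * p + l\<^sup>2 * (1 - 2 / l)"
    unfolding xx ..
  also have "\<dots> = s\<^sup>2 - 1" unfolding p using pos by (simp add: field_simps power2_eq_square)
  finally show "dist_dir x y \<bullet> dist_dir x y = (cosh_dist x y)\<^sup>2 - 1" by (simp add: s_def)
  have "y \<bullet> dist_dir x y = (s + l - 1) * (y \<bullet> y) - l * p"
    unfolding dist_dir_def l_def[symmetric] s_def[symmetric] p_def
    by (simp add: inner_diff inner_commute)
  also have "\<dots> = (s + l - 1) * (1 - 2 / m) - l * p"
    unfolding xx ..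
  also have "\<dots> = s - (s + l - 1) / m" unfolding p using pos by (simp add: field_simps)
  finally show "y \<bullet> dist_dir x y = cosh_dist x y - (cosh_dist x y + conformal_factor x - 1) / conformal_factor y"
    by (simp add: s_def l_def m_def)
qed

lemma conformal_factor_has_derivative:
  assumes "y \<in> hyp_space"
  shows "(conformal_factor has_derivative (\<lambda>v. (conformal_factor y)\<^sup>2 * (y \<bullet> v))) (at y)"
proof -
  have "((\<lambda>y. 2 / (1 - y \<bullet> y)) has_derivative (\<lambda>v. (2 / (1 - y \<bullet> y))\<^sup>2 * (y \<bullet> v))) (at y)"
    using hyp_space_denom[OF assms]
    by (auto intro!: derivative_eq_intros simp: fun_eq_iff inner_commute power2_eq_square field_simps)
  then show ?thesis by (simp add: conformal_factor_def[abs_def] power2_norm_eq_inner)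
qed

lemma cosh_dist_has_derivative:
  assumes "x \<in> hyp_space" "y \<in> hyp_space"
  shows "(cosh_dist x has_derivative (\<lambda>v. conformal_factor y * (dist_dir x y \<bullet> v))) (at y)"
proof -
  define l where "l = conformal_factor x"
  define m where "m = conformal_factor y"
  have s: "cosh_dist x y = (l - 1) * (m - 1) - l * m * (x \<bullet> y)"
    using cosh_dist_lorentz[OF assms] by (simp add: l_def m_def)
  have "((\<lambda>y. (l - 1) * (conformal_factor y - 1) - l * conformal_factor y * (x \<bullet> y)) has_derivative
      (\<lambda>v. (l - 1) * (m\<^sup>2 * (y \<bullet> v)) - (l * m * (x \<bullet> v) + l * (m\<^sup>2 * (y \<bullet> v)) * (x \<bullet> y)))) (at y)"
    unfolding m_def
    by (auto intro!: derivative_eq_intros conformal_factor_has_derivative[OF assms(2)])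
  also have "(\<lambda>v. (l - 1) * (m\<^sup>2 * (y \<bullet> v)) - (l * m * (x \<bullet> v) + l * (m\<^sup>2 * (y \<bullet> v)) * (x \<bullet> y)))
      = (\<lambda>v. m * (dist_dir x y \<bullet> v))"
    unfolding dist_dir_def s l_def[symmetric]
    by (simp add: fun_eq_iff inner_diff algebra_simps power2_eq_square)
  finally show ?thesis unfolding m_def
    by (rule has_derivative_transform_within_open[OF _ hyp_space_open assms(2)])
       (simp add: l_def cosh_dist_lorentz[OF assms(1)])
qed

lemma continuous_on_cosh_dist: "x \<in> hyp_space \<Longrightarrow> continuous_on hyp_space (cosh_dist x)"
  by (meson cosh_dist_has_derivative has_derivative_at_withinI has_derivative_continuous_on)

lemma continuous_on_dist_dir: "x \<in> hyp_space \<Longrightarrow> continuous_on hyp_space (dist_dir x)"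
  unfolding dist_dir_def by (intro continuous_intros continuous_on_cosh_dist)

text \<open>After clearing denominators the condition is closed in the closed unit ball, and on the unit
  sphere it would force \<open>y = x\<close>.\<close>

lemma compact_cosh_ball:
  assumes "x \<in> hyp_space" shows "compact {y \<in> hyp_space. cosh_dist x y \<le> T}"
proof -
  define D where "D = {y. norm y \<le> 1 \<and> 2 * (norm (x - y))\<^sup>2 \<le> (T - 1) * ((1 - (norm x)\<^sup>2) * (1 - (norm y)\<^sup>2))}"
  have P: "1 - (norm x)\<^sup>2 > 0" using hyp_spaceD[OF assms] by simp
  have "y \<in> D \<longleftrightarrow> y \<in> {y \<in> hyp_space. cosh_dist x y \<le> T}" for y
  proof (cases "norm y < 1")
    case True
    then have "y \<in> hyp_space" "1 - (norm y)\<^sup>2 > 0" by (auto simp: hyp_space_def abs_square_less_1)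
    then have "1 + 2 * (norm (x - y))\<^sup>2 / ((1 - (norm x)\<^sup>2) * (1 - (norm y)\<^sup>2)) \<le> T \<longleftrightarrow>
        2 * (norm (x - y))\<^sup>2 \<le> (T - 1) * ((1 - (norm x)\<^sup>2) * (1 - (norm y)\<^sup>2))"
      using pos_divide_le_eq[OF mult_pos_pos[OF P], of "1 - (norm y)\<^sup>2" "2 * (norm (x - y))\<^sup>2" "T - 1"] by linarith
    then show ?thesis using True \<open>y \<in> hyp_space\<close> by (simp add: D_def cosh_dist_def)
  next
    case False
    have "y \<notin> D"
    proof
      assume y: "y \<in> D"
      then have "norm y = 1" using False by (simp add: D_def)
      then have "norm (x - y) = 0" using y by (simp add: D_def)
      then show False using \<open>norm y = 1\<close> P by simp
    qed
    then show ?thesis using False by (simp add: hyp_space_def)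
  qed
  then have "{y \<in> hyp_space. cosh_dist x y \<le> T} = D" by blast
  moreover have "D \<subseteq> cball 0 1" by (auto simp: D_def)
  moreover have "closed D" unfolding D_def
    by (intro closed_Collect_conj closed_Collect_le continuous_intros)
  ultimately show ?thesis by (metis bounded_cball bounded_subset compact_eq_bounded_closed)
qed

lemma Ck_on_cosh_dist: "x \<in> hyp_space \<Longrightarrow> Ck_on k hyp_space (cosh_dist x)"
proof -
  assume x: "x \<in> hyp_space"
  have lin: "Ck_on k hyp_space (\<lambda>y::'a. z \<bullet> y)" "Ck_on k hyp_space (\<lambda>y::'a. y \<bullet> z)" for k z
    by (rule Ck_on_bounded_linear[OF hyp_space_open], rule bounded_linear_inner_right)
       (rule Ck_on_bounded_linear[OF hyp_space_open], rule bounded_linear_inner_left)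
  have sq: "Ck_on k hyp_space (\<lambda>y::'a. y \<bullet> y)"
  proof (cases k)
    case 0
    then show ?thesis by (auto intro!: continuous_intros)
  next
    case (Suc j)
    show ?thesis unfolding Suc
      by (rule Ck_on_SucI[OF hyp_space_open, where f' = "\<lambda>y v. y \<bullet> v + v \<bullet> y"])
         (auto intro!: derivative_eq_intros Ck_on_add[OF hyp_space_open] lin)
  qed
  define l where "l = conformal_factor x"
  have den: "Ck_on k hyp_space (\<lambda>y::'a. (1 + (-1) * (y \<bullet> y)) powr (-1))"
    by (intro Ck_on_compose[OF hyp_space_open open_greaterThan _ _ Ck_on_powr] Ck_on_add Ck_on_mult
        Ck_on_const sq hyp_space_open) (use hyp_space_denom in force)
  have "Ck_on k hyp_space (\<lambda>y. (l - 1) * (2 * (1 + (-1) * (y \<bullet> y)) powr (-1) + (-1)) +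
      ((-1) * l) * (2 * (1 + (-1) * (y \<bullet> y)) powr (-1)) * (x \<bullet> y))"
    by (intro Ck_on_add Ck_on_mult Ck_on_const den lin hyp_space_open)
  then show ?thesis
  proof (rule Ck_on_cong[OF hyp_space_open, THEN iffD1, rotated])
    fix y :: 'a assume y: "y \<in> hyp_space"
    have "(1 + (-1) * (y \<bullet> y)) powr (-1) = 1 / (1 - y \<bullet> y)"
      using hyp_space_denom[OF y] by (simp add: powr_minus_divide)
    then show "(l - 1) * (2 * (1 + (-1) * (y \<bullet> y)) powr (-1) + (-1)) +
      ((-1) * l) * (2 * (1 + (-1) * (y \<bullet> y)) powr (-1)) * (x \<bullet> y) = cosh_dist x y"
      by (simp add: cosh_dist_lorentz[OF x y] l_def conformal_factor_def[of y] power2_norm_eq_inner)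
  qed
qed

definition grad :: "('a::euclidean_space \<Rightarrow> real) \<Rightarrow> 'a \<Rightarrow> 'a" where
  "grad u x = (\<Sum>b\<in>Basis. frechet_derivative u (at x) b *\<^sub>R b)"

lemma grad_inner:
  assumes "(u has_derivative u') (at x)"
  shows "grad u x \<bullet> v = u' v"
proof -
  have "grad u x \<bullet> v = (\<Sum>b\<in>Basis. (b \<bullet> v) * u' b)"
    using frechet_derivative_at[OF assms] by (simp add: grad_def inner_sum_left mult.commute)
  also have "\<dots> = u' (\<Sum>b\<in>Basis. (v \<bullet> b) *\<^sub>R b)"
    using has_derivative_linear[OF assms] by (simp add: linear_sum linear_scale inner_commute)
  also have "\<dots> = u' v" by (simp add: euclidean_representation)
  finally show ?thesis .
qed

lemma hyp_metric_grad:
  assumes "y \<in> hyp_space"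
  shows "hyp_metric y (hyp_grad u y) (hyp_grad \<phi> y) = (grad u y \<bullet> grad \<phi> y) / (conformal_factor y)\<^sup>2"
  using conformal_factor_pos[OF assms]
  by (simp add: hyp_metric_def hyp_grad_def grad_def[symmetric] power2_eq_square)

text \<open>The Laplace--Beltrami operator on functions of \<^const>\<open>cosh_dist\<close>.\<close>

definition radial_laplacian :: "nat \<Rightarrow> (real \<Rightarrow> real) \<Rightarrow> (real \<Rightarrow> real) \<Rightarrow> real \<Rightarrow> real" where
  "radial_laplacian n F' F'' t = (t\<^sup>2 - 1) * F'' t + real n * t * F' t"

text \<open>Green's formula with a radial function. The Euclidean field
  $u\,\lambda^{n-1} F'(s)\,\mathrm{dist\_dir}$ has compact support, so its divergence integrates to
  zero. The gradient of \<open>u\<close> contributes the left-hand side. The rest is \<open>u\<close> times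
  $\lambda^n \Delta (F \circ s)$, because $|\nabla s|^2 = s^2 - 1$ and $\Delta s = n s$.\<close>

lemma radial_green_identity:
  fixes u :: "'a::euclidean_space \<Rightarrow> real"
  assumes x: "x \<in> hyp_space" and u: "Ck_on 1 hyp_space u"
    and F: "\<And>t. (F has_real_derivative F' t) (at t)" "\<And>t. (F' has_real_derivative F'' t) (at t)"
    and F''c: "continuous_on UNIV F''"
    and z: "\<And>t. t \<ge> T \<Longrightarrow> F t = 0"
  shows "(LINT y|hyp_vol. hyp_metric y (hyp_grad u y) (hyp_grad (\<lambda>y. F (cosh_dist x y)) y)) =
    - (LINT y|hyp_vol. u y * radial_laplacian DIM('a) F' F'' (cosh_dist x y))"
proof -
  define K where "K = {y \<in> hyp_space. cosh_dist x y \<le> T + 1}"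
  have K: "compact K" "K \<subseteq> hyp_space" using compact_cosh_ball[OF x] by (auto simp: K_def)
  obtain m where n: "DIM('a) = Suc m" using DIM_positive[where 'a='a] by (metis Suc_pred)
  have F'z: "F' t = 0" if "t > T" for t
  proof -
    have "(F has_real_derivative 0) (at t)"
      by (rule has_field_derivative_transform_within_open[where f = "\<lambda>_. 0" and S = "{T<..}"])
         (use that z in auto)
    then show ?thesis using F(1) DERIV_unique by blast
  qed
  have F''z: "F'' t = 0" if "t > T" for t
  proof -
    have "(F' has_real_derivative 0) (at t)"
      by (rule has_field_derivative_transform_within_open[where f = "\<lambda>_. 0" and S = "{T<..}"])
         (use that F'z in auto)
    then show ?thesis using F(2) DERIV_unique by blast
  qed
  have contF': "continuous_on UNIV F'" using F(2) DERIV_isCont continuous_at_imp_continuous_on by blast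
  have contF's: "continuous_on hyp_space (\<lambda>y. F' (cosh_dist x y))"
    and contF''s: "continuous_on hyp_space (\<lambda>y. F'' (cosh_dist x y))"
    by (auto intro: continuous_on_compose2[OF contF'] continuous_on_compose2[OF F''c] continuous_on_cosh_dist[OF x])
  have u_der: "(u has_derivative frechet_derivative u (at y)) (at y)" if "y \<in> hyp_space" for y
    using Ck_on_SucD(1)[OF hyp_space_open, of 0 u] u that by simp
  have u_cont': "continuous_on hyp_space (\<lambda>y. frechet_derivative u (at y) v)" for v
    using u by simp
  have u_cont: "continuous_on hyp_space u" using Ck_on_imp_continuous_on[OF hyp_space_open u] .
  let ?l = conformal_factor
  let ?s = "cosh_dist x"
  let ?T = "dist_dir x"
  define q where "q y = ?s y + ?l x - 1" for y
  have T_eq: "?T y = q y *\<^sub>R y - ?l x *\<^sub>R x" for y by (simp add: dist_dir_def q_def)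
  define g where "g b y = u y * (?l y ^ m * F' (?s y) * (?T y \<bullet> b))" for b y
  define g' where "g' b y v =
      frechet_derivative u (at y) v * (?l y ^ m * F' (?s y) * (?T y \<bullet> b)) +
      u y * (real m * ?l y ^ (m + 1) * (y \<bullet> v) * F' (?s y) * (?T y \<bullet> b) +
        ?l y ^ m * (F'' (?s y) * (?l y * (?T y \<bullet> v))) * (?T y \<bullet> b) +
        ?l y ^ m * F' (?s y) * (?l y * (?T y \<bullet> v) * (y \<bullet> b) + q y * (v \<bullet> b)))" for b y v
  have g_der: "(g b has_derivative g' b y) (at y)" if y: "y \<in> hyp_space" for b y
  proof -
    have l1: "((\<lambda>y. ?l y ^ m) has_derivative (\<lambda>v. real m * ?l y ^ (m + 1) * (y \<bullet> v))) (at y)"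
    proof -
      have "((\<lambda>y. ?l y ^ m) has_derivative (\<lambda>v. real m * ((?l y)\<^sup>2 * (y \<bullet> v)) * ?l y ^ (m - 1))) (at y)"
        by (rule derivative_eq_intros conformal_factor_has_derivative[OF y] refl)+
      moreover have "real m * ((?l y)\<^sup>2 * c) * ?l y ^ (m - 1) = real m * ?l y ^ (m + 1) * c" for c
        by (cases m) (auto simp: power2_eq_square)
      ultimately show ?thesis by (simp only:)
    qed
    have F1: "((\<lambda>y. F' (?s y)) has_derivative (\<lambda>v. F'' (?s y) * (?l y * (?T y \<bullet> v)))) (at y)"
      using has_derivative_compose[OF cosh_dist_has_derivative[OF x y] F(2)[unfolded has_field_derivative_def]]
      by simp
    have T1: "((\<lambda>y. ?T y \<bullet> b) has_derivative (\<lambda>v. ?l y * (?T y \<bullet> v) * (y \<bullet> b) + q y * (v \<bullet> b))) (at y)"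
      unfolding dist_dir_def[of x y for y] inner_diff_left
      by (rule derivative_eq_intros cosh_dist_has_derivative[OF x y] refl)+
         (simp add: fun_eq_iff q_def dist_dir_def inner_diff algebra_simps)
    show ?thesis
      unfolding g_def[abs_def]
      by (rule has_derivative_eq_rhs[OF has_derivative_mult[OF u_der[OF y]
          has_derivative_mult[OF has_derivative_mult[OF l1 F1] T1]]])
         (simp add: fun_eq_iff g'_def algebra_simps)
  qed
  have g'_cont: "continuous_on hyp_space (\<lambda>y. g' b y b)" for b
    unfolding g'_def q_def
    by (intro continuous_intros u_cont u_cont' contF's contF''s continuous_on_dist_dir[OF x]
        continuous_on_cosh_dist[OF x] continuous_conformal_factor)
  have g'_zero: "g' b y v = 0" if "y \<in> hyp_space - K" for b y v
  proof -
    have "T < cosh_dist x y" using that by (auto simp: K_def)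
    then show ?thesis by (simp add: F'z F''z g'_def)
  qed
  have int0: "integral\<^sup>L lborel (\<lambda>y. indicator hyp_space y * g' b y b) = 0" for b
    by (rule integral_directional_derivative_eq_0[OF hyp_space_open g_der g'_cont K])
       (use F'z in \<open>auto simp: g_def K_def\<close>)
  have lb_int: "integrable lborel (\<lambda>y. indicator hyp_space y * h y)"
    if "continuous_on hyp_space h" "\<And>y. y \<in> hyp_space - K \<Longrightarrow> h y = 0" for h :: "'a \<Rightarrow> real"
  proof -
    have eq: "indicator hyp_space y * h y = indicator hyp_space y * (?l y ^ DIM('a) * (h y / ?l y ^ DIM('a)))" for y :: 'a
      using conformal_factor_pos[of y] by (cases "y \<in> hyp_space") auto
    have c: "continuous_on hyp_space (\<lambda>y. h y / ?l y ^ DIM('a))"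
      by (intro continuous_intros that continuous_conformal_factor) (use conformal_factor_pos in force)
    show ?thesis
      unfolding eq hyp_vol_integral(2)[OF continuous_imp_measurable_hyp_vol[OF c], symmetric]
      by (rule hyp_integrable_continuous[OF c K]) (simp add: that)
  qed
  define LHS where "LHS y = F' (?s y) * (grad u y \<bullet> ?T y) / ?l y" for y
  define RHS where "RHS y = u y * radial_laplacian DIM('a) F' F'' (?s y)" for y
  have grad_cont: "continuous_on hyp_space (grad u)"
    unfolding grad_def by (intro continuous_intros u_cont')
  have contL: "continuous_on hyp_space LHS" unfolding LHS_def
    by (intro continuous_intros contF's grad_cont continuous_on_dist_dir[OF x] continuous_conformal_factor)
       (use conformal_factor_pos in force)
  have contR: "continuous_on hyp_space RHS" unfolding RHS_def radial_laplacian_def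
    by (intro continuous_intros contF's contF''s u_cont continuous_on_cosh_dist[OF x])
  \<comment> \<open>The divergence of the field.\<close>
  have sum: "(\<Sum>b\<in>Basis. g' b y b) = ?l y ^ DIM('a) * (LHS y + RHS y)" if y: "y \<in> hyp_space" for y
  proof -
    have lp: "?l y > 0" by (rule conformal_factor_pos[OF y])
    define G where "G = grad u y"
    have Gu: "frechet_derivative u (at y) v = G \<bullet> v" for v
      unfolding G_def by (rule grad_inner[OF u_der[OF y], symmetric])
    have ip: "(\<Sum>b\<in>Basis. (v \<bullet> b) * (w \<bullet> b)) = v \<bullet> w" for v w :: 'a
      by (rule euclidean_inner[symmetric])
    have "(\<Sum>b\<in>Basis. g' b y b) = (\<Sum>b\<in>Basis.
        (?l y ^ m * F' (?s y)) * ((G \<bullet> b) * (?T y \<bullet> b)) +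
        (u y * (real m + 1) * ?l y ^ (m + 1) * F' (?s y)) * ((y \<bullet> b) * (?T y \<bullet> b)) +
        (u y * ?l y ^ (m + 1) * F'' (?s y)) * ((?T y \<bullet> b) * (?T y \<bullet> b)) +
        u y * ?l y ^ m * F' (?s y) * q y)"
      by (rule sum.cong) (auto simp: g'_def Gu inner_same_Basis algebra_simps)
    also have "\<dots> = (?l y ^ m * F' (?s y)) * (G \<bullet> ?T y) +
        (u y * (real m + 1) * ?l y ^ (m + 1) * F' (?s y)) * (y \<bullet> ?T y) +
        (u y * ?l y ^ (m + 1) * F'' (?s y)) * (?T y \<bullet> ?T y) +
        real DIM('a) * (u y * ?l y ^ m * F' (?s y) * q y)"
      unfolding sum.distrib sum_distrib_left[symmetric] ip by simp
    also have "\<dots> = ?l y ^ Suc m * (LHS y + RHS y)"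
      unfolding dist_dir_inner_self[OF x y] q_def[symmetric] LHS_def RHS_def radial_laplacian_def n G_def
      using lp by (simp add: field_simps)
    finally show ?thesis by (simp add: n)
  qed
  have "0 = (\<Sum>b\<in>Basis. integral\<^sup>L lborel (\<lambda>y. indicator hyp_space y * g' b y b))"
    by (simp add: int0)
  also have "\<dots> = integral\<^sup>L lborel (\<lambda>y. \<Sum>b\<in>Basis. indicator hyp_space y * g' b y b)"
    by (rule Bochner_Integration.integral_sum[symmetric]) (rule lb_int[OF g'_cont g'_zero])
  also have "(\<lambda>y. \<Sum>b\<in>Basis. indicator hyp_space y * g' b y b) =
      (\<lambda>y. indicator hyp_space y * (?l y ^ DIM('a) * (LHS y + RHS y)))"
    using sum by (auto simp: sum_distrib_left[symmetric] indicator_def fun_eq_iff)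
  also have "integral\<^sup>L lborel \<dots> = integral\<^sup>L hyp_vol (\<lambda>y. LHS y + RHS y)"
    by (rule hyp_vol_integral(1)[symmetric])
       (intro continuous_imp_measurable_hyp_vol continuous_intros contL contR)
  also have "\<dots> = integral\<^sup>L hyp_vol LHS + integral\<^sup>L hyp_vol RHS"
    by (intro Bochner_Integration.integral_add hyp_integrable_continuous[OF contL K] hyp_integrable_continuous[OF contR K])
       (auto simp: LHS_def RHS_def radial_laplacian_def K_def F'z F''z)
  finally have "integral\<^sup>L hyp_vol LHS = - integral\<^sup>L hyp_vol RHS" by simp
  moreover have "(LINT y|hyp_vol. hyp_metric y (hyp_grad u y) (hyp_grad (\<lambda>y. F (cosh_dist x y)) y)) = integral\<^sup>L hyp_vol LHS"
  proof (rule Bochner_Integration.integral_cong[OF refl])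
    fix y :: 'a assume "y \<in> space hyp_vol"
    then have y: "y \<in> hyp_space" by simp
    have d: "((\<lambda>y. F (?s y)) has_derivative (\<lambda>v. F' (?s y) * (?l y * (?T y \<bullet> v)))) (at y)"
      using has_derivative_compose[OF cosh_dist_has_derivative[OF x y] F(1)[unfolded has_field_derivative_def]]
      by simp
    have "grad u y \<bullet> grad (\<lambda>y. F (?s y)) y = F' (?s y) * (?l y * (?T y \<bullet> grad u y))"
      using grad_inner[OF d, of "grad u y"] by (simp add: inner_commute)
    then show "hyp_metric y (hyp_grad u y) (hyp_grad (\<lambda>y. F (cosh_dist x y)) y) = LHS y"
      unfolding hyp_metric_grad[OF y] LHS_def using conformal_factor_pos[OF y]
      by (simp add: power2_eq_square inner_commute field_simps)
  qed
  ultimately show ?thesis by (simp add: RHS_def[abs_def])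
qed

lemma radial_test_function:
  assumes x: "x \<in> hyp_space" and F: "\<And>k. Ck_on k UNIV F" and z: "\<And>t. t \<ge> T \<Longrightarrow> F t = 0"
  shows "hyp_test_function (\<lambda>y. F (cosh_dist x y))"
  unfolding hyp_test_function_def
proof (intro conjI allI)
  show "Ck_on k hyp_space (\<lambda>y. F (cosh_dist x y))" for k
    by (rule Ck_on_compose[OF hyp_space_open open_UNIV _ Ck_on_cosh_dist[OF x] F]) simp
  show "\<exists>K. compact K \<and> K \<subseteq> hyp_space \<and> (\<forall>y\<in>hyp_space - K. F (cosh_dist x y) = 0)"
    by (rule exI[of _ "{y \<in> hyp_space. cosh_dist x y \<le> T}"]) (use compact_cosh_ball[OF x] z linear[of T] in blast)
qed

section \<open>Averages and truncated Green functions\<close>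

text \<open>A radial function \<open>F\<close> of $t = \cosh d$ satisfies
  $\Delta F = (t^2-1)^{1-n/2} \frac{d}{dt}\bigl((t^2-1)^{n/2} F'(t)\bigr)$. Hence
  \<open>green_density\<close> is, up to a constant factor, minus the derivative of the Green function. Multiplying it by the
  difference of two cutoffs gives a smooth function of compact support; the Laplacian of its
  antiderivative is a difference of two averaging kernels, one near the centre and one far away.\<close>

definition green_density :: "nat \<Rightarrow> real \<Rightarrow> real" where
  "green_density n t = (t\<^sup>2 - 1) powr - (real n / 2)"

definition cutoff :: "real \<Rightarrow> real \<Rightarrow> real" where
  "cutoff \<epsilon> t = step ((t - 1) / \<epsilon>)"

lemma step_has_derivative: "(step has_real_derivative deriv step t) (at t)"
proof -
  have "step differentiable (at t)"
    using step_smooth[of 1] by (simp add: differentiable_on_eq_differentiable_at)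
  then show ?thesis by (simp add: DERIV_deriv_iff_real_differentiable)
qed

lemma continuous_deriv_step: "continuous_on A (deriv step)"
proof -
  have "deriv step = (\<lambda>t. frechet_derivative step (at t) 1)"
    using step_has_derivative frechet_derivative_at by (metis (no_types) has_field_derivative_def mult.right_neutral ext)
  then have "continuous_on UNIV (deriv step)" using step_smooth[of 1] by simp
  then show ?thesis using continuous_on_subset by blast
qed

lemma deriv_step_nonneg: "deriv step t \<ge> 0"
  by (rule mono_on_imp_deriv_nonneg[of UNIV step, OF _ step_has_derivative])
     (auto intro: mono_onI step_mono)

lemma deriv_step_eq_0:
  assumes "t < 1 \<or> t > 2" shows "deriv step t = 0"
proof -
  have "(step has_real_derivative 0) (at t)"
  proof (cases "t < 1")
    case True
    show ?thesis
      by (rule has_field_derivative_transform_within_open[OF DERIV_const open_lessThan[of 1]])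
         (use True in \<open>simp_all add: step_0\<close>)
  next
    case False
    show ?thesis
      by (rule has_field_derivative_transform_within_open[OF DERIV_const open_greaterThan[of 2]])
         (use False assms in \<open>simp_all add: step_1\<close>)
  qed
  then show ?thesis by (rule DERIV_imp_deriv)
qed

lemma deriv_step_pos_ex: "\<exists>t. 1 < t \<and> t < 2 \<and> deriv step t > 0"
proof -
  have "\<exists>z>1. z < 2 \<and> step 2 - step 1 = (2 - 1) * deriv step z"
    by (rule MVT2) (auto intro: step_has_derivative)
  then show ?thesis by (auto simp: step_0 step_1)
qed

lemma cutoff_0: "\<epsilon> > 0 \<Longrightarrow> t \<le> 1 + \<epsilon> \<Longrightarrow> cutoff \<epsilon> t = 0"
  unfolding cutoff_def by (rule step_0) (simp add: field_simps)

lemma cutoff_1: "\<epsilon> > 0 \<Longrightarrow> t \<ge> 1 + 2 * \<epsilon> \<Longrightarrow> cutoff \<epsilon> t = 1"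
  unfolding cutoff_def by (rule step_1) (simp add: field_simps)

lemma cutoff_antimono:
  assumes "0 < \<epsilon>" "\<epsilon> \<le> \<epsilon>'"
  shows "cutoff \<epsilon>' t \<le> cutoff \<epsilon> t"
proof (cases "t \<ge> 1")
  case True
  have "(t - 1) / \<epsilon>' \<le> (t - 1) / \<epsilon>"
    using True assms by (intro divide_left_mono mult_pos_pos) linarith+
  then show ?thesis unfolding cutoff_def by (rule step_mono)
next
  case False
  then show ?thesis using assms cutoff_0[of \<epsilon> t] cutoff_0[of \<epsilon>' t] by linarith
qed

lemma cutoff_has_derivative: "\<epsilon> > 0 \<Longrightarrow> (cutoff \<epsilon> has_real_derivative deriv step ((t - 1) / \<epsilon>) / \<epsilon>) (at t)"
  unfolding cutoff_def[abs_def]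
  by (rule DERIV_cong[OF DERIV_chain2[OF step_has_derivative, of _ "1 / \<epsilon>"]])
     (auto intro!: derivative_eq_intros)

lemma cutoff_smooth: "\<epsilon> > 0 \<Longrightarrow> Ck_on k UNIV (cutoff \<epsilon>)"
proof -
  have "Ck_on k UNIV (\<lambda>t::real. (1 / \<epsilon>) * (t + (-1)))"
    by (intro Ck_on_mult Ck_on_add Ck_on_const open_UNIV Ck_on_bounded_linear bounded_linear_ident)
  from Ck_on_compose[OF open_UNIV open_UNIV _ this step_smooth] show ?thesis
    by (simp add: cutoff_def[abs_def])
qed

lemma green_density_pos: "t > 1 \<Longrightarrow> green_density n t > 0"
proof -
  assume "t > 1"
  then have "1 < t\<^sup>2" by (simp add: one_less_power)
  then show ?thesis by (simp add: green_density_def)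
qed

lemma green_density_nonneg: "green_density n t \<ge> 0"
  by (simp add: green_density_def)

lemma green_density_antimono: "1 < t \<Longrightarrow> t \<le> T \<Longrightarrow> green_density n T \<le> green_density n t"
proof -
  assume t: "1 < t" "t \<le> T"
  then have "1 < t\<^sup>2" "t\<^sup>2 \<le> T\<^sup>2" by (auto simp: one_less_power power_mono)
  then show ?thesis unfolding green_density_def by (intro powr_mono2') auto
qed

lemma green_density_smooth: "Ck_on k {1<..} (green_density n)"
proof -
  have "Ck_on k {1<..} (\<lambda>t::real. (t * t + (-1)) powr (- (real n / 2)))"
    by (intro Ck_on_compose[OF open_greaterThan open_greaterThan _ _ Ck_on_powr] Ck_on_add Ck_on_mult
        Ck_on_const open_greaterThan Ck_on_bounded_linear bounded_linear_ident)
       (auto simp: less_1_mult)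
  then show ?thesis by (simp add: green_density_def[abs_def] power2_eq_square)
qed

lemma green_density_has_derivative:
  assumes "t > 1"
  shows "(green_density n has_real_derivative - (real n * t * green_density n t / (t\<^sup>2 - 1))) (at t)"
proof -
  have p: "t\<^sup>2 - 1 > 0" using assms by (simp add: one_less_power)
  have "((\<lambda>t. (t\<^sup>2 - 1) powr - (real n / 2)) has_real_derivative
      (- (real n / 2)) * (t\<^sup>2 - 1) powr (- (real n / 2) - 1) * (2 * t)) (at t)"
    by (rule DERIV_chain2[where f = "\<lambda>z. z powr - (real n / 2)" and g = "\<lambda>t. t\<^sup>2 - 1", OF has_real_derivative_powr[OF p]])
       (auto intro!: derivative_eq_intros)
  moreover have "(t\<^sup>2 - 1) powr (- (real n / 2) - 1) = (t\<^sup>2 - 1) powr (- (real n / 2)) / (t\<^sup>2 - 1)"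
    using p by (simp add: powr_diff)
  moreover have "(- (real n / 2)) * (Z / q) * (2 * t) = - (real n * t * Z / q)" for Z q :: real by simp
  ultimately show ?thesis unfolding green_density_def[abs_def] by (simp only:)
qed

text \<open>The kernel is supported in the shell $1 + \epsilon \le \cosh d \le 1 + 2\epsilon$. The associated
  average is not normalised; its total mass does not depend on \<open>\<epsilon>\<close>, as shown below.\<close>

definition avg_kernel :: "nat \<Rightarrow> real \<Rightarrow> real \<Rightarrow> real" where
  "avg_kernel n \<epsilon> t = (t\<^sup>2 - 1) * green_density n t * (deriv step ((t - 1) / \<epsilon>) / \<epsilon>)"

definition average :: "real \<Rightarrow> ('a::euclidean_space \<Rightarrow> real) \<Rightarrow> 'a \<Rightarrow> real" where
  "average \<epsilon> f x = (LINT y|hyp_vol. f y * avg_kernel DIM('a) \<epsilon> (cosh_dist x y))"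

text \<open>The antiderivative that vanishes for large arguments.\<close>

definition is_green :: "nat \<Rightarrow> real \<Rightarrow> real \<Rightarrow> (real \<Rightarrow> real) \<Rightarrow> bool" where
  "is_green n \<epsilon> R F \<longleftrightarrow>
    (\<forall>t. (F has_real_derivative - ((cutoff \<epsilon> t - cutoff R t) * green_density n t)) (at t)) \<and>
    (\<forall>k. Ck_on k UNIV F) \<and> (\<forall>t\<ge>1 + 2 * R. F t = 0)"

definition green :: "nat \<Rightarrow> real \<Rightarrow> real \<Rightarrow> real \<Rightarrow> real" where
  "green n \<epsilon> R = (SOME F. is_green n \<epsilon> R F)"

lemma truncated_density_smooth:
  assumes "0 < \<epsilon>" "\<epsilon> \<le> R"
  shows "Ck_on k UNIV (\<lambda>t. (cutoff \<epsilon> t - cutoff R t) * green_density n t)" (is "Ck_on k UNIV ?g")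
proof -
  have "Ck_on k {1<..} (\<lambda>t. (cutoff \<epsilon> t + (-1) * cutoff R t) * green_density n t)"
    using assms
    by (intro Ck_on_mult Ck_on_add Ck_on_const green_density_smooth open_greaterThan
        Ck_on_subset[OF open_UNIV open_greaterThan subset_UNIV cutoff_smooth]) auto
  then have 1: "Ck_on k {1<..} ?g" by simp
  have 2: "Ck_on k {..<1 + \<epsilon>} ?g"
    by (subst Ck_on_cong[OF open_lessThan, where g = "\<lambda>_. 0"]) (use assms in \<open>auto simp: cutoff_0 Ck_on_const\<close>)
  have "{1<..} \<union> {..<1 + \<epsilon>} = UNIV" using assms by auto
  then show ?thesis using Ck_on_Un[OF open_greaterThan open_lessThan 1 2] by simp
qed

lemma is_green_green:
  assumes "0 < \<epsilon>" "\<epsilon> \<le> R"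
  shows "is_green n \<epsilon> R (green n \<epsilon> R)"
proof -
  have "(cutoff \<epsilon> t - cutoff R t) * green_density n t = 0" if "t \<ge> 1 + 2 * R" for t
    using that assms by (simp add: cutoff_1)
  note z = this
  have "\<exists>F. is_green n \<epsilon> R F"
  proof (rule smooth_antiderivative[OF truncated_density_smooth[OF assms] z])
    fix F assume F: "\<And>t. (F has_real_derivative - ((cutoff \<epsilon> t - cutoff R t) * green_density n t)) (at t)"
      "\<And>k. Ck_on k UNIV F" "\<And>t. 1 + 2 * R \<le> t \<Longrightarrow> F t = 0"
    show ?thesis unfolding is_green_def by (intro exI[of _ F] conjI allI impI F)
  qed
  then show ?thesis unfolding green_def by (rule someI_ex)
qed

text \<open>By the product rule the terms with the cutoffs themselves cancel, and only the derivatives of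
  the cutoffs remain.\<close>

lemma radial_laplacian_green:
  fixes \<epsilon> R :: real and n :: nat
  assumes "0 < \<epsilon>" "\<epsilon> \<le> R"
  defines "g \<equiv> \<lambda>t. (cutoff \<epsilon> t - cutoff R t) * green_density n t"
  shows "(g has_real_derivative deriv g t) (at t)" "continuous_on UNIV (deriv g)"
    "radial_laplacian n (\<lambda>t. - g t) (\<lambda>t. - deriv g t) t = avg_kernel n R t - avg_kernel n \<epsilon> t"
proof -
  have C1: "Ck_on 1 UNIV g" unfolding g_def by (rule truncated_density_smooth[OF assms(1,2)])
  then have "g differentiable (at t)" for t by (simp add: differentiable_on_eq_differentiable_at)
  then show der: "(g has_real_derivative deriv g t) (at t)" for t by (simp add: DERIV_deriv_iff_real_differentiable)
  have "deriv g = (\<lambda>t. frechet_derivative g (at t) 1)"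
    using der frechet_derivative_at by (metis (no_types) has_field_derivative_def mult.right_neutral ext)
  then show "continuous_on UNIV (deriv g)" using C1 by simp
  have R: "R > 0" using assms by simp
  show "radial_laplacian n (\<lambda>t. - g t) (\<lambda>t. - deriv g t) t = avg_kernel n R t - avg_kernel n \<epsilon> t"
  proof (cases "t < 1 + \<epsilon>")
    case True
    have "(g has_real_derivative 0) (at t)"
      by (rule has_field_derivative_transform_within_open[where f = "\<lambda>_. 0" and S = "{..<1 + \<epsilon>}"])
         (use True assms in \<open>auto simp: g_def cutoff_0\<close>)
    then have "deriv g t = 0" by (rule DERIV_imp_deriv)
    moreover have "g t = 0" using True assms by (simp add: g_def cutoff_0)
    moreover have "(t - 1) / \<epsilon> < 1" "(t - 1) / R < 1" using True assms R by (auto simp: field_simps)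
    ultimately show ?thesis by (simp add: radial_laplacian_def avg_kernel_def deriv_step_eq_0)
  next
    case False
    then have t: "t > 1" using assms by simp
    then have p: "t\<^sup>2 - 1 > 0" by (simp add: one_less_power)
    have "(g has_real_derivative (deriv step ((t - 1) / \<epsilon>) / \<epsilon> - deriv step ((t - 1) / R) / R) * green_density n t +
        - (real n * t * green_density n t / (t\<^sup>2 - 1)) * (cutoff \<epsilon> t - cutoff R t)) (at t)"
      unfolding g_def
      by (intro DERIV_mult DERIV_diff cutoff_has_derivative green_density_has_derivative t assms R)
    then have dg: "deriv g t = (deriv step ((t - 1) / \<epsilon>) / \<epsilon> - deriv step ((t - 1) / R) / R) * green_density n t +
        - (real n * t * green_density n t / (t\<^sup>2 - 1)) * (cutoff \<epsilon> t - cutoff R t)"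
      by (rule DERIV_imp_deriv)
    have gt: "g t = (cutoff \<epsilon> t - cutoff R t) * green_density n t" by (simp add: g_def)
    have alg: "q * - ((a - b) * w + - (N * w / q) * c) + N * - (c * w) = q * w * b - q * w * a"
      if "q \<noteq> 0" for q a b w N c :: real
      using that by (simp add: field_simps)
    show ?thesis
      unfolding radial_laplacian_def avg_kernel_def dg gt by (rule alg) (use p in simp)
  qed
qed

lemma green_has_derivative:
  "0 < \<epsilon> \<Longrightarrow> \<epsilon> \<le> R \<Longrightarrow>
    (green n \<epsilon> R has_real_derivative - ((cutoff \<epsilon> t - cutoff R t) * green_density n t)) (at t)"
  using is_green_green[of \<epsilon> R n] unfolding is_green_def by simp

lemma green_eq_0: "0 < \<epsilon> \<Longrightarrow> \<epsilon> \<le> R \<Longrightarrow> t \<ge> 1 + 2 * R \<Longrightarrow> green n \<epsilon> R t = 0"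
  using is_green_green[of \<epsilon> R n] unfolding is_green_def by simp

lemma continuous_on_green: "0 < \<epsilon> \<Longrightarrow> \<epsilon> \<le> R \<Longrightarrow> continuous_on A (green n \<epsilon> R)"
  by (meson DERIV_isCont continuous_at_imp_continuous_on green_has_derivative)

text \<open>Lowering \<open>\<epsilon>\<close> and raising \<open>R\<close> enlarges the truncated density, so increments decrease. This
  monotonicity replaces passing to the limit in singular integrals.\<close>

lemma green_increment_antimono:
  assumes "0 < \<epsilon>'" "\<epsilon>' \<le> \<epsilon>" "\<epsilon> \<le> R" "R \<le> R'" "s \<le> t"
  shows "green n \<epsilon>' R' t - green n \<epsilon>' R' s \<le> green n \<epsilon> R t - green n \<epsilon> R s"
proof -
  have "green n \<epsilon>' R' t - green n \<epsilon> R t \<le> green n \<epsilon>' R' s - green n \<epsilon> R s"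
  proof (rule DERIV_nonpos_imp_nonincreasing[OF assms(5)])
    fix r
    have "((\<lambda>r. green n \<epsilon>' R' r - green n \<epsilon> R r) has_real_derivative
        - ((cutoff \<epsilon>' r - cutoff R' r) * green_density n r) - - ((cutoff \<epsilon> r - cutoff R r) * green_density n r)) (at r)"
      by (intro DERIV_diff green_has_derivative) (use assms in auto)
    moreover have "(cutoff \<epsilon> r - cutoff R r) * green_density n r \<le> (cutoff \<epsilon>' r - cutoff R' r) * green_density n r"
      using cutoff_antimono[of \<epsilon>' \<epsilon> r] cutoff_antimono[of R R' r] assms
      by (intro mult_right_mono green_density_nonneg) auto
    ultimately show "\<exists>y. ((\<lambda>r. green n \<epsilon>' R' r - green n \<epsilon> R r) has_real_derivative y) (at r) \<and> y \<le> 0"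
      by (intro exI conjI) auto
  qed
  then show ?thesis by simp
qed

lemma green_antimono:
  assumes "0 < \<epsilon>" "\<epsilon> \<le> R" "s \<le> t"
  shows "green n \<epsilon> R t \<le> green n \<epsilon> R s"
proof (rule DERIV_nonpos_imp_nonincreasing[OF assms(3)])
  fix r
  have "(cutoff \<epsilon> r - cutoff R r) * green_density n r \<ge> 0"
    using cutoff_antimono[OF assms(1,2)] by (intro mult_nonneg_nonneg green_density_nonneg) simp
  then show "\<exists>y. (green n \<epsilon> R has_real_derivative y) (at r) \<and> y \<le> 0"
    using green_has_derivative[OF assms(1,2), of n r] by (intro exI conjI) auto
qed

lemma green_nonneg: "0 < \<epsilon> \<Longrightarrow> \<epsilon> \<le> R \<Longrightarrow> green n \<epsilon> R t \<ge> 0"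
  using green_antimono[of \<epsilon> R t "max t (1 + 2 * R)" n] green_eq_0[of \<epsilon> R "max t (1 + 2 * R)" n] by simp

text \<open>Between the two cutoffs the truncation is invisible.\<close>

lemma green_increment_le:
  assumes "0 < \<epsilon>" "\<epsilon> \<le> R" "1 + 2 * \<epsilon> \<le> s" "s \<le> t" "t \<le> 1 + R"
  shows "green n \<epsilon> R t - green n \<epsilon> R s \<le> - (green_density n (1 + R) * (t - s))"
proof -
  let ?w = "green_density n (1 + R)"
  have "green n \<epsilon> R t + ?w * t \<le> green n \<epsilon> R s + ?w * s"
  proof (rule DERIV_nonpos_imp_nonincreasing[OF assms(4)])
    fix r assume r: "s \<le> r" "r \<le> t"
    have d: "((\<lambda>r. green n \<epsilon> R r + ?w * r) has_real_derivative
        - ((cutoff \<epsilon> r - cutoff R r) * green_density n r) + ?w * 1) (at r)"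
      by (intro DERIV_add DERIV_cmult DERIV_ident green_has_derivative assms)
    have "cutoff \<epsilon> r = 1" "cutoff R r = 0" using r assms by (auto simp: cutoff_1 cutoff_0)
    moreover have "?w \<le> green_density n r" using r assms by (intro green_density_antimono) auto
    ultimately show "\<exists>y. ((\<lambda>r. green n \<epsilon> R r + ?w * r) has_real_derivative y) (at r) \<and> y \<le> 0"
      by (intro exI[of _ "- ((cutoff \<epsilon> r - cutoff R r) * green_density n r) + ?w * 1"] conjI d) simp
  qed
  then show ?thesis by (simp add: algebra_simps)
qed

lemma avg_kernel_nonneg: "t \<ge> 1 \<Longrightarrow> \<epsilon> > 0 \<Longrightarrow> avg_kernel n \<epsilon> t \<ge> 0"
  unfolding avg_kernel_def
  by (intro mult_nonneg_nonneg divide_nonneg_nonneg green_density_nonneg deriv_step_nonneg)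
     (auto simp: one_le_power)

lemma avg_kernel_eq_0:
  assumes "\<epsilon> > 0" "t < 1 + \<epsilon> \<or> t > 1 + 2 * \<epsilon>" shows "avg_kernel n \<epsilon> t = 0"
proof -
  have "(t - 1) / \<epsilon> < 1 \<or> (t - 1) / \<epsilon> > 2" using assms by (auto simp: field_simps)
  then show ?thesis by (simp add: avg_kernel_def deriv_step_eq_0)
qed

lemma continuous_avg_kernel:
  assumes "\<epsilon> > 0" shows "continuous_on A (avg_kernel n \<epsilon>)"
proof -
  have lin: "continuous_on {1<..} (\<lambda>t. (t - 1) / \<epsilon>)"
    by (intro continuous_on_divide continuous_on_diff continuous_on_id continuous_on_const) (use assms in simp)
  have 1: "continuous_on {1<..} (\<lambda>t. deriv step ((t - 1) / \<epsilon>))"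
    using continuous_on_compose2[OF continuous_deriv_step[of UNIV] lin] by simp
  have "continuous_on {1<..} (\<lambda>t. (t\<^sup>2 - 1) * green_density n t * (deriv step ((t - 1) / \<epsilon>) / \<epsilon>))"
    by (intro continuous_on_mult continuous_on_divide continuous_on_diff continuous_on_power continuous_on_id continuous_on_const 1
        Ck_on_imp_continuous_on[OF open_greaterThan green_density_smooth[of 0]])
       (use assms in simp)
  then have "continuous_on {1<..} (avg_kernel n \<epsilon>)"
    by (simp add: avg_kernel_def[abs_def])
  moreover have "continuous_on {..<1 + \<epsilon>} (avg_kernel n \<epsilon>)"
    by (rule continuous_on_eq[OF continuous_on_const[of _ 0]]) (use assms in \<open>auto simp: avg_kernel_eq_0\<close>)
  moreover have "{1<..} \<union> {..<1 + \<epsilon>} = UNIV" using assms by auto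
  ultimately have "continuous_on UNIV (avg_kernel n \<epsilon>)"
    using continuous_on_open_Un[OF open_greaterThan open_lessThan, of 1 "avg_kernel n \<epsilon>" "1 + \<epsilon>"] by simp
  then show ?thesis using continuous_on_subset by blast
qed

lemma continuous_on_radial:
  "x \<in> hyp_space \<Longrightarrow> continuous_on UNIV F \<Longrightarrow> continuous_on hyp_space (\<lambda>y. F (cosh_dist x y))"
  by (rule continuous_on_compose2[OF _ continuous_on_cosh_dist]) auto

lemma average_integrable:
  fixes f :: "'a::euclidean_space \<Rightarrow> real"
  assumes "x \<in> hyp_space" "continuous_on hyp_space f" "\<epsilon> > 0"
  shows "integrable hyp_vol (\<lambda>y. f y * avg_kernel n \<epsilon> (cosh_dist x y))"
  by (rule hyp_integrable_continuous[where K = "{y \<in> hyp_space. cosh_dist x y \<le> 1 + 2 * \<epsilon>}"])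
     (use assms in \<open>auto intro!: continuous_intros continuous_on_radial continuous_avg_kernel
        compact_cosh_ball avg_kernel_eq_0\<close>)

lemma average_diff_eq_green:
  fixes u :: "'a::euclidean_space \<Rightarrow> real"
  assumes "x \<in> hyp_space" "Ck_on 1 hyp_space u" "0 < \<epsilon>" "\<epsilon> \<le> R"
  shows "average \<epsilon> u x - average R u x =
    (LINT y|hyp_vol. hyp_metric y (hyp_grad u y) (hyp_grad (\<lambda>y. green DIM('a) \<epsilon> R (cosh_dist x y)) y))"
proof -
  let ?n = "DIM('a)"
  define g where "g = (\<lambda>t. (cutoff \<epsilon> t - cutoff R t) * green_density ?n t)"
  note L = radial_laplacian_green[OF assms(3,4), of ?n, folded g_def]
  have c: "continuous_on hyp_space u" by (rule Ck_on_imp_continuous_on[OF hyp_space_open assms(2)])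
  have L3: "radial_laplacian ?n (\<lambda>t. - g t) (\<lambda>t. - deriv g t) t = avg_kernel ?n R t - avg_kernel ?n \<epsilon> t" for t
    unfolding g_def by (rule radial_laplacian_green(3)[OF assms(3,4)])
  have gd: "(green ?n \<epsilon> R has_real_derivative - g t) (at t)" for t
    unfolding g_def by (rule green_has_derivative[OF assms(3,4)])
  have "(LINT y|hyp_vol. hyp_metric y (hyp_grad u y) (hyp_grad (\<lambda>y. green ?n \<epsilon> R (cosh_dist x y)) y)) =
    - (LINT y|hyp_vol. u y * radial_laplacian ?n (\<lambda>t. - g t) (\<lambda>t. - deriv g t) (cosh_dist x y))"
    by (rule radial_green_identity[OF assms(1,2), where T = "1 + 2 * R"])
       (intro gd DERIV_minus L(1) continuous_on_minus L(2) green_eq_0 assms | assumption)+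
  also have "\<dots> = - (LINT y|hyp_vol. u y * avg_kernel ?n R (cosh_dist x y) - u y * avg_kernel ?n \<epsilon> (cosh_dist x y))"
    by (simp add: L3 right_diff_distrib)
  also have "\<dots> = average \<epsilon> u x - average R u x"
    unfolding average_def
    by (subst Bochner_Integration.integral_diff) (use assms c in \<open>auto intro!: average_integrable\<close>)
  finally show ?thesis by simp
qed

text \<open>The weak equation tested with a truncated Green function: two averages of \<open>u\<close> about the same
  centre differ by a truncated potential of \<open>f\<close>.\<close>

lemma average_poisson:
  fixes u :: "'a::euclidean_space \<Rightarrow> real"
  assumes "x \<in> hyp_space" "Ck_on 1 hyp_space u" "weak_hyp_poisson u f" "0 < \<epsilon>" "\<epsilon> \<le> R"
  shows "average \<epsilon> u x - average R u x = (LINT y|hyp_vol. f y * green DIM('a) \<epsilon> R (cosh_dist x y))"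
proof -
  have "hyp_test_function (\<lambda>y. green DIM('a) \<epsilon> R (cosh_dist x y))"
    using is_green_green[OF assms(4,5), of "DIM('a)"]
    by (intro radial_test_function[OF assms(1), of _ "1 + 2 * R"]) (auto simp: is_green_def)
  then show ?thesis
    using average_diff_eq_green[OF assms(1,2,4,5)] assms(3) unfolding weak_hyp_poisson_def by simp
qed

definition mass :: "'a::euclidean_space \<Rightarrow> real" where
  "mass x = average 1 (\<lambda>_. 1) x"

text \<open>Green's formula for the constant function 1.\<close>

lemma average_1:
  fixes x :: "'a::euclidean_space"
  assumes "x \<in> hyp_space" "\<epsilon> > 0"
  shows "average \<epsilon> (\<lambda>_. 1) x = mass x"
proof -
  have grad0: "hyp_grad (\<lambda>_::'a. 1::real) y = 0" for y by (simp add: hyp_grad_def)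
  have "average \<epsilon> (\<lambda>_. 1) x = average R (\<lambda>_. 1) x" if "0 < \<epsilon>" "\<epsilon> \<le> R" for \<epsilon> R
    using average_diff_eq_green[OF assms(1) Ck_on_const[of 1 _ 1] that] by (simp add: grad0 hyp_metric_def)
  from this[of \<epsilon> 1] this[of 1 \<epsilon>] show ?thesis using assms(2) unfolding mass_def by fastforce
qed

text \<open>The ray from \<open>x\<close> in direction \<open>b\<close> leaves the ball of radius given by \<open>t\<close>. The direction is
  kept in the conclusion for the sake of the maximum principle.\<close>

lemma ex_cosh_dist_eq:
  fixes x :: "'a::euclidean_space"
  assumes x: "x \<in> hyp_space" and t: "t > 1" and b: "b \<in> Basis"
  obtains y where "y \<in> hyp_space" "cosh_dist x y = t" "x \<bullet> b < y \<bullet> b"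
proof -
  define C where "C = {y \<in> hyp_space. cosh_dist x y < t}"
  have "open C" unfolding C_def
    using continuous_open_preimage[OF continuous_on_cosh_dist[OF x] hyp_space_open, of "{..<t}"]
    by (simp add: vimage_def Int_def)
  let ?L = "closed_segment x (x + 2 *\<^sub>R b)"
  have "norm (2 *\<^sub>R b) \<le> norm (x + 2 *\<^sub>R b) + norm x" by (metis add_diff_cancel_left' norm_triangle_ineq4)
  then have "x + 2 *\<^sub>R b \<notin> C" using x b by (simp add: C_def hyp_space_def)
  moreover have "x \<in> C" using x t by (simp add: C_def)
  ultimately have "?L \<inter> frontier C \<noteq> {}"
    by (intro connected_Int_frontier connected_segment) auto
  then obtain y where y: "y \<in> ?L" "y \<in> frontier C" by blast
  have "closure C \<subseteq> {y \<in> hyp_space. cosh_dist x y \<le> t}"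
    by (rule closure_minimal) (auto simp: C_def intro!: compact_imp_closed compact_cosh_ball x)
  moreover have "y \<in> closure C" "y \<notin> C" using y(2) \<open>open C\<close> by (auto simp: frontier_def interior_open)
  ultimately have yy: "y \<in> hyp_space" "cosh_dist x y = t" by (auto simp: C_def)
  obtain r where r: "0 \<le> r" "y = x + (r * 2) *\<^sub>R b"
    using y(1) by (auto simp: in_segment algebra_simps)
  have "r \<noteq> 0" using r yy t by auto
  then have "x \<bullet> b < y \<bullet> b" using r b by (simp add: inner_add_left)
  then show ?thesis using that yy by blast
qed

lemma avg_kernel_pos_ex:
  assumes "\<epsilon> > 0"
  shows "\<exists>t. 1 + \<epsilon> < t \<and> t < 1 + 2 * \<epsilon> \<and> avg_kernel n \<epsilon> t > 0"
proof -
  obtain r where r: "1 < r" "r < 2" "deriv step r > 0" using deriv_step_pos_ex by blast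
  define t where "t = 1 + \<epsilon> * r"
  have t: "1 + \<epsilon> < t" "t < 1 + 2 * \<epsilon>" "(t - 1) / \<epsilon> = r" using assms r by (auto simp: t_def)
  then have "t > 1" using assms by simp
  then have "avg_kernel n \<epsilon> t > 0"
    unfolding avg_kernel_def t(3)
    by (intro mult_pos_pos divide_pos_pos green_density_pos r assms) (simp add: one_less_power)
  then show ?thesis using t by blast
qed

lemma avg_kernel_pos_open:
  fixes x :: "'a::euclidean_space"
  assumes "x \<in> hyp_space" "\<epsilon> > 0"
  shows "open {y \<in> hyp_space. avg_kernel n \<epsilon> (cosh_dist x y) > 0}"
  using continuous_open_preimage[OF continuous_on_radial[OF assms(1) continuous_avg_kernel[OF assms(2)]]
      hyp_space_open, of "{0<..}" n] by (simp add: vimage_def Int_def)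

lemma mass_pos:
  fixes x :: "'a::euclidean_space"
  assumes x: "x \<in> hyp_space" shows "mass x > 0"
proof -
  let ?U = "{y \<in> hyp_space. avg_kernel DIM('a) 1 (cosh_dist x y) > 0}"
  obtain t where "t > 1 + 1" "avg_kernel DIM('a) 1 t > 0"
    using avg_kernel_pos_ex[of 1 "DIM('a)"] by auto
  moreover obtain y where "y \<in> hyp_space" "cosh_dist x y = t"
    using ex_cosh_dist_eq[OF x, of t "SOME b. b \<in> Basis"] \<open>t > 1 + 1\<close> by (auto simp: SOME_Basis)
  ultimately have "?U \<noteq> {}" by blast
  have o: "open ?U" by (rule avg_kernel_pos_open[OF x]) simp
  show ?thesis unfolding mass_def average_def
    by (rule hyp_integral_pos[where A = ?U])
       (use average_integrable[OF x continuous_on_const, of 1 1 "DIM('a)"] o \<open>?U \<noteq> {}\<close>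
          emeasure_hyp_vol_open_pos[OF o] cosh_dist_ge_1[OF x] in \<open>auto simp: sets_hyp_vol_iff intro!: avg_kernel_nonneg\<close>)
qed

text \<open>The kernel is nonnegative and carries the total mass \<open>mass x\<close>.\<close>

lemma average_bound:
  fixes f :: "'a::euclidean_space \<Rightarrow> real"
  assumes x: "x \<in> hyp_space" and f: "continuous_on hyp_space f" and e: "\<epsilon> > 0"
    and b: "\<And>y. y \<in> hyp_space \<Longrightarrow> 1 + \<epsilon> \<le> cosh_dist x y \<Longrightarrow> cosh_dist x y \<le> 1 + 2 * \<epsilon> \<Longrightarrow> \<bar>f y - l\<bar> \<le> \<delta>"
  shows "\<bar>average \<epsilon> f x - l * mass x\<bar> \<le> \<delta> * mass x"
proof -
  let ?k = "\<lambda>y. avg_kernel DIM('a) \<epsilon> (cosh_dist x y)"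
  have int: "integrable hyp_vol (\<lambda>y. g y * ?k y)" if "continuous_on hyp_space g" for g
    by (rule average_integrable[OF x that e])
  have c1: "c * mass x = (LINT y|hyp_vol. c * ?k y)" for c
    using average_1[OF x e] by (simp add: average_def)
  have "average \<epsilon> f x - l * mass x = (LINT y|hyp_vol. f y * ?k y - l * ?k y)"
    unfolding c1 average_def
    by (rule Bochner_Integration.integral_diff[symmetric]) (intro int f continuous_on_const)+
  also have "\<bar>\<dots>\<bar> \<le> (LINT y|hyp_vol. \<bar>f y * ?k y - l * ?k y\<bar>)"
    by (rule integral_abs_bound)
  also have "\<dots> \<le> (LINT y|hyp_vol. \<delta> * ?k y)"
  proof (rule integral_mono)
    show "integrable hyp_vol (\<lambda>y. \<bar>f y * ?k y - l * ?k y\<bar>)"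
      by (intro integrable_abs Bochner_Integration.integrable_diff int f continuous_on_const)
    show "integrable hyp_vol (\<lambda>y. \<delta> * ?k y)" by (intro int continuous_on_const)
    fix y :: 'a assume "y \<in> space hyp_vol"
    then have y: "y \<in> hyp_space" by simp
    have k: "?k y \<ge> 0" using cosh_dist_ge_1[OF x y] e by (rule avg_kernel_nonneg)
    show "\<bar>f y * ?k y - l * ?k y\<bar> \<le> \<delta> * ?k y"
    proof (cases "1 + \<epsilon> \<le> cosh_dist x y \<and> cosh_dist x y \<le> 1 + 2 * \<epsilon>")
      case True
      then show ?thesis using mult_right_mono[OF b[OF y] k] k
        by (simp add: left_diff_distrib[symmetric] abs_mult)
    next
      case False
      then have "?k y = 0" using e by (intro avg_kernel_eq_0) auto
      then show ?thesis by simp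
    qed
  qed
  also have "\<dots> = \<delta> * mass x" by (simp add: c1)
  finally show ?thesis .
qed

lemma norm_diff_le_cosh_dist:
  fixes x :: "'a::euclidean_space"
  assumes "x \<in> hyp_space" "y \<in> hyp_space" "cosh_dist x y \<le> 1 + 2 * \<epsilon>" "\<epsilon> > 0"
  shows "(norm (x - y))\<^sup>2 \<le> \<epsilon>"
proof -
  define P where "P = (1 - (norm x)\<^sup>2) * (1 - (norm y)\<^sup>2)"
  have "(norm x)\<^sup>2 < 1" "(norm y)\<^sup>2 < 1" using hyp_spaceD assms by auto
  then have P: "P > 0" "P \<le> 1" unfolding P_def by (auto intro: mult_pos_pos mult_le_one)
  have "2 * (norm (x - y))\<^sup>2 / P \<le> 2 * \<epsilon>" using assms by (simp add: cosh_dist_def P_def)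
  then have "(norm (x - y))\<^sup>2 \<le> \<epsilon> * P" using P by (simp add: field_simps)
  also have "\<dots> \<le> \<epsilon>" using P assms by (simp add: mult_left_le)
  finally show ?thesis .
qed

lemma average_tendsto_small:
  fixes f :: "'a::euclidean_space \<Rightarrow> real"
  assumes x: "x \<in> hyp_space" and f: "continuous_on hyp_space f"
  shows "(\<lambda>k. average (1 / real (Suc k)) f x) \<longlonglongrightarrow> f x * mass x"
proof (rule LIMSEQ_I)
  fix r :: real assume r: "0 < r"
  have m: "mass x > 0" by (rule mass_pos[OF x])
  define \<delta> where "\<delta> = r / (2 * mass x)"
  have \<delta>: "\<delta> > 0" "\<delta> * mass x < r" using r m by (auto simp: \<delta>_def)
  obtain d where d: "d > 0" "\<And>y. y \<in> hyp_space \<Longrightarrow> dist y x < d \<Longrightarrow> dist (f y) (f x) < \<delta>"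
    using f x \<delta>(1) unfolding continuous_on_iff by metis
  obtain N where N: "inverse (real (Suc N)) < d\<^sup>2" using reals_Archimedean[of "d\<^sup>2"] d by auto
  show "\<exists>N. \<forall>k\<ge>N. norm (average (1 / real (Suc k)) f x - f x * mass x) < r"
  proof (intro exI allI impI)
    fix k assume "k \<ge> N"
    define \<epsilon> where "\<epsilon> = 1 / real (Suc k)"
    have e: "\<epsilon> > 0" by (simp add: \<epsilon>_def)
    have "\<epsilon> \<le> 1 / real (Suc N)" unfolding \<epsilon>_def using \<open>k \<ge> N\<close> by (intro divide_left_mono) auto
    then have ed: "\<epsilon> < d\<^sup>2" using N by (simp add: inverse_eq_divide)
    have "\<bar>average \<epsilon> f x - f x * mass x\<bar> \<le> \<delta> * mass x"
    proof (rule average_bound[OF x f e])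
      fix y assume y: "y \<in> hyp_space" and s: "cosh_dist x y \<le> 1 + 2 * \<epsilon>"
      have "(norm (x - y))\<^sup>2 < d\<^sup>2"
        using norm_diff_le_cosh_dist[OF x y s e] ed by simp
      then have "dist y x < d" using d(1) by (metis dist_commute dist_norm power_less_imp_less_base less_imp_le)
      then show "\<bar>f y - f x\<bar> \<le> \<delta>" using d(2)[OF y] by (simp add: dist_real_def)
    qed
    then show "norm (average (1 / real (Suc k)) f x - f x * mass x) < r"
      using \<delta>(2) by (simp add: \<epsilon>_def)
  qed
qed

lemma cosh_dist_bounded_on_compact:
  assumes "x \<in> hyp_space" "compact K" "K \<subseteq> hyp_space"
  obtains B where "\<And>y. y \<in> K \<Longrightarrow> cosh_dist x y \<le> B"
proof -
  have "bounded (cosh_dist x ` K)"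
    by (intro compact_imp_bounded compact_continuous_image assms continuous_on_subset[OF continuous_on_cosh_dist[OF assms(1)]])
  then show ?thesis using that unfolding bounded_iff by (auto simp: abs_le_iff)
qed

text \<open>The sublevel sets of the distance to \<open>x0\<close> are compact.\<close>

lemma hyp_limit_compact:
  fixes u :: "'a::euclidean_space \<Rightarrow> real"
  assumes x0: "x0 \<in> hyp_space"
    and lim: "(u \<longlongrightarrow> l) (inf (filtercomap (\<lambda>x. hyp_dist x x0) at_top) (principal hyp_space))"
    and d: "\<delta> > 0"
  obtains K where "compact K" "K \<subseteq> hyp_space" "\<And>y. y \<in> hyp_space - K \<Longrightarrow> \<bar>u y - l\<bar> < \<delta>"
proof -
  have "\<forall>\<^sub>F y in inf (filtercomap (\<lambda>x. hyp_dist x x0) at_top) (principal hyp_space). dist (u y) l < \<delta>"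
    using lim d by (rule tendstoD)
  then obtain b where b: "\<And>y. y \<in> hyp_space \<Longrightarrow> hyp_dist y x0 \<ge> b \<Longrightarrow> \<bar>u y - l\<bar> < \<delta>"
    unfolding eventually_inf_principal eventually_filtercomap_at_top_linorder by (auto simp: dist_real_def)
  define K where "K = {y \<in> hyp_space. cosh_dist x0 y \<le> cosh (max b 0)}"
  have "\<bar>u y - l\<bar> < \<delta>" if y: "y \<in> hyp_space - K" for y
  proof -
    have "cosh (max b 0) < cosh_dist x0 y" using y by (auto simp: K_def)
    then have "max b 0 \<le> arcosh (cosh_dist x0 y)"
      using arcosh_real_strict_mono[of "cosh (max b 0)" "cosh_dist x0 y"] arcosh_cosh_real[of "max b 0"]
      by (simp add: cosh_real_ge_1)
    then show ?thesis using b[of y] y by (simp add: hyp_dist_eq_arcosh cosh_dist_commute)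
  qed
  moreover have "compact K" "K \<subseteq> hyp_space" using compact_cosh_ball[OF x0] by (auto simp: K_def)
  ultimately show ?thesis using that by blast
qed

lemma average_tendsto_infinity:
  fixes u :: "'a::euclidean_space \<Rightarrow> real"
  assumes x: "x \<in> hyp_space" and x0: "x0 \<in> hyp_space" and u: "continuous_on hyp_space u"
    and lim: "(u \<longlongrightarrow> l) (inf (filtercomap (\<lambda>x. hyp_dist x x0) at_top) (principal hyp_space))"
  shows "(\<lambda>k. average (real (Suc k)) u x) \<longlonglongrightarrow> l * mass x"
proof (rule LIMSEQ_I)
  fix r :: real assume r: "0 < r"
  have m: "mass x > 0" by (rule mass_pos[OF x])
  define \<delta> where "\<delta> = r / (2 * mass x)"
  have \<delta>: "\<delta> > 0" "\<delta> * mass x < r" using r m by (auto simp: \<delta>_def)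
  obtain K where K: "compact K" "K \<subseteq> hyp_space" "\<And>y. y \<in> hyp_space - K \<Longrightarrow> \<bar>u y - l\<bar> < \<delta>"
    using hyp_limit_compact[OF x0 lim \<delta>(1)] by blast
  obtain B where B: "\<And>y. y \<in> K \<Longrightarrow> cosh_dist x y \<le> B"
    using cosh_dist_bounded_on_compact[OF x K(1,2)] by blast
  obtain N where N: "B < real N" using reals_Archimedean2 by blast
  show "\<exists>N. \<forall>k\<ge>N. norm (average (real (Suc k)) u x - l * mass x) < r"
  proof (intro exI allI impI)
    fix k assume "k \<ge> N"
    have "\<bar>average (real (Suc k)) u x - l * mass x\<bar> \<le> \<delta> * mass x"
    proof (rule average_bound[OF x u])
      fix y assume y: "y \<in> hyp_space" and s: "1 + real (Suc k) \<le> cosh_dist x y"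
      have "y \<notin> K" using B[of y] s N \<open>k \<ge> N\<close> by auto
      then show "\<bar>u y - l\<bar> \<le> \<delta>" using K(3)[of y] y by simp
    qed simp
    then show "norm (average (real (Suc k)) u x - l * mass x) < r" using \<delta>(2) by simp
  qed
qed

section \<open>Reflections of the ball model\<close>

text \<open>For a unit vector \<open>e\<close> and \<open>\<bar>a\<bar> < 1\<close> the set \<open>plane_height e a x = 0\<close> is a hyperbolic
  hyperplane orthogonal to the diameter in direction \<open>e\<close>, and \<open>reflection e a\<close> is the hyperbolic
  reflection in it; in the hyperboloid model it is the Lorentz reflection with normal \<open>(a, e)\<close>.\<close>

definition plane_height :: "'a::euclidean_space \<Rightarrow> real \<Rightarrow> 'a \<Rightarrow> real" where
  "plane_height e a x = e \<bullet> x - a * (1 + x \<bullet> x) / 2"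

definition plane_normal :: "'a::euclidean_space \<Rightarrow> real \<Rightarrow> 'a \<Rightarrow> 'a" where
  "plane_normal e a x = e - a *\<^sub>R x"

definition reflection :: "'a::euclidean_space \<Rightarrow> real \<Rightarrow> 'a \<Rightarrow> 'a" where
  "reflection e a x =
    x - (2 * plane_height e a x / (plane_normal e a x \<bullet> plane_normal e a x)) *\<^sub>R plane_normal e a x"

text \<open>The conformal factor of the reflection. The defect \<open>1 - x \<bullet> x\<close>, the normal and, up to sign, the
  height are all multiplied by it under the reflection.\<close>

definition reflection_ratio :: "'a::euclidean_space \<Rightarrow> real \<Rightarrow> 'a \<Rightarrow> real" where
  "reflection_ratio e a x = (1 - a\<^sup>2) / (plane_normal e a x \<bullet> plane_normal e a x)"

lemma plane_normal_inner:
  assumes "e \<bullet> e = 1"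
  shows "plane_normal e a x \<bullet> plane_normal e a x = 1 - a\<^sup>2 - 2 * a * plane_height e a x"
  using assms
  by (simp add: plane_normal_def plane_height_def inner_diff inner_commute power2_eq_square field_simps)

lemma plane_normal_pos:
  assumes "e \<bullet> e = 1" "\<bar>a\<bar> < 1" "x \<in> hyp_space"
  shows "plane_normal e a x \<bullet> plane_normal e a x > 0"
proof -
  have "norm e = 1" using assms(1) by (simp add: norm_eq_sqrt_inner)
  have "norm (a *\<^sub>R x) \<le> \<bar>a\<bar> * 1" using assms(3) by (simp add: hyp_space_def mult_left_le)
  then have "e \<noteq> a *\<^sub>R x" using \<open>norm e = 1\<close> assms(2) by auto
  then show ?thesis by (simp add: plane_normal_def)
qed

locale hyp_reflection =
  fixes e :: "'a::euclidean_space" and a :: real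
  assumes unit: "e \<bullet> e = 1" and small: "\<bar>a\<bar> < 1"
begin

abbreviation "h \<equiv> plane_height e a"
abbreviation "N \<equiv> plane_normal e a"
abbreviation "\<sigma> \<equiv> reflection e a"
abbreviation "\<mu> \<equiv> reflection_ratio e a"

lemma q_pos: "1 - a\<^sup>2 > 0"
  using small by (simp add: abs_square_less_1)

lemma N_inner: "N x \<bullet> N x = 1 - a\<^sup>2 - 2 * a * h x"
  by (rule plane_normal_inner[OF unit])

lemma N_pos: "x \<in> hyp_space \<Longrightarrow> N x \<bullet> N x > 0"
  by (rule plane_normal_pos[OF unit small])

lemma \<mu>_pos: "x \<in> hyp_space \<Longrightarrow> \<mu> x > 0"
  using N_pos q_pos by (simp add: reflection_ratio_def)

lemma \<mu>_alt:
  assumes "x \<in> hyp_space"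
  shows "\<mu> x = 1 + a * (2 * h x / (N x \<bullet> N x))"
proof -
  have "1 - a\<^sup>2 = N x \<bullet> N x + a * (2 * h x)" using N_inner[of x] by simp
  then show ?thesis using N_pos[OF assms] by (simp add: reflection_ratio_def add_divide_distrib)
qed

lemma inner_refl:
  assumes "x \<in> hyp_space"
  shows "\<sigma> x \<bullet> \<sigma> x = x \<bullet> x - a * (2 * h x / (N x \<bullet> N x)) * (1 - x \<bullet> x)"
proof -
  define t where "t = 2 * h x / (N x \<bullet> N x)"
  have tN: "t * (N x \<bullet> N x) = 2 * h x" using N_pos[OF assms] by (simp add: t_def)
  have "\<sigma> x \<bullet> \<sigma> x = x \<bullet> x - 2 * t * (x \<bullet> N x) + t * (t * (N x \<bullet> N x))"
    by (simp add: reflection_def t_def[symmetric] inner_diff inner_commute algebra_simps)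
  also have "\<dots> = x \<bullet> x + t * (2 * h x - 2 * (x \<bullet> N x))" unfolding tN by (simp add: algebra_simps)
  also have "2 * h x - 2 * (x \<bullet> N x) = - a * (1 - x \<bullet> x)"
    by (simp add: plane_height_def plane_normal_def inner_diff inner_commute algebra_simps)
  finally show ?thesis by (simp add: t_def)
qed

lemma norm_refl:
  assumes "x \<in> hyp_space"
  shows "1 - \<sigma> x \<bullet> \<sigma> x = \<mu> x * (1 - x \<bullet> x)"
  unfolding inner_refl[OF assms] \<mu>_alt[OF assms] by (simp add: algebra_simps)

lemma refl_in: "x \<in> hyp_space \<Longrightarrow> \<sigma> x \<in> hyp_space"
proof -
  assume x: "x \<in> hyp_space"
  have "\<mu> x * (1 - x \<bullet> x) > 0" using \<mu>_pos[OF x] hyp_space_denom[OF x] by (rule mult_pos_pos)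
  then have "(norm (\<sigma> x))\<^sup>2 < 1" using norm_refl[OF x] by (simp add: power2_norm_eq_inner)
  then show ?thesis by (simp add: hyp_space_def abs_square_less_1)
qed

lemma conformal_refl:
  "x \<in> hyp_space \<Longrightarrow> conformal_factor (\<sigma> x) = conformal_factor x / \<mu> x"
  by (simp add: conformal_factor_def power2_norm_eq_inner norm_refl)

lemma N_refl: "x \<in> hyp_space \<Longrightarrow> N (\<sigma> x) = \<mu> x *\<^sub>R N x"
  by (simp add: plane_normal_def[of e a "\<sigma> x"] \<mu>_alt)
     (simp add: reflection_def plane_normal_def algebra_simps)

lemma h_refl: 
  assumes x: "x \<in> hyp_space" shows "h (\<sigma> x) = - \<mu> x * h x"
proof -
  define t where "t = 2 * h x / (N x \<bullet> N x)"
  have tN: "t * (N x \<bullet> N x) = 2 * h x" using N_pos[OF assms] by (simp add: t_def)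
  have "h (\<sigma> x) = e \<bullet> x - t * (e \<bullet> N x) - a * (1 + (x \<bullet> x - a * t * (1 - x \<bullet> x))) / 2"
    unfolding plane_height_def[of e a "\<sigma> x"] inner_refl[OF x] t_def[symmetric]
    by (simp add: reflection_def t_def[symmetric] inner_diff)
  also have "\<dots> = h x - t * (e \<bullet> N x - a\<^sup>2 * (1 - x \<bullet> x) / 2)"
    by (simp add: plane_height_def power2_eq_square field_simps)
  also have "e \<bullet> N x - a\<^sup>2 * (1 - x \<bullet> x) / 2 = N x \<bullet> N x + a * h x"
    using unit by (simp add: plane_height_def plane_normal_def inner_diff inner_commute power2_eq_square field_simps)
  also have "h x - t * (N x \<bullet> N x + a * h x) = - (1 + a * t) * h x"
    using tN by (simp add: algebra_simps)
  finally show ?thesis by (simp add: \<mu>_alt[OF x] t_def)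
qed

lemma refl_refl: 
  assumes x: "x \<in> hyp_space" shows "\<sigma> (\<sigma> x) = x"
proof -
  have "\<mu> x \<noteq> 0" using \<mu>_pos[OF x] by simp
  then have "2 * (- \<mu> x * h x) / (\<mu> x *\<^sub>R N x \<bullet> \<mu> x *\<^sub>R N x) * \<mu> x = - (2 * h x / (N x \<bullet> N x))"
    by simp
  then have "(2 * (- \<mu> x * h x) / (\<mu> x *\<^sub>R N x \<bullet> \<mu> x *\<^sub>R N x)) *\<^sub>R \<mu> x *\<^sub>R N x = - (2 * h x / (N x \<bullet> N x)) *\<^sub>R N x"
    by (simp only: scaleR_scaleR)
  then show ?thesis
    unfolding reflection_def[of e a "\<sigma> x"] N_refl[OF x] h_refl[OF x] by (simp add: reflection_def)
qed

text \<open>This is the formula $-\langle X - 2\langle X,N\rangle N, Y\rangle = -\langle X,Y\rangle +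
  2 \langle X,N\rangle\langle Y,N\rangle$ of the hyperboloid model. Its sign decides which of \<open>x\<close>
  and its mirror image is closer to \<open>y\<close>; that the reflection is an isometry follows from it.\<close>

lemma cosh_dist_refl_left:
  assumes x: "x \<in> hyp_space" and y: "y \<in> hyp_space"
  shows "cosh_dist (\<sigma> x) y = cosh_dist x y
    + 2 * (conformal_factor x * h x) * (conformal_factor y * h y) / (1 - a\<^sup>2)"
proof -
  define t n where "t = 2 * h x / (N x \<bullet> N x)" and "n = N x \<bullet> N x"
  have n: "n > 0" using N_pos[OF x] by (simp add: n_def)
  have tn: "t * n = 2 * h x" using n by (simp add: t_def n_def)
  have q: "1 - a\<^sup>2 = n + 2 * a * h x" using N_inner[of x] by (simp add: n_def)
  have m: "\<mu> x = (1 - a\<^sup>2) / n" by (simp add: reflection_ratio_def n_def)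
  have "(norm (\<sigma> x - y))\<^sup>2 = (norm (x - y - t *\<^sub>R N x))\<^sup>2"
    by (simp add: reflection_def t_def algebra_simps)
  also have "\<dots> = (norm (x - y))\<^sup>2 - 2 * t * (N x \<bullet> (x - y)) + t * (t * n)"
    by (simp add: power2_norm_eq_inner n_def inner_diff inner_commute algebra_simps)
  finally have d: "(norm (\<sigma> x - y))\<^sup>2 = (norm (x - y))\<^sup>2 - 2 * t * (N x \<bullet> (x - y)) + t * (2 * h x)"
    by (simp add: tn)
  have key: "n * (norm (\<sigma> x - y))\<^sup>2 - (1 - a\<^sup>2) * (norm (x - y))\<^sup>2 = 4 * h x * h y"
  proof -
    have "n * (norm (\<sigma> x - y))\<^sup>2 - (1 - a\<^sup>2) * (norm (x - y))\<^sup>2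
        = (t * n) * (2 * h x - 2 * (N x \<bullet> (x - y))) - 2 * a * h x * (norm (x - y))\<^sup>2"
      unfolding d q by (simp add: algebra_simps)
    also have "\<dots> = 2 * h x * (2 * h x - 2 * (N x \<bullet> (x - y)) - a * (norm (x - y))\<^sup>2)"
      unfolding tn by (simp add: algebra_simps)
    also have "2 * h x - 2 * (N x \<bullet> (x - y)) - a * (norm (x - y))\<^sup>2 = 2 * h y"
      by (simp add: plane_height_def plane_normal_def power2_norm_eq_inner inner_diff inner_commute field_simps)
    finally show ?thesis by simp
  qed
  have "conformal_factor (\<sigma> x) * (norm (\<sigma> x - y))\<^sup>2 = conformal_factor x * (n * (norm (\<sigma> x - y))\<^sup>2) / (1 - a\<^sup>2)"
    by (simp add: conformal_refl[OF x] m)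
  also have "n * (norm (\<sigma> x - y))\<^sup>2 = (1 - a\<^sup>2) * (norm (x - y))\<^sup>2 + 4 * h x * h y"
    using key by linarith
  also have "conformal_factor x * ((1 - a\<^sup>2) * (norm (x - y))\<^sup>2 + 4 * h x * h y) / (1 - a\<^sup>2)
      = conformal_factor x * ((1 - a\<^sup>2) * (norm (x - y))\<^sup>2 / (1 - a\<^sup>2)) + 4 * conformal_factor x * h x * h y / (1 - a\<^sup>2)"
    by (simp add: add_divide_distrib distrib_left)
  also have "\<dots> = conformal_factor x * (norm (x - y))\<^sup>2 + 4 * conformal_factor x * h x * h y / (1 - a\<^sup>2)"
    using q_pos by simp
  finally have *: "conformal_factor (\<sigma> x) * (norm (\<sigma> x - y))\<^sup>2 = conformal_factor x * (norm (x - y))\<^sup>2 + 4 * conformal_factor x * h x * h y / (1 - a\<^sup>2)" .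
  have "cosh_dist (\<sigma> x) y = 1 + conformal_factor y * (conformal_factor (\<sigma> x) * (norm (\<sigma> x - y))\<^sup>2) / 2"
    by (simp add: cosh_dist_conformal)
  also have "\<dots> = cosh_dist x y + 2 * (conformal_factor x * h x) * (conformal_factor y * h y) / (1 - a\<^sup>2)"
  proof -
    have "1 + m * (l * d + 4 * l * u * v / q) / 2 = 1 + l * m * d / 2 + 2 * (l * u) * (m * v) / q"
      if "q \<noteq> 0" for m l d u v q :: real
      using that by (simp add: field_simps)
    then show ?thesis unfolding * using q_pos by (simp add: cosh_dist_conformal)
  qed
  finally show ?thesis .
qed

lemma cosh_dist_refl_right:
  assumes "x \<in> hyp_space" "y \<in> hyp_space"
  shows "cosh_dist x (\<sigma> y) = cosh_dist (\<sigma> x) y"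
  unfolding cosh_dist_commute[of x "\<sigma> y"] cosh_dist_refl_left[OF assms] cosh_dist_refl_left[OF assms(2,1)]
    cosh_dist_commute[of y x]
  by simp

lemma cosh_dist_refl:
  assumes "x \<in> hyp_space" "y \<in> hyp_space"
  shows "cosh_dist (\<sigma> x) (\<sigma> y) = cosh_dist x y"
  using cosh_dist_refl_right[OF refl_in assms(2)] assms refl_refl by simp

lemma refl_has_derivative:
  assumes x: "x \<in> hyp_space"
  shows "(\<sigma> has_derivative (\<lambda>v. \<mu> x *\<^sub>R (v - (2 * (N x \<bullet> v) / (N x \<bullet> N x)) *\<^sub>R N x))) (at x)"
proof -
  define n where "n = N x \<bullet> N x"
  have n: "n > 0" using N_pos[OF x] by (simp add: n_def)
  have hd: "(h has_derivative (\<lambda>v. N x \<bullet> v)) (at x)"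
    unfolding plane_height_def[abs_def]
    by (auto intro!: derivative_eq_intros
        simp: fun_eq_iff plane_normal_def inner_diff inner_commute field_simps)
  have nd: "((\<lambda>x. N x \<bullet> N x) has_derivative (\<lambda>v. - (2 * a * (N x \<bullet> v)))) (at x)"
    unfolding N_inner
    by (rule has_derivative_eq_rhs[OF has_derivative_diff[OF has_derivative_const has_derivative_mult_right[OF hd]]]) simp
  have td: "((\<lambda>x. 2 * h x / (N x \<bullet> N x)) has_derivative (\<lambda>v. \<mu> x * (2 * (N x \<bullet> v) / n))) (at x)"
  proof (rule has_derivative_eq_rhs)
    show "((\<lambda>x. 2 * h x / (N x \<bullet> N x)) has_derivative
        (\<lambda>v. - (2 * h x) * (inverse (N x \<bullet> N x) * - (2 * a * (N x \<bullet> v)) * inverse (N x \<bullet> N x)) + 2 * (N x \<bullet> v) / (N x \<bullet> N x))) (at x)"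
      by (rule has_derivative_divide[OF has_derivative_mult_right[OF hd] nd]) (use n in \<open>simp add: n_def\<close>)
    show "(\<lambda>v. - (2 * h x) * (inverse (N x \<bullet> N x) * - (2 * a * (N x \<bullet> v)) * inverse (N x \<bullet> N x)) + 2 * (N x \<bullet> v) / (N x \<bullet> N x))
       = (\<lambda>v. \<mu> x * (2 * (N x \<bullet> v) / n))"
      unfolding \<mu>_alt[OF x] n_def[symmetric] using n by (simp add: fun_eq_iff field_simps)
  qed
  have Nd: "(N has_derivative (\<lambda>v. - a *\<^sub>R v)) (at x)"
    unfolding plane_normal_def[abs_def] by (auto intro!: derivative_eq_intros)
  show ?thesis
    unfolding reflection_def[abs_def]
  proof (rule has_derivative_eq_rhs)
    show "((\<lambda>x. x - (2 * h x / (N x \<bullet> N x)) *\<^sub>R N x) has_derivative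
       (\<lambda>v. v - ((2 * h x / (N x \<bullet> N x)) *\<^sub>R (- a *\<^sub>R v) + (\<mu> x * (2 * (N x \<bullet> v) / n)) *\<^sub>R N x))) (at x)"
      by (intro has_derivative_diff has_derivative_ident has_derivative_scaleR td Nd)
    show "(\<lambda>v. v - ((2 * h x / (N x \<bullet> N x)) *\<^sub>R (- a *\<^sub>R v) + (\<mu> x * (2 * (N x \<bullet> v) / n)) *\<^sub>R N x))
       = (\<lambda>v. \<mu> x *\<^sub>R (v - (2 * (N x \<bullet> v) / (N x \<bullet> N x)) *\<^sub>R N x))"
    proof
      fix v :: 'a
      have "v + (a * (2 * h x / (N x \<bullet> N x))) *\<^sub>R v = \<mu> x *\<^sub>R v"
        unfolding \<mu>_alt[OF x] by (simp add: scaleR_left_distrib)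
      then show "v - ((2 * h x / (N x \<bullet> N x)) *\<^sub>R (- a *\<^sub>R v) + (\<mu> x * (2 * (N x \<bullet> v) / n)) *\<^sub>R N x)
       = \<mu> x *\<^sub>R (v - (2 * (N x \<bullet> v) / (N x \<bullet> N x)) *\<^sub>R N x)"
        by (simp add: scaleR_diff_right n_def algebra_simps)
    qed
  qed
qed

lemma continuous_on_refl: "continuous_on hyp_space \<sigma>"
  by (rule has_derivative_continuous_on[OF has_derivative_at_withinI[OF refl_has_derivative]])

lemma measurable_refl: "\<sigma> \<in> measurable hyp_vol hyp_vol"
proof -
  have "\<sigma> \<in> measurable (restrict_space borel hyp_space) (restrict_space borel hyp_space)"
    by (rule measurable_restrict_space2)
       (auto simp: space_restrict_space refl_in intro!: borel_measurable_continuous_on_restrict continuous_on_refl)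
  then show ?thesis by (simp only: measurable_cong_sets[OF sets_hyp_vol sets_hyp_vol])
qed

text \<open>The derivative of the reflection is \<open>\<mu> x\<close> times a Euclidean reflection, so its determinant is
  \<open>\<mu> x ^ n\<close> up to sign, exactly what the volume density requires.\<close>

lemma householder_orthogonal:
  assumes "x \<in> hyp_space"
  shows "orthogonal_transformation (\<lambda>v. v - (2 * (N x \<bullet> v) / (N x \<bullet> N x)) *\<^sub>R N x)" (is "orthogonal_transformation ?H")
  unfolding orthogonal_transformation
proof (intro conjI allI)
  have c: "2 * (N x \<bullet> (u + v)) / (N x \<bullet> N x) = 2 * (N x \<bullet> u) / (N x \<bullet> N x) + 2 * (N x \<bullet> v) / (N x \<bullet> N x)"
    "2 * (N x \<bullet> (r *\<^sub>R u)) / (N x \<bullet> N x) = r * (2 * (N x \<bullet> u) / (N x \<bullet> N x))" for u v r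
    by (simp_all add: inner_add_right add_divide_distrib)
  show "linear ?H"
  proof (rule linearI)
    show "?H (u + v) = ?H u + ?H v" for u v unfolding c scaleR_left_distrib by simp
    show "?H (r *\<^sub>R u) = r *\<^sub>R ?H u" for r u unfolding c by (simp only: scaleR_diff_right scaleR_scaleR)
  qed
  fix v
  define n c where "n = N x \<bullet> N x" and "c = 2 * (N x \<bullet> v) / n"
  have cn: "c * n = 2 * (N x \<bullet> v)" using N_pos[OF assms] by (simp add: c_def n_def)
  have "(norm (?H v))\<^sup>2 = (norm v)\<^sup>2 - 2 * c * (N x \<bullet> v) + c * (c * n)"
    unfolding n_def[symmetric] c_def[symmetric]
    by (simp add: power2_norm_eq_inner inner_diff inner_commute n_def algebra_simps)
  also have "\<dots> = (norm v)\<^sup>2" unfolding cn by simp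
  finally show "norm (?H v) = norm v" by simp
qed

end

section \<open>Reflections preserve the hyperbolic volume\<close>

lemma integral_reflection_wellorder:
  fixes e :: "real ^ 'm::{finite,wellorder}" and f :: "real ^ 'm::_ \<Rightarrow> real"
  assumes "hyp_reflection e a" and f: "integrable hyp_vol f"
  shows "integral\<^sup>L hyp_vol (\<lambda>y. f (reflection e a y)) = integral\<^sup>L hyp_vol f"
proof -
  interpret hyp_reflection e a by fact
  let ?l = conformal_factor
  define n where "n = DIM(real ^ 'm::_)"
  define B where "B = (hyp_space :: (real ^ 'm::_) set)"
  have fm: "f \<in> borel_measurable hyp_vol" using f by simp
  have fsm: "(\<lambda>y. f (\<sigma> y)) \<in> borel_measurable hyp_vol"
    by (rule measurable_compose[OF measurable_refl fm])
  define w where "w f y = ?l y ^ n * f y" for f :: "real ^ 'm::_ \<Rightarrow> real" and y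
  have wm: "(\<lambda>y. indicator B y * w f y) \<in> borel_measurable lborel" if "f \<in> borel_measurable hyp_vol" for f
  proof -
    have "w f \<in> borel_measurable (restrict_space borel B)"
      unfolding w_def[abs_def] B_def
      by (intro borel_measurable_times conformal_factor_power_measurable) (use that in \<open>simp add: measurable_hyp_vol_cong\<close>)
    then show ?thesis
      by (simp add: borel_measurable_restrict_space_iff B_def hyp_space_open)
  qed
  have conv: "integrable hyp_vol f \<longleftrightarrow> w f absolutely_integrable_on B"
    "integrable hyp_vol f \<Longrightarrow> integral\<^sup>L hyp_vol f = integral B (w f)"
    if m: "f \<in> borel_measurable hyp_vol" for f
  proof -
    have "w f absolutely_integrable_on B \<longleftrightarrow> integrable lborel (\<lambda>y. indicator B y * w f y)"
      unfolding set_integrable_def using integrable_completion[OF wm[OF m]] by simp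
    then show 1: "integrable hyp_vol f \<longleftrightarrow> w f absolutely_integrable_on B"
      using hyp_vol_integral(2)[OF m] by (simp add: w_def B_def n_def)
    assume i: "integrable hyp_vol f"
    have "integral\<^sup>L hyp_vol f = integral\<^sup>L lborel (\<lambda>y. indicator B y * w f y)"
      using hyp_vol_integral(1)[OF m] by (simp add: w_def B_def n_def)
    also have "\<dots> = integral\<^sup>L lebesgue (\<lambda>y. indicator B y * w f y)"
      by (rule integral_completion[OF wm[OF m], symmetric])
    also have "\<dots> = integral B (w f)"
      using set_lebesgue_integral_eq_integral(2)[of B "w f"] 1 i by (simp add: set_lebesgue_integral_def)
    finally show "integral\<^sup>L hyp_vol f = integral B (w f)" .
  qed
  define D where "D x v = \<mu> x *\<^sub>R (v - (2 * (N x \<bullet> v) / (N x \<bullet> N x)) *\<^sub>R N x)" for x v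
  have det: "\<bar>det (matrix (D x))\<bar> = \<mu> x ^ n" if x: "x \<in> B" for x
  proof -
    let ?H = "\<lambda>v. v - (2 * (N x \<bullet> v) / (N x \<bullet> N x)) *\<^sub>R N x"
    have o: "orthogonal_transformation ?H" using householder_orthogonal x by (simp add: B_def)
    have "D x = (*\<^sub>R) (\<mu> x) \<circ> ?H" by (auto simp: D_def)
    moreover have "linear ((*\<^sub>R) (\<mu> x) :: real ^ 'm::_ \<Rightarrow> _)" by (rule linear_scaleR)
    ultimately have "matrix (D x) = matrix ((*\<^sub>R) (\<mu> x)) ** matrix ?H"
      using matrix_compose[of ?H "(*\<^sub>R) (\<mu> x)"] o by (simp add: orthogonal_transformation)
    then have "\<bar>det (matrix (D x))\<bar> = \<bar>\<mu> x ^ CARD('m)\<bar> * \<bar>det (matrix ?H)\<bar>"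
      by (simp only: det_mul abs_mult det_matrix_scaleR)
    then show ?thesis
      using orthogonal_transformation_det[OF o] \<mu>_pos[of x] x by (simp add: n_def B_def)
  qed
  have img: "\<sigma> ` B = B" 
    unfolding B_def using refl_in refl_refl by (metis (no_types, lifting) image_subset_iff subsetI subset_antisym image_eqI)
  have "(\<lambda>x. \<bar>det (matrix (D x))\<bar> *\<^sub>R vec (w f (\<sigma> x)) :: real ^ 1) absolutely_integrable_on B \<and>
      integral B (\<lambda>x. \<bar>det (matrix (D x))\<bar> *\<^sub>R vec (w f (\<sigma> x))) = (vec b :: real ^ 1) \<longleftrightarrow>
      (\<lambda>x. vec (w f x) :: real ^ 1) absolutely_integrable_on (\<sigma> ` B) \<and>
      integral (\<sigma> ` B) (\<lambda>x. vec (w f x)) = (vec b :: real ^ 1)" for b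
  proof (rule has_absolute_integral_change_of_variables)
    show "B \<in> sets lebesgue" by (simp add: B_def hyp_space_open borel_open)
    show "(\<sigma> has_derivative D x) (at x within B)" if "x \<in> B" for x
      using refl_has_derivative[of x] that has_derivative_at_withinI unfolding B_def D_def by blast
    show "inj_on \<sigma> B" unfolding B_def by (rule inj_on_inverseI[of _ \<sigma>]) (rule refl_refl)
  qed
  then have cov: "(\<lambda>x. \<bar>det (matrix (D x))\<bar> * w f (\<sigma> x)) absolutely_integrable_on B \<and>
      integral B (\<lambda>x. \<bar>det (matrix (D x))\<bar> * w f (\<sigma> x)) = b \<longleftrightarrow>
      w f absolutely_integrable_on B \<and> integral B (w f) = b" for b
    by (simp add: absolutely_integrable_on_1_iff integral_on_1_eq img)
  have eq: "\<bar>det (matrix (D x))\<bar> * w f (\<sigma> x) = w (\<lambda>y. f (\<sigma> y)) x" if "x \<in> B" for x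
  proof -
    have "\<mu> x ^ n * (?l x / \<mu> x) ^ n = ?l x ^ n"
      using \<mu>_pos[of x] that by (simp add: B_def power_divide)
    then show ?thesis
      using det[OF that] conformal_refl[of x] that by (simp add: w_def B_def)
  qed
  have "w f absolutely_integrable_on B" using conv(1)[OF fm] f by blast
  with cov[of "integral B (w f)"] have
    "(\<lambda>x. \<bar>det (matrix (D x))\<bar> * w f (\<sigma> x)) absolutely_integrable_on B"
    "integral B (\<lambda>x. \<bar>det (matrix (D x))\<bar> * w f (\<sigma> x)) = integral B (w f)" by blast+
  then have "w (\<lambda>y. f (\<sigma> y)) absolutely_integrable_on B" "integral B (w (\<lambda>y. f (\<sigma> y))) = integral B (w f)"
    using eq set_integrable_cong[of lebesgue lebesgue B B "\<lambda>x. \<bar>det (matrix (D x))\<bar> * w f (\<sigma> x)" "w (\<lambda>y. f (\<sigma> y))"]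
      Henstock_Kurzweil_Integration.integral_cong[of B "\<lambda>x. \<bar>det (matrix (D x))\<bar> * w f (\<sigma> x)" "w (\<lambda>y. f (\<sigma> y))"] by auto
  then show ?thesis using conv[OF fsm] conv(2)[OF fm f] by simp
qed

text \<open>The change of variables formula concerns Cartesian powers over index types with a well-order.
  An arbitrary finite index type is relabelled by a well-ordered copy, a linear isometry
  that permutes the coordinates and preserves volume, distances and reflections.\<close>

typedef 'n wo_copy = "UNIV :: 'n set" by simp

instance wo_copy :: (finite) finite
proof
  have "range (Abs_wo_copy :: 'a \<Rightarrow> 'a wo_copy) = UNIV"
    by (rule surjI[of _ Rep_wo_copy]) (rule Rep_wo_copy_inverse)
  then show "finite (UNIV :: 'a wo_copy set)" using finite_imageI[OF finite, of Abs_wo_copy "UNIV :: 'a set"] by simp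
qed

instantiation wo_copy :: (finite) wellorder
begin

definition less_eq_wo_copy :: "'a wo_copy \<Rightarrow> 'a wo_copy \<Rightarrow> bool" where
  "less_eq_wo_copy x y \<longleftrightarrow> to_nat (Rep_wo_copy x) \<le> to_nat (Rep_wo_copy y)"

definition less_wo_copy :: "'a wo_copy \<Rightarrow> 'a wo_copy \<Rightarrow> bool" where
  "less_wo_copy x y \<longleftrightarrow> to_nat (Rep_wo_copy x) < to_nat (Rep_wo_copy y)"

instance
proof
  fix P :: "'a wo_copy \<Rightarrow> bool" and a
  assume step: "\<And>x. (\<And>y. y < x \<Longrightarrow> P y) \<Longrightarrow> P x"
  show "P a"
  proof (induction a rule: measure_induct_rule[where f = "\<lambda>x. to_nat (Rep_wo_copy x)"])
    case (less x)
    show ?case by (rule step, rule less) (simp add: less_wo_copy_def)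
  qed
qed (auto simp: less_eq_wo_copy_def less_wo_copy_def Rep_wo_copy_inject)

end

definition relabel :: "real ^ 'n wo_copy \<Rightarrow> real ^ 'n::finite" where
  "relabel x = (\<chi> i. x $ Abs_wo_copy i)"

lemma bij_Abs_wo_copy: "bij Abs_wo_copy"
  by (rule bij_betw_byWitness[where f' = Rep_wo_copy]) (simp_all add: Abs_wo_copy_inverse Rep_wo_copy_inverse)

lemma relabel_inner: "relabel x \<bullet> relabel y = x \<bullet> y"
  unfolding inner_vec_def relabel_def
  by (simp add: sum.reindex_bij_betw[OF bij_Abs_wo_copy, of "\<lambda>i. x $ i * y $ i"])

lemma linear_relabel: "linear relabel"
  by (intro linearI) (simp_all add: relabel_def vec_eq_iff)

lemma surj_relabel: "surj relabel"
proof (rule surjI)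
  show "relabel (\<chi> i. x $ Rep_wo_copy i) = x" for x :: "real ^ 'n::finite"
    by (simp add: relabel_def vec_eq_iff Abs_wo_copy_inverse)
qed

lemma inj_relabel: "inj (relabel :: real ^ 'n wo_copy \<Rightarrow> real ^ 'n::finite)"
proof (rule injI)
  fix x y :: "real ^ 'n wo_copy"
  assume "relabel x = relabel y"
  then have "relabel (x - y) = 0" by (simp add: linear_diff[OF linear_relabel])
  then have "(x - y) \<bullet> (x - y) = 0" using relabel_inner[of "x - y" "x - y"] by simp
  then show "x = y" by simp
qed

lemma relabel_axis: "relabel (axis i 1) = axis (Rep_wo_copy i) 1"
proof -
  have "i = Abs_wo_copy j \<longleftrightarrow> Rep_wo_copy i = j" for j
    using Abs_wo_copy_inverse[of j] Rep_wo_copy_inverse[of i] by auto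
  then show ?thesis by (simp add: relabel_def axis_def vec_eq_iff eq_commute)
qed

lemma Basis_real_vec: "(Basis :: (real ^ 'k) set) = range (\<lambda>i. axis i 1)"
  by (auto simp: Basis_vec_def)

lemma relabel_Basis: "(relabel :: real ^ 'n wo_copy \<Rightarrow> real ^ 'n::finite) ` Basis = Basis"
proof -
  have "range Rep_wo_copy = (UNIV :: 'n::finite set)"
    by (rule surjI[of _ Abs_wo_copy]) (simp add: Abs_wo_copy_inverse)
  then have "range (\<lambda>i. axis (Rep_wo_copy i) (1::real)) = range (\<lambda>i :: 'n. axis i 1)"
    using image_image[of "\<lambda>i :: 'n. axis i (1::real)" Rep_wo_copy UNIV] by (simp only:)
  then show ?thesis by (simp only: Basis_real_vec image_image relabel_axis)
qed

lemma continuous_on_relabel: "continuous_on S relabel"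
  by (rule linear_continuous_on[OF linear_relabel[THEN linear_conv_bounded_linear[THEN iffD1]]])

lemma borel_measurable_relabel: "relabel \<in> borel_measurable lborel"
  using borel_measurable_continuous_onI[OF continuous_on_relabel] by simp

text \<open>Relabelling maps boxes to boxes with the same side lengths.\<close>

lemma lborel_relabel: "distr lborel borel (relabel :: real ^ 'n wo_copy \<Rightarrow> real ^ 'n::finite) = lborel"
proof (rule lborel_eqI[symmetric])
  fix l u :: "real ^ 'n" assume lu: "\<And>b. b \<in> Basis \<Longrightarrow> l \<bullet> b \<le> u \<bullet> b"
  obtain l' u' where l': "l = relabel l'" "u = relabel u'" using surj_relabel by (metis surjD)
  have "box l u = {z. \<forall>b\<in>relabel ` (Basis :: (real ^ 'n wo_copy) set). l \<bullet> b < z \<bullet> b \<and> z \<bullet> b < u \<bullet> b}"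
    by (simp only: box_def relabel_Basis)
  then have "relabel -` box l u = box l' u'"
    unfolding l' by (auto simp: relabel_inner box_def)
  then have "emeasure (distr lborel borel relabel) (box l u) = emeasure lborel (box l' u')"
    using emeasure_distr[OF borel_measurable_relabel, of "box l u"] by simp
  also have "\<dots> = (\<Prod>b\<in>Basis. (u' - l') \<bullet> b)"
  proof (rule emeasure_lborel_box)
    fix b :: "real ^ 'n wo_copy" assume "b \<in> Basis"
    then have "relabel b \<in> Basis" using relabel_Basis by blast
    from lu[OF this] show "l' \<bullet> b \<le> u' \<bullet> b" unfolding l' relabel_inner .
  qed
  also have "(\<Prod>b\<in>Basis. (u' - l') \<bullet> b) = (\<Prod>b\<in>relabel ` Basis. (u - l) \<bullet> b)"
    unfolding l' prod.reindex[OF inj_on_subset[OF inj_relabel subset_UNIV]]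
    by (simp add: linear_diff[OF linear_relabel, symmetric] relabel_inner)
  finally show "emeasure (distr lborel borel relabel) (box l u) = ennreal (\<Prod>b\<in>Basis. (u - l) \<bullet> b)"
    by (simp add: relabel_Basis)
qed simp

lemma norm_relabel: "norm (relabel x) = norm x"
  by (simp add: norm_eq_sqrt_inner relabel_inner)

lemma relabel_in_hyp_space: "relabel x \<in> hyp_space \<longleftrightarrow> x \<in> hyp_space"
  by (simp add: hyp_space_def norm_relabel)

lemma measurable_relabel: "relabel \<in> measurable hyp_vol hyp_vol"
proof -
  have "relabel \<in> measurable (restrict_space borel hyp_space) (restrict_space borel hyp_space)"
    by (rule measurable_restrict_space2)
       (auto simp: space_restrict_space relabel_in_hyp_space
         intro!: borel_measurable_continuous_on_restrict continuous_on_relabel)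
  then show ?thesis by (simp only: measurable_cong_sets[OF sets_hyp_vol sets_hyp_vol])
qed

lemma hyp_vol_relabel:
  fixes f :: "real ^ 'n \<Rightarrow> real"
  assumes m: "f \<in> borel_measurable hyp_vol"
  shows "integral\<^sup>L hyp_vol (\<lambda>x. f (relabel x)) = integral\<^sup>L hyp_vol f"
    "integrable hyp_vol (\<lambda>x. f (relabel x)) \<longleftrightarrow> integrable hyp_vol f"
proof -
  define g where "g y = indicator hyp_space y * (conformal_factor y ^ CARD('n) * f y)" for y
  have card: "CARD('n wo_copy) = CARD('n)"
    using bij_betw_same_card[OF bij_Abs_wo_copy[where 'a = 'n]] by simp
  have gm: "g \<in> borel_measurable borel"
  proof -
    have "(\<lambda>y. conformal_factor y ^ CARD('n) * f y) \<in> borel_measurable (restrict_space borel hyp_space)"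
      by (intro borel_measurable_times conformal_factor_power_measurable) (use m in \<open>simp add: measurable_hyp_vol_cong\<close>)
    then show ?thesis
      by (simp add: g_def[abs_def] borel_measurable_restrict_space_iff hyp_space_open)
  qed
  have gr: "g (relabel x) = indicator hyp_space x * (conformal_factor x ^ CARD('n wo_copy) * f (relabel x))" for x
    by (simp add: g_def card indicator_def relabel_in_hyp_space conformal_factor_def norm_relabel)
  have fm: "(\<lambda>x. f (relabel x)) \<in> borel_measurable hyp_vol"
    by (rule measurable_compose[OF measurable_relabel m])
  have "integral\<^sup>L lborel (\<lambda>x. g (relabel x)) = integral\<^sup>L (distr lborel borel relabel) g"
    by (rule integral_distr[symmetric]) (use gm borel_measurable_relabel in auto)
  then show "integral\<^sup>L hyp_vol (\<lambda>x. f (relabel x)) = integral\<^sup>L hyp_vol f"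
    unfolding lborel_relabel by (simp add: hyp_vol_integral(1)[OF m] hyp_vol_integral(1)[OF fm] gr) (simp add: g_def[abs_def])
  have "integrable lborel (\<lambda>x. g (relabel x)) \<longleftrightarrow> integrable (distr lborel borel relabel) g"
    by (rule integrable_distr_eq[symmetric]) (use gm borel_measurable_relabel in auto)
  then show "integrable hyp_vol (\<lambda>x. f (relabel x)) \<longleftrightarrow> integrable hyp_vol f"
    unfolding lborel_relabel by (simp add: hyp_vol_integral(2)[OF m] hyp_vol_integral(2)[OF fm] gr) (simp add: g_def[abs_def])
qed

lemma reflection_relabel: "reflection (relabel e) a (relabel x) = relabel (reflection e a x)"
  by (simp add: reflection_def plane_height_def plane_normal_def relabel_inner
      linear_diff[OF linear_relabel, symmetric] linear_scale[OF linear_relabel, symmetric])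

lemma integral_reflection:
  fixes e :: "real ^ 'n" and f :: "real ^ 'n \<Rightarrow> real"
  assumes r: "hyp_reflection e a" and f: "integrable hyp_vol f"
  shows "integral\<^sup>L hyp_vol (\<lambda>y. f (reflection e a y)) = integral\<^sup>L hyp_vol f"
proof -
  interpret hyp_reflection e a by fact
  obtain e' where e': "e = relabel e'" using surj_relabel by (metis surjD)
  have r': "hyp_reflection e' a" using r by (simp add: hyp_reflection_def e' relabel_inner)
  have m: "f \<in> borel_measurable hyp_vol" using f by simp
  have "integral\<^sup>L hyp_vol (\<lambda>y. f (\<sigma> y)) = integral\<^sup>L hyp_vol (\<lambda>x. f (\<sigma> (relabel x)))"
    by (rule hyp_vol_relabel(1)[symmetric]) (rule measurable_compose[OF measurable_refl m])
  also have "\<dots> = integral\<^sup>L hyp_vol (\<lambda>x. f (relabel (reflection e' a x)))"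
    by (simp add: e' reflection_relabel)
  also have "\<dots> = integral\<^sup>L hyp_vol (\<lambda>x. f (relabel x))"
    by (rule integral_reflection_wellorder[OF r', of "\<lambda>x. f (relabel x)"]) (simp add: hyp_vol_relabel(2)[OF m] f)
  also have "\<dots> = integral\<^sup>L hyp_vol f" by (rule hyp_vol_relabel(1)[OF m])
  finally show ?thesis .
qed

section \<open>Bisectors\<close>

text \<open>In the hyperboloid model the reflection that exchanges two points \<open>B\<close> and \<open>Q\<close> has the normal
  \<open>B - Q\<close>. Rescaling its spatial part \<open>w\<close> to a unit vector gives \<open>e\<close> and \<open>a\<close>, and the height of
  \<open>x\<close> becomes a multiple of the difference of the two values of \<open>cosh_dist\<close>.\<close>

lemma bisector:
  fixes q b :: "'a::euclidean_space"
  assumes q: "q \<in> hyp_space" and b: "b \<in> hyp_space" and ne: "q \<noteq> b"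
  obtains e a where "hyp_reflection e a" "reflection e a b = q" "plane_height e a b > 0"
    "\<And>x. x \<in> hyp_space \<Longrightarrow> cosh_dist x q < cosh_dist x b \<Longrightarrow> plane_height e a x < 0"
proof -
  let ?l = "conformal_factor"
  define w where "w = ?l b *\<^sub>R b - ?l q *\<^sub>R q"
  define M where "M = norm w"
  have M0: "M \<ge> 0" by (simp add: M_def)
  define d where "d = ?l b - ?l q"
  have lb: "?l b > 0" and lq: "?l q > 0" using conformal_factor_pos q b by auto
  have s: "cosh_dist q b > 1" by (rule cosh_dist_gt_1[OF q b ne])
  have "w \<bullet> w = (?l b)\<^sup>2 * (b \<bullet> b) - 2 * ?l b * ?l q * (q \<bullet> b) + (?l q)\<^sup>2 * (q \<bullet> q)"
    by (simp add: w_def inner_diff inner_commute power2_eq_square algebra_simps)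
  also have "\<dots> = d\<^sup>2 + 2 * (cosh_dist q b - 1)"
    unfolding norm_via_conformal[OF q] norm_via_conformal[OF b] cosh_dist_lorentz[OF q b] d_def
    using lb lq by (simp add: field_simps power2_eq_square)
  finally have M2: "M\<^sup>2 = d\<^sup>2 + 2 * (cosh_dist q b - 1)" by (simp add: M_def power2_norm_eq_inner)
  then have "d\<^sup>2 < M\<^sup>2" using s by simp
  then have dM: "\<bar>d\<bar> < M" using power2_less_imp_less[of "\<bar>d\<bar>" M] M0 by simp
  then have M: "M > 0" by simp
  define e where "e = w /\<^sub>R M"
  define a where "a = d / M"
  have ee: "e \<bullet> e = 1" using M M_def by (simp add: e_def power2_norm_eq_inner[symmetric] dot_square_norm power2_eq_square)
  have aa: "\<bar>a\<bar> < 1" using dM M by (simp add: a_def)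
  interpret hyp_reflection e a by unfold_locales (rule ee, rule aa)
  have height: "?l x * M * h x = cosh_dist x q - cosh_dist x b" if x: "x \<in> hyp_space" for x
  proof -
    have lx: "?l x > 0" by (rule conformal_factor_pos[OF x])
    have "M * h x = w \<bullet> x - d * (1 + x \<bullet> x) / 2"
      using M by (simp add: plane_height_def e_def a_def field_simps)
    also have "\<dots> = w \<bullet> x - d * (1 - 1 / ?l x)"
      unfolding norm_via_conformal[OF x] by (simp add: field_simps)
    finally have Mh: "M * h x = w \<bullet> x - d * (1 - 1 / ?l x)" .
    have "?l x * (1 - 1 / ?l x) = ?l x - 1" using lx by (simp add: right_diff_distrib)
    moreover have "?l x * M * h x = ?l x * (w \<bullet> x) - d * (?l x * (1 - 1 / ?l x))"
      using arg_cong[OF Mh, of "\<lambda>z. ?l x * z"] by (simp only: right_diff_distrib mult.assoc mult.left_commute)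
    ultimately have "?l x * M * h x = ?l x * (w \<bullet> x) - d * (?l x - 1)" by simp
    also have "\<dots> = cosh_dist x q - cosh_dist x b"
      unfolding cosh_dist_lorentz[OF x q] cosh_dist_lorentz[OF x b] w_def d_def
      by (simp add: inner_diff inner_commute algebra_simps)
    finally show ?thesis .
  qed
  have Nb: "M *\<^sub>R N b = ?l q *\<^sub>R (b - q)"
  proof -
    have "M *\<^sub>R e = w" "M * a = d" using M by (simp_all add: e_def a_def)
    moreover have "M *\<^sub>R N b = M *\<^sub>R e - (M * a) *\<^sub>R b"
      by (simp add: plane_normal_def scaleR_diff_right)
    ultimately show ?thesis by (simp add: w_def d_def scaleR_diff_right scaleR_diff_left)
  qed
  have hb: "?l b * M * h b = ?l b * ?l q * ((b - q) \<bullet> (b - q)) / 2"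
    using height[OF b] by (simp add: cosh_dist_conformal[of b q] power2_norm_eq_inner)
  have bq: "(b - q) \<bullet> (b - q) > 0" using ne by simp
  have hb': "M * h b = ?l q * ((b - q) \<bullet> (b - q)) / 2" using hb lb by simp
  have "M * h b > 0" unfolding hb' using bq lq by (simp add: mult_pos_pos del: inner_gt_zero_iff)
  then have "h b > 0" using M zero_less_mult_pos by blast
  have "N b = (1 / M) *\<^sub>R (M *\<^sub>R N b)" using M by simp
  then have Nb': "N b = (?l q / M) *\<^sub>R (b - q)" unfolding Nb by simp
  have "2 * h b / (N b \<bullet> N b) = M / ?l q"
  proof -
    have "N b \<bullet> N b = (?l q / M)\<^sup>2 * ((b - q) \<bullet> (b - q))" unfolding Nb' by (simp add: power2_eq_square)
    moreover have "h b = ?l q * ((b - q) \<bullet> (b - q)) / (2 * M)" using hb' M by (simp add: field_simps)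
    moreover have "2 * (l * z / (2 * m)) / ((l / m)\<^sup>2 * z) = m / l" if "l > 0" "m > 0" "z > 0" for l m z :: real
      using that by (simp add: field_simps power2_eq_square)
    ultimately show ?thesis using lq M bq by simp
  qed
  then have "\<sigma> b = b - (M / ?l q) *\<^sub>R (?l q / M) *\<^sub>R (b - q)" by (simp add: reflection_def Nb')
  then have "\<sigma> b = q" using M lq by simp
  moreover have "h x < 0" if "x \<in> hyp_space" "cosh_dist x q < cosh_dist x b" for x
  proof -
    have "?l x * M * h x < 0" using height[OF that(1)] that(2) by simp
    moreover have "?l x * M > 0" using conformal_factor_pos[OF that(1)] M by simp
    ultimately show ?thesis using mult_less_0_iff[of "?l x * M" "h x"] by linarith
  qed
  ultimately show ?thesis using that \<open>h b > 0\<close> hyp_reflection_axioms by blast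
qed

lemma mass_reflection:
  fixes e x :: "real ^ 'n"
  assumes "hyp_reflection e a" "x \<in> hyp_space"
  shows "mass (reflection e a x) = mass x"
proof -
  interpret hyp_reflection e a by fact
  let ?k = "avg_kernel DIM(real ^ 'n) 1"
  have "mass (\<sigma> x) = (LINT y|hyp_vol. ?k (cosh_dist (\<sigma> x) y))" by (simp add: mass_def average_def)
  also have "\<dots> = (LINT y|hyp_vol. ?k (cosh_dist x (\<sigma> y)))"
    by (rule Bochner_Integration.integral_cong) (use cosh_dist_refl_right[OF assms(2)] in auto)
  also have "\<dots> = (LINT y|hyp_vol. ?k (cosh_dist x y))"
    using integral_reflection[OF assms(1), of "\<lambda>y. ?k (cosh_dist x y)"]
      average_integrable[OF assms(2) continuous_on_const, of 1 1 "DIM(real ^ 'n)"] by simp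
  finally show ?thesis by (simp add: mass_def average_def)
qed

text \<open>Any two points are exchanged by a reflection.\<close>

lemma mass_const:
  fixes x y :: "real ^ 'n"
  assumes "x \<in> hyp_space" "y \<in> hyp_space"
  shows "mass x = mass y"
proof (cases "x = y")
  case False
  from bisector[OF assms False] obtain e a where "hyp_reflection e a" "reflection e a y = x" by metis
  then show ?thesis using mass_reflection[of e a y] assms by simp
qed simp

section \<open>The domain is a superlevel set\<close>

text \<open>Boundedness is expressed by a ball about \<open>p0\<close> in terms of \<open>cosh_dist\<close>; \<open>x0\<close> is the base point of
  the condition at infinity.\<close>

locale overdetermined =
  fixes \<Omega> :: "(real ^ 'n) set" and u :: "real ^ 'n \<Rightarrow> real" and c :: real and x0 p0 :: "real ^ 'n" and T :: real
  assumes open_\<Omega>: "open \<Omega>" and ne_\<Omega>: "\<Omega> \<noteq> {}" and sub_\<Omega>: "\<Omega> \<subseteq> hyp_space"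
    and p0: "p0 \<in> hyp_space" and bounded_\<Omega>: "\<And>y. y \<in> \<Omega> \<Longrightarrow> cosh_dist p0 y \<le> T"
    and x0: "x0 \<in> hyp_space" and c_pos: "c > 0"
    and C1_u: "Ck_on 1 hyp_space u"
    and poisson: "weak_hyp_poisson u (indicator \<Omega>)"
    and frontier_u: "\<And>x. x \<in> frontier \<Omega> \<Longrightarrow> u x = 0"
    and limit_u: "(u \<longlongrightarrow> - c) (inf (filtercomap (\<lambda>x. hyp_dist x x0) at_top) (principal hyp_space))"
begin

lemma average_card: "average \<epsilon> f x = (LINT y|hyp_vol. f y * avg_kernel CARD('n) \<epsilon> (cosh_dist x y))"
  for x :: "real ^ 'n"
  by (simp add: average_def)

definition K0 :: "(real ^ 'n) set" where "K0 = {y \<in> hyp_space. cosh_dist p0 y \<le> T}"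

lemma K0: "compact K0" "K0 \<subseteq> hyp_space" "\<Omega> \<subseteq> K0"
  using compact_cosh_ball[OF p0] sub_\<Omega> bounded_\<Omega> by (auto simp: K0_def)

lemma closure_\<Omega>: "closure \<Omega> \<subseteq> K0" "compact (closure \<Omega>)"
proof -
  show 1: "closure \<Omega> \<subseteq> K0" using K0 by (intro closure_minimal compact_imp_closed)
  then show "compact (closure \<Omega>)" using K0(1) compact_imp_bounded bounded_subset
    by (metis closed_closure compact_eq_bounded_closed)
qed

lemma u_continuous: "continuous_on hyp_space u"
  by (rule Ck_on_imp_continuous_on[OF hyp_space_open C1_u])

lemma u_continuous_closure: "continuous_on (closure \<Omega>) u"
  by (rule continuous_on_subset[OF u_continuous]) (use closure_\<Omega> K0 in blast)

lemma \<Omega>_sets: "\<Omega> \<in> sets hyp_vol"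
  using open_\<Omega> sub_\<Omega> by (simp add: sets_hyp_vol_iff)

lemma integrable_on_part:
  fixes g :: "real ^ 'n \<Rightarrow> real"
  assumes "B \<in> sets hyp_vol" "B \<subseteq> K0" "continuous_on hyp_space g"
  shows "integrable hyp_vol (\<lambda>y. indicator B y * g y)"
proof -
  have "bounded (g ` K0)"
    by (intro compact_imp_bounded compact_continuous_image K0 continuous_on_subset[OF assms(3)])
  then obtain C where "\<And>y. y \<in> K0 \<Longrightarrow> \<bar>g y\<bar> \<le> C" unfolding bounded_iff by auto
  then show ?thesis
    by (intro hyp_integrable_compact_support[OF _ K0(1,2), of _ "max C 0"])
       (use assms continuous_imp_measurable_hyp_vol[OF assms(3)] in
         \<open>auto simp: indicator_def le_max_iff_disj intro!: borel_measurable_times borel_measurable_indicator\<close>)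
qed

lemma green_continuous:
  "x \<in> hyp_space \<Longrightarrow> 0 < \<epsilon> \<Longrightarrow> \<epsilon> \<le> R \<Longrightarrow> continuous_on hyp_space (\<lambda>y. green CARD('n) \<epsilon> R (cosh_dist x y))"
  by (intro continuous_on_radial continuous_on_green)

lemma average_identity:
  assumes "x \<in> hyp_space" "0 < \<epsilon>" "\<epsilon> \<le> R"
  shows "average \<epsilon> u x - average R u x = (LINT y|hyp_vol. indicator \<Omega> y * green CARD('n) \<epsilon> R (cosh_dist x y))"
  using average_poisson[OF assms(1) C1_u poisson assms(2,3)] by simp

lemma average_minus_const:
  assumes x: "x \<in> hyp_space" and R: "R > 0"
  shows "(LINT y|hyp_vol. (u y - m) * avg_kernel CARD('n) R (cosh_dist x y)) = average R u x - m * mass x"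
    and "integrable hyp_vol (\<lambda>y. (u y - m) * avg_kernel CARD('n) R (cosh_dist x y))"
proof -
  have "integrable hyp_vol (\<lambda>y. u y * avg_kernel CARD('n) R (cosh_dist x y))"
    "integrable hyp_vol (\<lambda>y. m * avg_kernel CARD('n) R (cosh_dist x y))"
    by (intro average_integrable x R u_continuous continuous_on_const)+
  then show "(LINT y|hyp_vol. (u y - m) * avg_kernel CARD('n) R (cosh_dist x y)) = average R u x - m * mass x"
    using average_1[OF x R] by (simp add: left_diff_distrib average_card)
  show "integrable hyp_vol (\<lambda>y. (u y - m) * avg_kernel CARD('n) R (cosh_dist x y))"
    by (intro average_integrable x R continuous_on_diff u_continuous continuous_on_const)
qed

lemma ex_cosh_ball_in_open:
  assumes "open U" "x \<in> U" "x \<in> hyp_space"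
  obtains R where "R > 0" "\<And>y. y \<in> hyp_space \<Longrightarrow> cosh_dist x y \<le> 1 + 2 * R \<Longrightarrow> y \<in> U"
proof -
  obtain d where d: "d > 0" "ball x d \<subseteq> U" using assms(1,2) by (auto simp: open_contains_ball)
  define R where "R = (d / 2)\<^sup>2"
  have R: "R > 0" using d by (simp add: R_def)
  have "y \<in> U" if "y \<in> hyp_space" "cosh_dist x y \<le> 1 + 2 * R" for y
  proof -
    have "(norm (x - y))\<^sup>2 \<le> (d / 2)\<^sup>2"
      using norm_diff_le_cosh_dist[OF assms(3) that R] by (simp add: R_def)
    then have "norm (x - y) \<le> d / 2" using d(1) by (metis less_eq_real_def half_gt_zero power2_le_imp_le)
    then show ?thesis using d by (auto simp: dist_norm)
  qed
  then show ?thesis using that R by blast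
qed

text \<open>Inside the domain a mean over a small sphere lies below the value at the centre, so \<open>u\<close> has
  no interior minimum.\<close>

lemma no_interior_min:
  assumes x: "x \<in> \<Omega>" and min: "\<And>y. y \<in> \<Omega> \<Longrightarrow> u x \<le> u y"
  shows False
proof -
  have xh: "x \<in> hyp_space" using x sub_\<Omega> by auto
  obtain R where R: "R > 0" "\<And>y. y \<in> hyp_space \<Longrightarrow> cosh_dist x y \<le> 1 + 2 * R \<Longrightarrow> y \<in> \<Omega>"
    using ex_cosh_ball_in_open[OF open_\<Omega> x xh] by blast
  \<comment> \<open>With this choice the truncated Green function strictly decreases between \<open>1 + R / 2\<close> and
    \<open>1 + R\<close>, so it is positive on the ball \<open>?A\<close> below.\<close>
  define \<epsilon> where "\<epsilon> = R / 4"
  have e: "0 < \<epsilon>" "\<epsilon> \<le> R" using R by (auto simp: \<epsilon>_def)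
  define I where "I = (LINT y|hyp_vol. indicator \<Omega> y * green CARD('n) \<epsilon> R (cosh_dist x y))"
  have "I > 0"
  proof -
    let ?A = "{y \<in> hyp_space. cosh_dist x y < 1 + R / 2}"
    have "open ?A"
      using continuous_open_preimage[OF continuous_on_cosh_dist[OF xh] hyp_space_open, of "{..<1 + R / 2}"]
      by (simp add: vimage_def Int_def)
    moreover have "x \<in> ?A" using xh R by simp
    then have "?A \<noteq> {}" by blast
    ultimately have A: "emeasure hyp_vol ?A > 0" "?A \<in> sets hyp_vol"
      by (auto simp: sets_hyp_vol_iff intro!: emeasure_hyp_vol_open_pos simp del: Collect_empty_eq)
    have "green CARD('n) \<epsilon> R t > 0" if "t < 1 + R / 2" for t
    proof -
      have "green CARD('n) \<epsilon> R (1 + R) - green CARD('n) \<epsilon> R (1 + R / 2) \<le> - (green_density CARD('n) (1 + R) * ((1 + R) - (1 + R / 2)))"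
        by (rule green_increment_le) (use R in \<open>auto simp: \<epsilon>_def\<close>)
      moreover have "green_density CARD('n) (1 + R) * ((1 + R) - (1 + R / 2)) > 0"
        using R by (intro mult_pos_pos green_density_pos) auto
      moreover have "green CARD('n) \<epsilon> R (1 + R / 2) \<le> green CARD('n) \<epsilon> R t" using that e by (intro green_antimono) auto
      ultimately show ?thesis using green_nonneg[OF e, of "CARD('n)" "1 + R"] by linarith
    qed
    moreover have "?A \<subseteq> \<Omega>" using R by auto
    ultimately show ?thesis unfolding I_def
      using green_nonneg[OF e]
      by (intro hyp_integral_pos[OF _ _ A(2,1)] integrable_on_part \<Omega>_sets K0 green_continuous xh e) auto
  qed
  have avg: "average R u x \<ge> u x * mass x"
  proof -
    have "0 \<le> (LINT y|hyp_vol. (u y - u x) * avg_kernel CARD('n) R (cosh_dist x y))"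
    proof (rule Bochner_Integration.integral_nonneg)
      fix y :: "real ^ 'n" assume "y \<in> space hyp_vol"
      then have y: "y \<in> hyp_space" by simp
      show "0 \<le> (u y - u x) * avg_kernel CARD('n) R (cosh_dist x y)"
      proof (cases "cosh_dist x y \<le> 1 + 2 * R")
        case True
        then show ?thesis using min[OF R(2)[OF y]] avg_kernel_nonneg[OF cosh_dist_ge_1[OF xh y] R(1)] by simp
      next
        case False
        then show ?thesis using avg_kernel_eq_0[OF R(1)] by simp
      qed
    qed
    also have "\<dots> = average R u x - u x * mass x" by (rule average_minus_const[OF xh R(1)])
    finally show ?thesis by simp
  qed
  have "average (1 / real (Suc k)) u x - average R u x \<ge> I" if k: "1 / real (Suc k) \<le> \<epsilon>" for k
  proof -
    let ?d = "1 / real (Suc k)"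
    have d: "0 < ?d" "?d \<le> R" using k e by auto
    have "I \<le> (LINT y|hyp_vol. indicator \<Omega> y * green CARD('n) ?d R (cosh_dist x y))"
      unfolding I_def
    proof (rule integral_mono)
      fix y
      let ?s = "cosh_dist x y"
      have "green CARD('n) \<epsilon> R ?s \<le> green CARD('n) ?d R ?s"
        using green_increment_antimono[of ?d \<epsilon> R R ?s "max ?s (1 + 2 * R)" "CARD('n)"] k e d
        by (simp add: green_eq_0)
      then show "indicator \<Omega> y * green CARD('n) \<epsilon> R ?s \<le> indicator \<Omega> y * green CARD('n) ?d R ?s"
        by (simp add: indicator_def)
    qed (intro integrable_on_part \<Omega>_sets K0 green_continuous xh e d)+
    then show ?thesis using average_identity[OF xh d] by simp
  qed
  moreover have "\<forall>\<^sub>F k in sequentially. 1 / real (Suc k) \<le> \<epsilon>"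
    using order_tendstoD(2)[OF LIMSEQ_inverse_real_of_nat e(1)]
    by eventually_elim (simp add: inverse_eq_divide)
  ultimately have "\<forall>\<^sub>F k in sequentially. I \<le> average (1 / real (Suc k)) u x - average R u x"
    by (auto elim: eventually_mono)
  moreover have "(\<lambda>k. average (1 / real (Suc k)) u x - average R u x) \<longlonglongrightarrow> u x * mass x - average R u x"
    by (intro tendsto_diff average_tendsto_small xh u_continuous tendsto_const)
  ultimately have "I \<le> u x * mass x - average R u x"
    using tendsto_lowerbound[OF _ _ sequentially_bot] by blast
  then show False using avg \<open>I > 0\<close> by linarith
qed

lemma u_pos: "x \<in> \<Omega> \<Longrightarrow> u x > 0"
proof -
  have "\<exists>m\<in>closure \<Omega>. \<forall>y\<in>closure \<Omega>. u m \<le> u y"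
    by (rule continuous_attains_inf)
       (use closure_\<Omega>(2) ne_\<Omega> u_continuous_closure in auto)
  then obtain m where m: "m \<in> closure \<Omega>" "\<And>y. y \<in> closure \<Omega> \<Longrightarrow> u m \<le> u y" by blast
  have "m \<notin> \<Omega>" using no_interior_min[of m] m closure_subset by blast
  then have "m \<in> frontier \<Omega>" using m open_\<Omega> by (simp add: frontier_def interior_open)
  then have nonneg: "u y \<ge> 0" if "y \<in> \<Omega>" for y using m(2)[of y] frontier_u that closure_subset by force
  assume x: "x \<in> \<Omega>"
  show ?thesis
  proof (rule ccontr)
    assume "\<not> ?thesis"
    then have "u x = 0" using nonneg[OF x] by simp
    then show False using no_interior_min[OF x] nonneg by simp
  qed
qed

text \<open>Outside the domain \<open>u\<close> has the mean value property. At a positive maximum that lies as far as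
  possible in a fixed direction, a small sphere contains a point farther in this direction.\<close>

lemma u_nonpos:
  assumes x1: "x1 \<in> hyp_space" "x1 \<notin> \<Omega>"
  shows "u x1 \<le> 0"
proof (rule ccontr)
  assume "\<not> ?thesis"
  then have pos: "u x1 > 0" by simp
  obtain K where K: "compact K" "K \<subseteq> hyp_space" "\<And>y. y \<in> hyp_space - K \<Longrightarrow> \<bar>u y - - c\<bar> < c"
    using hyp_limit_compact[OF x0 limit_u c_pos] by blast
  have outside: "u y < 0" if "y \<in> hyp_space - K" for y using K(3)[OF that] by linarith
  define L where "L = K - \<Omega>"
  have L: "compact L" "L \<subseteq> hyp_space" "x1 \<in> L"
    using K open_\<Omega> x1 pos outside[of x1] by (auto simp: L_def compact_diff)
  have uL: "continuous_on L u" using u_continuous L(2) continuous_on_subset by blast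
  obtain m where m: "m \<in> L" "\<And>y. y \<in> L \<Longrightarrow> u y \<le> u m"
    using continuous_attains_sup[OF L(1) _ uL] L(3) by blast
  define M where "M = u m"
  have M: "M > 0" using m(2)[OF L(3)] pos by (simp add: M_def)
  have maxM: "u y \<le> M" if "y \<in> hyp_space" "y \<notin> \<Omega>" for y
    using that outside[of y] m(2)[of y] M by (cases "y \<in> K") (auto simp: M_def L_def)
  define S where "S = {y \<in> L. u y = M}"
  have "closed S" unfolding S_def
    using continuous_closed_preimage_constant[OF uL compact_imp_closed[OF L(1)]] by simp
  then have S: "compact S" "m \<in> S"
  proof -
    have "L \<inter> S = S" by (auto simp: S_def)
    then show "compact S" using compact_Int_closed[OF L(1) \<open>closed S\<close>] by simp
    show "m \<in> S" using m(1) by (simp add: S_def M_def)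
  qed
  obtain b :: "real ^ 'n" where b: "b \<in> Basis" using nonempty_Basis by blast
  have "\<exists>x\<in>S. \<forall>y\<in>S. y \<bullet> b \<le> x \<bullet> b"
    by (rule continuous_attains_sup) (use S in \<open>auto intro!: continuous_intros\<close>)
  then obtain x where x: "x \<in> S" "\<And>y. y \<in> S \<Longrightarrow> y \<bullet> b \<le> x \<bullet> b" by blast
  have xh: "x \<in> hyp_space" and x\<Omega>: "x \<notin> \<Omega>" and ux: "u x = M" using x L by (auto simp: S_def L_def)
  have xcl: "x \<notin> closure \<Omega>"
  proof
    assume "x \<in> closure \<Omega>"
    then have "x \<in> frontier \<Omega>" using x\<Omega> open_\<Omega> by (simp add: frontier_def interior_open)
    then show False using frontier_u ux M by simp
  qed
  obtain R where R: "R > 0" "\<And>y. y \<in> hyp_space \<Longrightarrow> cosh_dist x y \<le> 1 + 2 * R \<Longrightarrow> y \<in> - closure \<Omega>"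
    using ex_cosh_ball_in_open[of "- closure \<Omega>" x] xcl xh by auto
  have out: "y \<notin> \<Omega>" if "y \<in> hyp_space" "cosh_dist x y \<le> 1 + 2 * R" for y
    using R(2)[OF that] closure_subset by auto
  have "average (1 / real (Suc k)) u x = average R u x" if k: "1 / real (Suc k) \<le> R" for k
  proof -
    have "(LINT y|hyp_vol. indicator \<Omega> y * green CARD('n) (1 / real (Suc k)) R (cosh_dist x y)) =
        (LINT y|(hyp_vol :: (real ^ 'n) measure). (0::real))"
    proof (rule Bochner_Integration.integral_cong[OF refl])
      fix y :: "real ^ 'n" assume "y \<in> space hyp_vol"
      then show "indicator \<Omega> y * green CARD('n) (1 / real (Suc k)) R (cosh_dist x y) = 0"
        using out[of y] k by (cases "cosh_dist x y \<le> 1 + 2 * R") (auto simp: green_eq_0)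
    qed
    then show ?thesis using average_identity[OF xh _ k] by simp
  qed
  moreover have "\<forall>\<^sub>F k in sequentially. 1 / real (Suc k) \<le> R"
    using order_tendstoD(2)[OF LIMSEQ_inverse_real_of_nat R(1)]
    by eventually_elim (simp add: inverse_eq_divide)
  ultimately have "\<forall>\<^sub>F k in sequentially. average (1 / real (Suc k)) u x = average R u x"
    by (auto elim: eventually_mono)
  then have "(\<lambda>k. average (1 / real (Suc k)) u x) \<longlonglongrightarrow> average R u x"
    by (rule tendsto_eventually)
  then have mv: "average R u x = M * mass x"
    using average_tendsto_small[OF xh u_continuous] LIMSEQ_unique ux by blast
  let ?k = "\<lambda>y. avg_kernel CARD('n) R (cosh_dist x y)"
  obtain t where t: "1 + R < t" "t < 1 + 2 * R" "avg_kernel CARD('n) R t > 0"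
    using avg_kernel_pos_ex[OF R(1)] by blast
  obtain y where y: "y \<in> hyp_space" "cosh_dist x y = t" "x \<bullet> b < y \<bullet> b"
    using ex_cosh_dist_eq[OF xh _ b, of t] t R by auto
  have y\<Omega>: "y \<notin> \<Omega>" using out[OF y(1)] y t by simp
  have "u y \<noteq> M"
  proof
    assume "u y = M"
    then have "y \<in> K" using outside[of y] y M by force
    then have "y \<in> S" using \<open>u y = M\<close> y\<Omega> by (simp add: S_def L_def)
    then show False using x(2)[of y] y(3) by simp
  qed
  then have uy: "u y < M" using maxM[OF y(1) y\<Omega>] by simp
  let ?A = "{z \<in> hyp_space. ?k z > 0} \<inter> {z \<in> hyp_space. u z < M}"
  have "open ?A"
  proof (rule open_Int)
    show "open {z \<in> hyp_space. ?k z > 0}" by (rule avg_kernel_pos_open[OF xh R(1)])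
    show "open {z \<in> hyp_space. u z < M}"
      using continuous_open_preimage[OF u_continuous hyp_space_open, of "{..<M}"] by (simp add: vimage_def Int_def)
  qed
  moreover have "y \<in> ?A" using y uy t by simp
  then have "?A \<noteq> {}" by blast
  ultimately have A: "emeasure hyp_vol ?A > 0" "?A \<in> sets hyp_vol"
    using emeasure_hyp_vol_open_pos[of ?A] by (blast, simp add: sets_hyp_vol_iff borel_open) blast
  have neg: "(M - u z) * ?k z = - ((u z - M) * ?k z)" for z by (simp add: algebra_simps)
  have int: "integrable hyp_vol (\<lambda>z. (M - u z) * ?k z)"
    unfolding neg by (intro Bochner_Integration.integrable_minus average_minus_const(2)[OF xh R(1)])
  have "(LINT z|hyp_vol. (M - u z) * ?k z) > 0"
  proof (rule hyp_integral_pos[OF int _ A(2,1)])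
    fix z :: "real ^ 'n" assume z: "z \<in> hyp_space"
    show "0 \<le> (M - u z) * ?k z"
    proof (cases "cosh_dist x z \<le> 1 + 2 * R")
      case True
      then show ?thesis using maxM[OF z out[OF z]] avg_kernel_nonneg[OF cosh_dist_ge_1[OF xh z] R(1)] by simp
    next
      case False
      then show ?thesis using avg_kernel_eq_0[OF R(1)] by simp
    qed
  qed auto
  moreover have "(LINT z|hyp_vol. (M - u z) * ?k z) = - (average R u x - M * mass x)"
    unfolding neg by (simp only: Bochner_Integration.integral_minus average_minus_const(1)[OF xh R(1)])
  ultimately show False using mv by simp
qed

text \<open>This identity is what lets inequalities between values of \<open>u\<close> control the domain, and it makes
  the moving plane argument close.\<close>

lemma \<Omega>_eq: "x \<in> hyp_space \<Longrightarrow> x \<in> \<Omega> \<longleftrightarrow> u x > 0"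
  using u_pos u_nonpos[of x] by (metis not_less)

lemma ex_maximum: "\<exists>p\<in>\<Omega>. \<forall>y\<in>hyp_space. u y \<le> u p"
proof -
  have "\<exists>p\<in>closure \<Omega>. \<forall>y\<in>closure \<Omega>. u y \<le> u p"
    by (rule continuous_attains_sup)
       (use closure_\<Omega>(2) ne_\<Omega> u_continuous_closure in auto)
  then obtain p where p: "p \<in> closure \<Omega>" "\<And>y. y \<in> closure \<Omega> \<Longrightarrow> u y \<le> u p" by blast
  have ph: "p \<in> hyp_space" using p closure_\<Omega> K0 by auto
  obtain z where z: "z \<in> \<Omega>" using ne_\<Omega> by auto
  then have "u p > 0" using p(2)[of z] u_pos[OF z] closure_subset by fastforce
  then have "p \<in> \<Omega>" using \<Omega>_eq[OF ph] by simp
  moreover have "u y \<le> u p" if "y \<in> hyp_space" for y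
    using p(2)[of y] u_nonpos[OF that] \<open>u p > 0\<close> closure_subset by (cases "y \<in> \<Omega>") auto
  ultimately show ?thesis by blast
qed

end

section \<open>Comparison with the reflected solution\<close>

lemma continuous_on_cosh_dist_pair:
  "continuous_on (hyp_space \<times> hyp_space) (\<lambda>(x, y). cosh_dist x y)"
proof -
  have "(1 - (norm x)\<^sup>2) * (1 - (norm y)\<^sup>2) \<noteq> 0" if "x \<in> hyp_space" "y \<in> hyp_space" for x y :: 'a
    using hyp_spaceD[OF that(1)] hyp_spaceD[OF that(2)] by simp
  then show ?thesis
    unfolding cosh_dist_def split_def by (intro continuous_intros) auto
qed

abbreviation green_seq :: "nat \<Rightarrow> nat \<Rightarrow> real \<Rightarrow> real" where
  "green_seq n k \<equiv> green n (1 / real (Suc k)) (real (Suc k))"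

context overdetermined
begin

text \<open>These points alone contribute to the difference of the potentials at a point and at its mirror
  image: the contributions of the cap and of the reflected cap cancel.\<close>

definition uncovered :: "real ^ 'n \<Rightarrow> real \<Rightarrow> (real ^ 'n) set" where
  "uncovered e a = {y \<in> \<Omega>. plane_height e a y < 0 \<and> reflection e a y \<notin> \<Omega>}"

definition cap_reflects :: "real ^ 'n \<Rightarrow> real \<Rightarrow> bool" where
  "cap_reflects e a \<longleftrightarrow> (\<forall>x\<in>\<Omega>. plane_height e a x > 0 \<longrightarrow> reflection e a x \<in> \<Omega>)"

lemma eps_le: "0 < 1 / real (Suc k)" "1 / real (Suc k) \<le> real (Suc k)"
proof -
  have "1 / real (Suc k) \<le> 1" by simp
  also have "1 \<le> real (Suc k)" by simp
  finally show "1 / real (Suc k) \<le> real (Suc k)" .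
qed simp

text \<open>Up to the constant \<open>mass x\<close>, \<open>u + c\<close> is the Green potential of the domain: the average
  concentrates at \<open>x\<close> as \<open>\<epsilon>\<close> tends to 0 and escapes to infinity as \<open>R\<close> grows.\<close>

lemma green_representation:
  assumes x: "x \<in> hyp_space"
  shows "(\<lambda>k. LINT y|hyp_vol. indicator \<Omega> y * green_seq CARD('n) k (cosh_dist x y)) \<longlonglongrightarrow> (u x + c) * mass x"
proof -
  have "(\<lambda>k. average (1 / real (Suc k)) u x - average (real (Suc k)) u x) \<longlonglongrightarrow> u x * mass x - - c * mass x"
    by (intro tendsto_diff average_tendsto_small average_tendsto_infinity[OF x x0] x u_continuous limit_u)
  then show ?thesis
    unfolding average_identity[OF x eps_le] by (simp add: algebra_simps)
qed

end

text \<open>One position of the moving plane, at which the cap on the side of positive height reflects into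
  the domain.\<close>

locale overdetermined_reflection = overdetermined \<Omega> u c x0 p0 T + hyp_reflection e a
  for \<Omega> :: "(real ^ 'n) set" and u c x0 p0 T and e :: "real ^ 'n" and a +
  assumes cap: "cap_reflects e a"
begin

abbreviation "E \<equiv> uncovered e a"

definition D :: "nat \<Rightarrow> real ^ 'n \<Rightarrow> real ^ 'n \<Rightarrow> real" where
  "D k x y = green_seq CARD('n) k (cosh_dist x y) - green_seq CARD('n) k (cosh_dist (\<sigma> x) y)"

lemma h_continuous: "continuous_on S h"
  unfolding plane_height_def by (intro continuous_intros) simp

lemma D_continuous: "x \<in> hyp_space \<Longrightarrow> continuous_on hyp_space (D k x)"
  unfolding D_def by (intro continuous_on_diff green_continuous refl_in eps_le)

lemma half_sets:
  "{y \<in> \<Omega>. h y > 0} \<in> sets hyp_vol" "{y \<in> \<Omega>. h y < 0} \<in> sets hyp_vol"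
  "{y \<in> hyp_space. \<sigma> y \<in> \<Omega> \<and> h y < 0} \<in> sets hyp_vol" "E \<in> sets hyp_vol"
proof -
  have o: "open {y. h y > 0}" "open {y. h y < 0}"
    using h_continuous by (auto intro!: open_Collect_less continuous_on_const)
  have 1: "{y \<in> hyp_space. \<sigma> y \<in> \<Omega>} \<in> sets hyp_vol"
    using measurable_sets[OF measurable_refl \<Omega>_sets] by (simp add: vimage_def Int_def conj_commute)
  show a: "{y \<in> \<Omega>. h y > 0} \<in> sets hyp_vol" "{y \<in> \<Omega>. h y < 0} \<in> sets hyp_vol"
    using open_Int[OF open_\<Omega> o(1)] open_Int[OF open_\<Omega> o(2)] sub_\<Omega>
    by (auto simp: sets_hyp_vol_iff Int_def)
  have "{y \<in> hyp_space. \<sigma> y \<in> \<Omega> \<and> h y < 0} = {y \<in> hyp_space. \<sigma> y \<in> \<Omega>} \<inter> (hyp_space \<inter> {y. h y < 0})"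
    by auto
  moreover have "hyp_space \<inter> {y. h y < 0} \<in> sets hyp_vol"
    using open_Int[OF hyp_space_open o(2)] by (simp add: sets_hyp_vol_iff)
  ultimately show "{y \<in> hyp_space. \<sigma> y \<in> \<Omega> \<and> h y < 0} \<in> sets hyp_vol" using 1 by auto
  have "E = {y \<in> \<Omega>. h y < 0} - {y \<in> hyp_space. \<sigma> y \<in> \<Omega>}"
    using sub_\<Omega> by (auto simp: uncovered_def)
  then show "E \<in> sets hyp_vol" using a(2) 1 by auto
qed

lemma E_sub: "E \<subseteq> \<Omega>" by (auto simp: uncovered_def)

text \<open>The reflection maps the part of the integral over the cap to minus an integral over the
  reflected cap; what remains is the uncovered part.\<close>

lemma integral_D:
  assumes x: "x \<in> hyp_space"
  shows "(LINT y|hyp_vol. indicator \<Omega> y * D k x y) = (LINT y|hyp_vol. indicator E y * D k x y)"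
proof -
  let ?P = "{y \<in> \<Omega>. h y > 0}" and ?N = "{y \<in> \<Omega>. h y < 0}" and ?R = "{y \<in> hyp_space. \<sigma> y \<in> \<Omega> \<and> h y < 0}"
  have h_ref: "h (\<sigma> y) > 0 \<longleftrightarrow> h y < 0" if "y \<in> hyp_space" for y
    using h_refl[OF that] \<mu>_pos[OF that] by (simp add: zero_less_mult_iff mult_less_0_iff)
  have D_ref: "D k x (\<sigma> y) = - D k x y" if "y \<in> hyp_space" for y
    by (simp add: D_def cosh_dist_refl_right[OF x that] cosh_dist_refl[OF x that])
  have R_sub: "?R \<subseteq> \<Omega>"
  proof
    fix y assume y: "y \<in> ?R"
    then have "\<sigma> (\<sigma> y) \<in> \<Omega>" using cap h_ref[of y] by (simp add: cap_reflects_def)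
    then show "y \<in> \<Omega>" using refl_refl y by simp
  qed
  have D0: "D k x y = 0" if "h y = 0" "y \<in> hyp_space" for y
    using cosh_dist_refl_left[OF x that(2)] that by (simp add: D_def)
  have int: "integrable hyp_vol (\<lambda>y. indicator B y * D k x y)" if "B \<in> sets hyp_vol" "B \<subseteq> \<Omega>" for B
    by (rule integrable_on_part) (use that K0 D_continuous[OF x] in auto)
  have iP: "integrable hyp_vol (\<lambda>y. indicator ?P y * D k x y)"
    and iN: "integrable hyp_vol (\<lambda>y. indicator ?N y * D k x y)"
    and iR: "integrable hyp_vol (\<lambda>y. indicator ?R y * D k x y)"
    by (intro int half_sets R_sub; auto)+
  have "(LINT y|hyp_vol. indicator ?P y * D k x y) = (LINT y|hyp_vol. indicator ?P (\<sigma> y) * D k x (\<sigma> y))"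
    by (rule integral_reflection[OF hyp_reflection_axioms iP, symmetric])
  also have "\<dots> = (LINT y|hyp_vol. - (indicator ?R y * D k x y))"
    by (rule Bochner_Integration.integral_cong) (auto simp: D_ref h_ref indicator_def)
  finally have P: "(LINT y|hyp_vol. indicator ?P y * D k x y) = - (LINT y|hyp_vol. indicator ?R y * D k x y)"
    by simp
  have "(LINT y|hyp_vol. indicator \<Omega> y * D k x y) =
      (LINT y|hyp_vol. indicator ?P y * D k x y + indicator ?N y * D k x y)"
  proof (rule Bochner_Integration.integral_cong[OF refl])
    fix y :: "real ^ 'n" assume "y \<in> space hyp_vol"
    then show "indicator \<Omega> y * D k x y = indicator ?P y * D k x y + indicator ?N y * D k x y"
      using D0[of y] by (cases "h y" "0::real" rule: linorder_cases) (auto simp: indicator_def)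
  qed
  also have "\<dots> = (LINT y|hyp_vol. indicator ?N y * D k x y) - (LINT y|hyp_vol. indicator ?R y * D k x y)"
    by (simp add: Bochner_Integration.integral_add[OF iP iN] P)
  also have "\<dots> = (LINT y|hyp_vol. indicator ?N y * D k x y - indicator ?R y * D k x y)"
    by (rule Bochner_Integration.integral_diff[OF iN iR, symmetric])
  also have "\<dots> = (LINT y|hyp_vol. indicator E y * D k x y)"
  proof (rule Bochner_Integration.integral_cong[OF refl])
    fix y :: "real ^ 'n" assume "y \<in> space hyp_vol"
    then show "indicator ?N y * D k x y - indicator ?R y * D k x y = indicator E y * D k x y"
      using R_sub by (auto simp: indicator_def uncovered_def)
  qed
  finally show ?thesis .
qed

lemma difference_limit:
  assumes x: "x \<in> hyp_space"
  shows "(\<lambda>k. LINT y|hyp_vol. indicator E y * D k x y) \<longlonglongrightarrow> (u x - u (\<sigma> x)) * mass x"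
proof -
  have int: "integrable hyp_vol (\<lambda>y. indicator \<Omega> y * green_seq CARD('n) k (cosh_dist z y))" if "z \<in> hyp_space" for k z
    by (intro integrable_on_part \<Omega>_sets K0 green_continuous that eps_le)
  have "(\<lambda>k. (LINT y|hyp_vol. indicator \<Omega> y * green_seq CARD('n) k (cosh_dist x y)) -
      (LINT y|hyp_vol. indicator \<Omega> y * green_seq CARD('n) k (cosh_dist (\<sigma> x) y)))
      \<longlonglongrightarrow> (u x + c) * mass x - (u (\<sigma> x) + c) * mass (\<sigma> x)"
    by (intro tendsto_diff green_representation x refl_in)
  moreover have "(LINT y|hyp_vol. indicator \<Omega> y * green_seq CARD('n) k (cosh_dist x y)) -
      (LINT y|hyp_vol. indicator \<Omega> y * green_seq CARD('n) k (cosh_dist (\<sigma> x) y)) = (LINT y|hyp_vol. indicator \<Omega> y * D k x y)" for k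
    unfolding D_def right_diff_distrib
    by (rule Bochner_Integration.integral_diff[symmetric]) (intro int x refl_in)+
  moreover have "mass (\<sigma> x) = mass x" using mass_const refl_in x by blast
  ultimately show ?thesis by (simp add: integral_D[OF x] algebra_simps)
qed

text \<open>If the reflected cap exhausts the far part up to a null set, the potentials at \<open>x\<close> and at its
  mirror image agree.\<close>

lemma symmetric_if_covered:
  assumes null: "emeasure hyp_vol E = 0" and x: "x \<in> hyp_space"
  shows "u (\<sigma> x) = u x"
proof -
  have ae: "AE y in hyp_vol. y \<notin> E"
    using null half_sets(4) by (simp add: AE_iff_null_sets[symmetric] null_setsI)
  have "(LINT y|hyp_vol. indicator E y * D k x y) = 0" for k
  proof -
    have "AE y in hyp_vol. indicator E y * D k x y = 0" using ae by eventually_elim simp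
    then show ?thesis by (rule integral_eq_zero_AE)
  qed
  then have "(u x - u (\<sigma> x)) * mass x = 0"
    using LIMSEQ_unique[OF difference_limit[OF x], of 0] by simp
  then show ?thesis using mass_pos[OF x] by simp
qed

lemma D_antimono:
  assumes x: "x \<in> hyp_space" "h x > 0" and y: "y \<in> E" and kj: "j \<le> k"
  shows "D k x y \<le> D j x y" "D k x y \<le> 0" "cosh_dist (\<sigma> x) y \<le> cosh_dist x y"
proof -
  have yh: "y \<in> hyp_space" "h y < 0" using y sub_\<Omega> by (auto simp: uncovered_def)
  have "(conformal_factor x * h x) * (conformal_factor y * h y) \<le> 0"
    using x(2) yh(2) conformal_factor_pos[OF x(1)] conformal_factor_pos[OF yh(1)]
    by (intro mult_nonneg_nonpos mult_nonneg_nonneg) linarith+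
  then have "2 * ((conformal_factor x * h x) * (conformal_factor y * h y)) / (1 - a\<^sup>2) \<le> 0"
    using q_pos by (intro divide_nonpos_pos) linarith+
  then have "2 * (conformal_factor x * h x) * (conformal_factor y * h y) / (1 - a\<^sup>2) \<le> 0"
    by (simp only: mult.assoc)
  then show le: "cosh_dist (\<sigma> x) y \<le> cosh_dist x y" using cosh_dist_refl_left[OF x(1) yh(1)] by simp
  have "1 / real (Suc k) \<le> 1 / real (Suc j)" using kj by (intro divide_left_mono) auto
  then show "D k x y \<le> D j x y"
    unfolding D_def by (intro green_increment_antimono eps_le le) (use kj in auto)
  show "D k x y \<le> 0" unfolding D_def using green_antimono[OF eps_le le] by simp
qed

lemma difference_le:
  assumes x: "x \<in> hyp_space" "h x > 0"
  shows "(u x - u (\<sigma> x)) * mass x \<le> (LINT y|hyp_vol. indicator E y * D j x y)"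
proof (rule tendsto_upperbound[OF difference_limit[OF x(1)]])
  show "\<forall>\<^sub>F k in sequentially. (LINT y|hyp_vol. indicator E y * D k x y) \<le> (LINT y|hyp_vol. indicator E y * D j x y)"
    using eventually_ge_at_top[of j]
  proof eventually_elim
    case (elim k)
    have int: "integrable hyp_vol (\<lambda>y. indicator E y * D k x y)" for k
      by (rule integrable_on_part) (use half_sets E_sub K0 D_continuous[OF x(1)] in auto)
    show ?case
      by (rule integral_mono[OF int int]) (use D_antimono[OF x _ elim] in \<open>auto simp: indicator_def\<close>)
  qed
qed simp

lemma conformal_factor_ge_1: "y \<in> hyp_space \<Longrightarrow> conformal_factor y \<ge> 1"
  for y :: "real ^ 'n"
  using hyp_spaceD[of y] by (simp add: conformal_factor_def field_simps)

text \<open>Hopf lemma and strong maximum principle in one. The Green function decreases at least linearly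
  between the two values of \<open>cosh_dist\<close>, and their difference is a multiple of the height of \<open>x\<close>
  by \<open>cosh_dist_refl_left\<close>.\<close>

lemma hopf:
  assumes pos: "emeasure hyp_vol E > 0" and z: "z \<in> hyp_space"
  obtains \<kappa> \<rho> where "\<kappa> > 0" "\<rho> > 0"
    "\<And>x. x \<in> hyp_space \<Longrightarrow> dist x z < \<rho> \<Longrightarrow> h x > 0 \<Longrightarrow> u x - u (\<sigma> x) \<le> - (\<kappa> * h x)"
proof -
  let ?l = conformal_factor
  have Eh: "y \<in> hyp_space" "h y < 0" if "y \<in> E" for y using that sub_\<Omega> by (auto simp: uncovered_def)
  \<comment> \<open>Away from the plane and from the possible singularity at the mirror image of \<open>z\<close>, the integrand
    is comparable to the height of \<open>x\<close>. Countably many such pieces exhaust \<open>E\<close> up to one point, so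
    one of them has positive measure.\<close>
  define F where "F i = {y \<in> E. h y < - (1 / real (Suc i)) \<and> cosh_dist (\<sigma> z) y > 1 + 1 / real (Suc i)}" for i
  have \<sigma>z: "\<sigma> z \<in> hyp_space" by (rule refl_in[OF z])
  have F_sets: "F i \<in> sets hyp_vol" for i
  proof -
    have "open {y. h y < - (1 / real (Suc i))}"
      using h_continuous by (auto intro!: open_Collect_less continuous_on_const)
    then have 1: "hyp_space \<inter> {y. h y < - (1 / real (Suc i))} \<in> sets hyp_vol"
      using borel_open[OF open_Int[OF hyp_space_open]] by (simp add: sets_hyp_vol_iff)
    have "open {y \<in> hyp_space. cosh_dist (\<sigma> z) y > 1 + 1 / real (Suc i)}"
      using continuous_open_preimage[OF continuous_on_cosh_dist[OF \<sigma>z] hyp_space_open, of "{1 + 1 / real (Suc i)<..}"]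
      by (simp add: vimage_def Int_def)
    then have 2: "{y \<in> hyp_space. cosh_dist (\<sigma> z) y > 1 + 1 / real (Suc i)} \<in> sets hyp_vol"
      by (auto simp: sets_hyp_vol_iff)
    have "F i = E \<inter> (hyp_space \<inter> {y. h y < - (1 / real (Suc i))}) \<inter> {y \<in> hyp_space. cosh_dist (\<sigma> z) y > 1 + 1 / real (Suc i)}"
      using Eh by (auto simp: F_def)
    then show ?thesis using 1 2 half_sets(4) by auto
  qed
  have "\<exists>i. emeasure hyp_vol (F i) > 0"
  proof (rule ccontr)
    assume "\<not> ?thesis"
    then have "F i \<in> null_sets hyp_vol" for i using F_sets[of i] by (simp add: null_sets_def)
    then have 1: "(\<Union>i. F i) \<in> null_sets hyp_vol" by (rule null_sets_UN)
    have "{\<sigma> z} \<in> sets hyp_vol" using \<sigma>z by (simp add: sets_hyp_vol_iff)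
    moreover have "emeasure hyp_vol {\<sigma> z} = 0"
      using \<open>{\<sigma> z} \<in> sets hyp_vol\<close> by (simp add: emeasure_hyp_vol)
    ultimately have 2: "{\<sigma> z} \<in> null_sets hyp_vol" by (rule null_setsI[rotated])
    have "E \<subseteq> (\<Union>i. F i) \<union> {\<sigma> z}"
    proof
      fix y assume y: "y \<in> E"
      show "y \<in> (\<Union>i. F i) \<union> {\<sigma> z}"
      proof (cases "y = \<sigma> z")
        case False
        have "min (- h y) (cosh_dist (\<sigma> z) y - 1) > 0"
          using Eh[OF y] cosh_dist_gt_1[OF \<sigma>z, of y] False by auto
        then obtain i where "inverse (real (Suc i)) < min (- h y) (cosh_dist (\<sigma> z) y - 1)"
          using reals_Archimedean by blast
        then have "y \<in> F i" using y by (simp add: F_def inverse_eq_divide)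
        then show ?thesis by blast
      qed simp
    qed
    then have "emeasure hyp_vol E = 0"
      using null_sets_subset[OF null_sets.Un[OF 1 2] half_sets(4)] by auto
    then show False using pos by simp
  qed
  then obtain i where i: "emeasure hyp_vol (F i) > 0" by blast
  define \<delta> where "\<delta> = 1 / real (Suc i)"
  have \<delta>: "\<delta> > 0" by (simp add: \<delta>_def)
  have FE: "F i \<subseteq> E" "F i \<subseteq> K0" using E_sub K0 by (auto simp: F_def)
  obtain r where r: "r > 0" "cball z r \<subseteq> hyp_space"
    using open_contains_cball hyp_space_open z by metis
  have contl: "continuous_on (cball z r \<times> K0) (\<lambda>w. cosh_dist (fst w) (snd w))"
    using continuous_on_subset[OF continuous_on_cosh_dist_pair, of "cball z r \<times> K0"] r K0
    by (auto simp: split_def)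
  have contr: "continuous_on (cball z r \<times> K0) (\<lambda>w. cosh_dist (\<sigma> (fst w)) (snd w))"
  proof -
    have "continuous_on (cball z r \<times> K0) (\<lambda>w. (\<sigma> (fst w), snd w))"
      by (intro continuous_on_Pair continuous_on_compose2[OF continuous_on_refl] continuous_intros) (use r in auto)
    moreover have "(\<lambda>w. (\<sigma> (fst w), snd w)) ` (cball z r \<times> K0) \<subseteq> hyp_space \<times> hyp_space"
      using r(2) K0(2) refl_in by (auto simp del: mem_cball)
    ultimately show ?thesis
      using continuous_on_compose2[OF continuous_on_cosh_dist_pair] by (fastforce simp: split_def)
  qed
  have comp: "compact (cball z r \<times> K0)" by (intro compact_Times compact_cball K0)
  have "bounded ((\<lambda>w. cosh_dist (fst w) (snd w)) ` (cball z r \<times> K0))"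
    by (intro compact_imp_bounded compact_continuous_image contl comp)
  then obtain S where S: "\<And>x y. x \<in> cball z r \<Longrightarrow> y \<in> K0 \<Longrightarrow> cosh_dist x y \<le> S"
    unfolding bounded_iff by (force simp: abs_le_iff)
  obtain \<rho>0 where \<rho>0: "\<rho>0 > 0" "\<And>v w. v \<in> cball z r \<times> K0 \<Longrightarrow> w \<in> cball z r \<times> K0 \<Longrightarrow> dist w v < \<rho>0 \<Longrightarrow>
      dist (cosh_dist (\<sigma> (fst w)) (snd w)) (cosh_dist (\<sigma> (fst v)) (snd v)) < \<delta> / 2"
    using compact_uniformly_continuous[OF contr comp] \<delta> unfolding uniformly_continuous_on_def
    by (metis half_gt_zero)
  define \<rho> where "\<rho> = min r \<rho>0"
  obtain k where k: "max S (4 / \<delta>) < real k" using reals_Archimedean2 by blast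
  define w where "w = green_density CARD('n) (1 + real (Suc k))"
  have w: "w > 0" unfolding w_def by (rule green_density_pos) simp
  have m: "mass z > 0" by (rule mass_pos[OF z])
  define V where "V = measure hyp_vol (F i)"
  have finF: "emeasure hyp_vol (F i) < \<infinity>"
    using emeasure_mono[OF FE(2), of hyp_vol] emeasure_hyp_vol_compact_finite[OF K0(1,2)]
      compact_imp_closed[OF K0(1)] K0(2) by (auto simp: sets_hyp_vol_iff intro: le_less_trans)
  have V: "V > 0" using i finF by (simp add: V_def measure_def enn2real_positive_iff)
  define \<kappa> where "\<kappa> = 2 * w * \<delta> * V / mass z"
  have "u x - u (\<sigma> x) \<le> - (\<kappa> * h x)" if x: "x \<in> hyp_space" "dist x z < \<rho>" "h x > 0" for x
  proof -
    have xr: "x \<in> cball z r" using x(2) by (simp add: \<rho>_def dist_commute)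
    have Dk: "D k x y \<le> - (2 * w * \<delta> * h x)" if y: "y \<in> F i" for y
    proof -
      have yE: "y \<in> E" and yK: "y \<in> K0" and yh: "y \<in> hyp_space" using y FE K0 by auto
      have hy: "h y < - \<delta>" and sz: "cosh_dist (\<sigma> z) y > 1 + \<delta>" using y by (auto simp: F_def \<delta>_def)
      have "dist (cosh_dist (\<sigma> x) y) (cosh_dist (\<sigma> z) y) < \<delta> / 2"
        using \<rho>0(2)[of "(z, y)" "(x, y)"] xr yK x(2) r by (simp add: \<rho>_def dist_Pair_Pair)
      then have s1: "cosh_dist (\<sigma> x) y > 1 + \<delta> / 2" using sz unfolding dist_real_def by linarith
      have s2: "cosh_dist x y \<le> S" using S xr yK by auto
      have "4 / \<delta> < real (Suc k)" using k by simp
      then have e1: "2 * (1 / real (Suc k)) \<le> \<delta> / 2" using \<delta> by (simp add: field_simps)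
      have "D k x y \<le> - (w * (cosh_dist x y - cosh_dist (\<sigma> x) y))"
        unfolding D_def w_def
        by (rule green_increment_le[OF eps_le _ D_antimono(3)[OF x(1,3) yE order_refl]]) (use s1 e1 s2 k in auto)
      also have "cosh_dist x y - cosh_dist (\<sigma> x) y = 2 * (?l x * ?l y / (1 - a\<^sup>2)) * h x * (- h y)"
        using cosh_dist_refl_left[OF x(1) yh] by simp
      also have "- (w * (2 * (?l x * ?l y / (1 - a\<^sup>2)) * h x * (- h y))) \<le> - (2 * w * \<delta> * h x)"
      proof -
        have "1 * 1 \<le> ?l x * ?l y"
          using conformal_factor_ge_1 x(1) yh by (intro mult_mono) (auto intro: order_trans[OF zero_le_one])
        moreover have "1 - a\<^sup>2 \<le> 1" by simp
        ultimately have "1 - a\<^sup>2 \<le> ?l x * ?l y" by linarith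
        then have q: "1 \<le> ?l x * ?l y / (1 - a\<^sup>2)" using q_pos by (subst le_divide_eq_1_pos) simp_all
        have "1 * h x * \<delta> \<le> ?l x * ?l y / (1 - a\<^sup>2) * h x * (- h y)"
          using q x(3) hy \<delta> by (intro mult_mono mult_nonneg_nonneg) linarith+
        then have "2 * w * (1 * h x * \<delta>) \<le> 2 * w * (?l x * ?l y / (1 - a\<^sup>2) * h x * (- h y))"
          using w by (intro mult_left_mono) auto
        then show ?thesis by (simp add: algebra_simps)
      qed
      finally show ?thesis .
    qed
    have "(u x - u (\<sigma> x)) * mass x \<le> (LINT y|hyp_vol. indicator E y * D k x y)"
      by (rule difference_le[OF x(1,3)])
    also have "\<dots> \<le> (LINT y|hyp_vol. indicator (F i) y * - (2 * w * \<delta> * h x))"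
    proof (rule integral_mono)
      show "integrable hyp_vol (\<lambda>y. indicator E y * D k x y)"
        by (rule integrable_on_part) (use half_sets E_sub K0 D_continuous[OF x(1)] in auto)
      show "integrable hyp_vol (\<lambda>y. indicator (F i) y * - (2 * w * \<delta> * h x))"
        by (rule integrable_on_part[OF F_sets FE(2) continuous_on_const])
      fix y :: "real ^ 'n"
      show "indicator E y * D k x y \<le> indicator (F i) y * - (2 * w * \<delta> * h x)"
        using Dk[of y] D_antimono(2)[OF x(1,3) _ order_refl, of y k] FE(1) by (auto simp: indicator_def)
    qed
    also have "\<dots> = - (2 * w * \<delta> * h x) * V"
    proof -
      have "F i \<inter> hyp_space = F i" using FE(2) K0(2) by auto
      then show ?thesis using F_sets[of i] finF by (simp add: V_def)
    qed
    finally have "(u x - u (\<sigma> x)) * mass z \<le> - (2 * w * \<delta> * h x) * V"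
      using mass_const[OF x(1) z] by simp
    then have "u x - u (\<sigma> x) \<le> - (2 * w * \<delta> * h x) * V / mass z"
      using m by (subst pos_le_divide_eq)
    then show ?thesis by (simp add: \<kappa>_def mult_ac)
  qed
  moreover have "\<kappa> > 0" using w \<delta> V m by (simp add: \<kappa>_def)
  moreover have "\<rho> > 0" using r \<rho>0 by (simp add: \<rho>_def)
  ultimately show ?thesis using that by blast
qed

end

section \<open>Moving planes\<close>

lemma tendsto_plane_height:
  "a \<longlonglongrightarrow> a' \<Longrightarrow> x \<longlonglongrightarrow> x' \<Longrightarrow> (\<lambda>k. plane_height e (a k) (x k)) \<longlonglongrightarrow> plane_height e a' x'"
  unfolding plane_height_def by (intro tendsto_intros) simp_all

lemma tendsto_plane_normal:
  "a \<longlonglongrightarrow> a' \<Longrightarrow> x \<longlonglongrightarrow> x' \<Longrightarrow> (\<lambda>k. plane_normal e (a k) (x k)) \<longlonglongrightarrow> plane_normal e a' x'"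
  unfolding plane_normal_def by (intro tendsto_intros)

lemma tendsto_reflection:
  assumes "a \<longlonglongrightarrow> a'" "x \<longlonglongrightarrow> x'" "e \<bullet> e = 1" "\<bar>a'\<bar> < 1" "x' \<in> hyp_space"
  shows "(\<lambda>k. reflection e (a k) (x k)) \<longlonglongrightarrow> reflection e a' x'"
  unfolding reflection_def
  by (intro tendsto_intros tendsto_plane_height tendsto_plane_normal assms)
     (use plane_normal_pos[OF assms(3-5)] in auto)

lemma plane_height_antimono: "a \<le> b \<Longrightarrow> plane_height e b x \<le> plane_height e a x"
  unfolding plane_height_def
  by (simp add: mult_right_mono inner_ge_zero add_nonneg_nonneg divide_right_mono)

lemma plane_height_line:
  "plane_height e a (x + t *\<^sub>R plane_normal e a x)
    = plane_height e a x + t * (1 - a * t / 2) * (plane_normal e a x \<bullet> plane_normal e a x)"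
proof -
  define v where "v = plane_normal e a x"
  have "plane_height e a (x + t *\<^sub>R v) = plane_height e a x + t * ((e - a *\<^sub>R x) \<bullet> v) - a * t\<^sup>2 * (v \<bullet> v) / 2"
    by (simp add: plane_height_def inner_add inner_diff inner_commute power2_eq_square field_simps)
  also have "e - a *\<^sub>R x = v" by (simp add: v_def plane_normal_def)
  finally show ?thesis by (simp add: v_def power2_eq_square algebra_simps)
qed

text \<open>The segment from \<open>x\<close> to its mirror image is parallel to \<open>N x\<close> with length proportional to the
  height. So the difference of the two values, divided by the height, is a normal derivative at an
  intermediate point, also in the limit of points approaching the plane.\<close>

lemma (in hyp_reflection) segment_mean_value:
  fixes u :: "'a \<Rightarrow> real"
  assumes u: "Ck_on 1 hyp_space u" and x: "x \<in> hyp_space"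
  obtains z where "z \<in> closed_segment x (\<sigma> x)" "u x - u (\<sigma> x) = 2 * h x / (N x \<bullet> N x) * (grad u z \<bullet> N x)"
proof -
  let ?v = "\<sigma> x - x"
  have v: "?v = - (2 * h x / (N x \<bullet> N x)) *\<^sub>R N x" by (simp add: reflection_def)
  have seg: "x + t *\<^sub>R ?v \<in> closed_segment x (\<sigma> x)" if "0 \<le> t" "t \<le> 1" for t
    using that by (auto simp: in_segment algebra_simps intro!: exI[of _ t])
  have sub: "closed_segment x (\<sigma> x) \<subseteq> hyp_space"
    using x refl_in[OF x] unfolding hyp_space_def by (simp add: closed_segment_subset)
  have "\<exists>z>0. z < 1 \<and> u (x + 1 *\<^sub>R ?v) - u (x + 0 *\<^sub>R ?v) = (1 - 0) * (grad u (x + z *\<^sub>R ?v) \<bullet> ?v)"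
  proof (rule MVT2)
    fix t :: real assume t: "0 \<le> t" "t \<le> 1"
    define y where "y = x + t *\<^sub>R ?v"
    have y: "y \<in> hyp_space" using seg[OF t] sub by (auto simp: y_def)
    have du: "(u has_derivative frechet_derivative u (at y)) (at y)"
      using Ck_on_SucD(1)[OF hyp_space_open, of 0 u] u y by simp
    have 1: "((\<lambda>t. x + t *\<^sub>R ?v) has_derivative (\<lambda>t. t *\<^sub>R ?v)) (at t)"
      by (auto intro!: derivative_eq_intros)
    have "((\<lambda>t. u (x + t *\<^sub>R ?v)) has_derivative (\<lambda>s. frechet_derivative u (at y) (s *\<^sub>R ?v))) (at t)"
      using has_derivative_compose[OF 1, of u "frechet_derivative u (at y)"] du by (simp add: y_def)
    moreover have "(\<lambda>s. frechet_derivative u (at y) (s *\<^sub>R ?v)) = (\<lambda>s. (grad u y \<bullet> ?v) * s)"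
      by (rule ext) (simp only: grad_inner[OF du, symmetric] inner_scaleR_right mult.commute)
    ultimately show "((\<lambda>t. u (x + t *\<^sub>R ?v)) has_real_derivative grad u (x + t *\<^sub>R ?v) \<bullet> ?v) (at t)"
      by (simp add: has_field_derivative_def y_def)
  qed simp
  then obtain t where t: "0 < t" "t < 1" "u (\<sigma> x) - u x = grad u (x + t *\<^sub>R ?v) \<bullet> ?v" by auto
  have "grad u (x + t *\<^sub>R ?v) \<bullet> ?v = - (2 * h x / (N x \<bullet> N x) * (grad u (x + t *\<^sub>R ?v) \<bullet> N x))"
    by (subst v) simp
  then have "u x - u (\<sigma> x) = 2 * h x / (N x \<bullet> N x) * (grad u (x + t *\<^sub>R ?v) \<bullet> N x)"
    using t(3) by linarith
  then show ?thesis using that seg[of t] t by auto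
qed

lemma (in hyp_reflection) refl_fixed: "h x = 0 \<Longrightarrow> \<sigma> x = x"
  by (simp add: reflection_def)

lemma tendsto_closed_segment:
  fixes x y z :: "nat \<Rightarrow> 'a::euclidean_space"
  assumes "x \<longlonglongrightarrow> l" "y \<longlonglongrightarrow> l" "\<And>k. z k \<in> closed_segment (x k) (y k)"
  shows "z \<longlonglongrightarrow> l"
proof (rule Lim_null_comparison[THEN LIM_zero_cancel])
  show "\<forall>\<^sub>F k in sequentially. norm (z k - l) \<le> norm (x k - l) + norm (y k - l)"
  proof (rule always_eventually, rule allI)
    fix k
    have "z k \<in> cball l (norm (x k - l) + norm (y k - l))"
      using assms(3)[of k] closed_segment_subset[of "x k" "cball l (norm (x k - l) + norm (y k - l))" "y k"]
      by (auto simp: dist_norm norm_minus_commute)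
    then show "norm (z k - l) \<le> norm (x k - l) + norm (y k - l)" by (simp add: dist_norm norm_minus_commute)
  qed
  have "(\<lambda>k. norm (x k - l) + norm (y k - l)) \<longlonglongrightarrow> norm (l - l) + norm (l - l)"
    by (intro tendsto_intros assms)
  then show "(\<lambda>k. norm (x k - l) + norm (y k - l)) \<longlonglongrightarrow> 0" by simp
qed

context overdetermined
begin

lemma tendsto_grad:
  assumes "x \<longlonglongrightarrow> l" "l \<in> hyp_space"
  shows "(\<lambda>k. grad u (x k)) \<longlonglongrightarrow> grad u l"
proof -
  have "continuous_on hyp_space (grad u)"
    unfolding grad_def using C1_u by (intro continuous_intros) simp
  then have "isCont (grad u) l" using assms(2) continuous_on_eq_continuous_at[OF hyp_space_open] by blast
  then show ?thesis using assms(1) by (rule isCont_tendsto_compose)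
qed

lemma tendsto_u:
  assumes "x \<longlonglongrightarrow> l" "l \<in> hyp_space"
  shows "(\<lambda>k. u (x k)) \<longlonglongrightarrow> u l"
proof -
  have "isCont u l" using u_continuous assms(2) continuous_on_eq_continuous_at[OF hyp_space_open] by blast
  then show ?thesis using assms(1) by (rule isCont_tendsto_compose)
qed

text \<open>The second part is the conclusion of the Hopf lemma: on the plane itself the solution strictly
  decreases in the direction of the cap.\<close>

definition strict_at :: "real ^ 'n \<Rightarrow> real \<Rightarrow> bool" where
  "strict_at e a \<longleftrightarrow> (\<forall>x\<in>hyp_space. plane_height e a x > 0 \<longrightarrow> u x < u (reflection e a x)) \<and>
     (\<forall>x\<in>hyp_space. plane_height e a x = 0 \<longrightarrow> grad u x \<bullet> plane_normal e a x < 0)"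

definition symmetric_at :: "real ^ 'n \<Rightarrow> real \<Rightarrow> bool" where
  "symmetric_at e a \<longleftrightarrow> (\<forall>x\<in>hyp_space. u (reflection e a x) = u x)"

text \<open>The alternative is whether the uncovered part has positive measure. In the first case the
  estimate \<open>hopf\<close> gives the strict inequality in the cap, and by \<open>segment_mean_value\<close> the sign of the
  normal derivative on the plane.\<close>

lemma strict_or_symmetric:
  assumes r: "hyp_reflection e a" and cap: "cap_reflects e a"
  shows "strict_at e a \<or> symmetric_at e a"
proof -
  interpret overdetermined_reflection \<Omega> u c x0 p0 T e a
    using r cap overdetermined_axioms
    by (simp add: overdetermined_reflection_def overdetermined_reflection_axioms_def)
  show ?thesis
  proof (cases "emeasure hyp_vol E = 0")
    case True
    then show ?thesis using symmetric_if_covered by (simp add: symmetric_at_def)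
  next
    case False
    then have pos: "emeasure hyp_vol E > 0" by (simp add: zero_less_iff_neq_zero)
    have 1: "u x < u (\<sigma> x)" if x: "x \<in> hyp_space" "h x > 0" for x
    proof -
      from hopf[OF pos x(1)] obtain \<kappa> \<rho> where k: "\<kappa> > 0" "\<rho> > 0"
        "\<And>y. y \<in> hyp_space \<Longrightarrow> dist y x < \<rho> \<Longrightarrow> h y > 0 \<Longrightarrow> u y - u (\<sigma> y) \<le> - (\<kappa> * h y)" by blast
      have "\<kappa> * h x > 0" using k(1) x(2) by simp
      then show ?thesis using k(3)[OF x(1) _ x(2)] k(2) by simp
    qed
    have 2: "grad u x \<bullet> N x < 0" if x: "x \<in> hyp_space" "h x = 0" for x
    proof -
      from hopf[OF pos x(1)] obtain \<kappa> \<rho> where k: "\<kappa> > 0" "\<rho> > 0"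
        "\<And>y. y \<in> hyp_space \<Longrightarrow> dist y x < \<rho> \<Longrightarrow> h y > 0 \<Longrightarrow> u y - u (\<sigma> y) \<le> - (\<kappa> * h y)" by blast
      have Nx: "N x \<bullet> N x > 0" by (rule N_pos[OF x(1)])
      define y where "y k = x + (1 / real (Suc k)) *\<^sub>R N x" for k
      have "(\<lambda>k. 1 / real (Suc k)) \<longlonglongrightarrow> 0" using LIMSEQ_inverse_real_of_nat by (simp add: inverse_eq_divide)
      then have "y \<longlonglongrightarrow> x + 0 *\<^sub>R N x" unfolding y_def by (intro tendsto_intros)
      then have ylim: "y \<longlonglongrightarrow> x" by simp
      have hy: "h (y k) > 0" for k
      proof -
        have "a * (1 / real (Suc k)) \<le> 1 * 1" using small by (intro order_trans[OF abs_ge_self[of "a * (1 / real (Suc k))"]]) (simp add: abs_mult divide_le_eq)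
        then have "1 - a * (1 / real (Suc k)) / 2 > 0" by simp
        then show ?thesis unfolding y_def plane_height_line x(2)
          using Nx by (simp add: zero_less_mult_iff)
      qed
      have ev: "\<forall>\<^sub>F k in sequentially. y k \<in> hyp_space \<and> dist (y k) x < \<rho>"
        using topological_tendstoD[OF ylim hyp_space_open x(1)] tendstoD[OF ylim k(2)] by eventually_elim simp
      have "\<exists>z. z \<in> closed_segment (y k) (\<sigma> (y k)) \<and> (y k \<in> hyp_space \<longrightarrow>
          u (y k) - u (\<sigma> (y k)) = 2 * h (y k) / (N (y k) \<bullet> N (y k)) * (grad u z \<bullet> N (y k)))" for k
      proof (cases "y k \<in> hyp_space")
        case True
        then show ?thesis using segment_mean_value[OF C1_u True] by metis
      next
        case False
        then show ?thesis by (intro exI[of _ "y k"]) simp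
      qed
      then obtain z where z: "\<And>k. z k \<in> closed_segment (y k) (\<sigma> (y k))"
        "\<And>k. y k \<in> hyp_space \<Longrightarrow>
          u (y k) - u (\<sigma> (y k)) = 2 * h (y k) / (N (y k) \<bullet> N (y k)) * (grad u (z k) \<bullet> N (y k))" by metis
      have "(\<lambda>k. \<sigma> (y k)) \<longlonglongrightarrow> \<sigma> x"
        by (rule tendsto_reflection[OF tendsto_const ylim unit small x(1)])
      then have "z \<longlonglongrightarrow> x" using tendsto_closed_segment[OF ylim _ z(1)] refl_fixed[OF x(2)] by simp
      then have gl: "(\<lambda>k. grad u (z k) \<bullet> N (y k)) \<longlonglongrightarrow> grad u x \<bullet> N x"
        by (intro tendsto_inner tendsto_grad x tendsto_plane_normal ylim tendsto_const)
      have nl: "(\<lambda>k. - (\<kappa> * (N (y k) \<bullet> N (y k)) / 2)) \<longlonglongrightarrow> - (\<kappa> * (N x \<bullet> N x) / 2)"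
        by (intro tendsto_intros tendsto_plane_normal ylim) simp
      have "\<forall>\<^sub>F k in sequentially. grad u (z k) \<bullet> N (y k) \<le> - (\<kappa> * (N (y k) \<bullet> N (y k)) / 2)"
        using ev
      proof eventually_elim
        case (elim k)
        define m where "m = N (y k) \<bullet> N (y k)"
        have m: "m > 0" using N_pos elim by (simp add: m_def)
        have "2 * h (y k) / m * (grad u (z k) \<bullet> N (y k)) \<le> - (\<kappa> * h (y k))"
          using k(3)[of "y k"] elim hy[of k] z(2)[of k] by (simp add: m_def)
        then have "h (y k) * (grad u (z k) \<bullet> N (y k)) \<le> h (y k) * - (\<kappa> * m / 2)"
          using m by (simp add: field_simps)
        then show ?case using hy[of k] unfolding m_def by (rule mult_left_le_imp_le)
      qed
      then have "grad u x \<bullet> N x \<le> - (\<kappa> * (N x \<bullet> N x) / 2)"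
        by (rule tendsto_le[OF sequentially_bot nl gl])
      also have "\<dots> < 0" using k(1) Nx by simp
      finally show ?thesis .
    qed
    show ?thesis using 1 2 by (auto simp: strict_at_def)
  qed
qed

end

context overdetermined
begin

text \<open>A symmetry about a plane with the maximum point \<open>p\<close> on its far side produces a second
  maximum point in the cap. This is absurd if the cap does not meet the domain, and also if the planes
  with slightly larger parameter are strict, because their caps still contain the second point.\<close>

lemma not_symmetric:
  assumes r: "hyp_reflection e a" and p: "p \<in> \<Omega>" "\<And>y. y \<in> hyp_space \<Longrightarrow> u y \<le> u p"
    and hp: "plane_height e a p < 0"
    and above: "a = a1 \<and> (\<forall>y\<in>\<Omega>. plane_height e a1 y < 0) \<or>
      a < a1 \<and> a1 < 1 \<and> (\<forall>b. a < b \<and> b \<le> a1 \<longrightarrow> strict_at e b)"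
  shows "\<not> symmetric_at e a"
proof
  assume sym: "symmetric_at e a"
  interpret hyp_reflection e a by fact
  have ph: "p \<in> hyp_space" using p sub_\<Omega> by auto
  define q where "q = \<sigma> p"
  have qh: "q \<in> hyp_space" unfolding q_def by (rule refl_in[OF ph])
  have uq: "u q = u p" using sym ph by (simp add: symmetric_at_def q_def)
  have hq: "h q > 0" using h_refl[OF ph] \<mu>_pos[OF ph] hp by (simp add: q_def mult_pos_neg)
  have q\<Omega>: "q \<in> \<Omega>" using \<Omega>_eq[OF qh] uq u_pos[OF p(1)] by simp
  from above show False
  proof
    assume "a = a1 \<and> (\<forall>y\<in>\<Omega>. plane_height e a1 y < 0)"
    then show False using q\<Omega> hq by force
  next
    assume A: "a < a1 \<and> a1 < 1 \<and> (\<forall>b. a < b \<and> b \<le> a1 \<longrightarrow> strict_at e b)"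
    define t where "t = min (a1 - a) (h q / (1 + q \<bullet> q))"
    have pos: "1 + q \<bullet> q > 0" by (simp add: add_pos_nonneg)
    have t: "0 < t" "t \<le> a1 - a" "t \<le> h q / (1 + q \<bullet> q)" using A hq pos by (auto simp: t_def)
    have "t * (1 + q \<bullet> q) \<le> h q" using t(3) pos by (simp add: le_divide_eq)
    moreover have "plane_height e (a + t) q = h q - t * (1 + q \<bullet> q) / 2"
      by (simp add: plane_height_def field_simps)
    ultimately have hb: "plane_height e (a + t) q > 0" using hq by linarith
    have "strict_at e (a + t)" using A t by auto
    then have "u q < u (reflection e (a + t) q)" using qh hb by (simp add: strict_at_def)
    moreover have "reflection e (a + t) q \<in> hyp_space"
    proof -
      have "hyp_reflection e (a + t)" using unit small A t by (simp add: hyp_reflection_def abs_less_iff)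
      then show ?thesis using hyp_reflection.refl_in qh by blast
    qed
    ultimately show False using p(2) uq by force
  qed
qed

lemma cap_reflects_limit:
  assumes r: "hyp_reflection e a" and b: "b \<longlonglongrightarrow> a"
    and s: "\<And>k. strict_at e (b k)"
  shows "cap_reflects e a"
  unfolding cap_reflects_def
proof (intro ballI impI)
  interpret hyp_reflection e a by fact
  fix x assume x: "x \<in> \<Omega>" "h x > 0"
  have xh: "x \<in> hyp_space" using x sub_\<Omega> by auto
  have hl: "(\<lambda>k. plane_height e (b k) x) \<longlonglongrightarrow> h x" by (intro tendsto_plane_height b tendsto_const)
  have "\<forall>\<^sub>F k in sequentially. u x \<le> u (reflection e (b k) x)"
    using order_tendstoD(1)[OF hl x(2)]
  proof eventually_elim
    case (elim k)
    then show ?case using s[of k] xh by (auto simp: strict_at_def intro: less_imp_le)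
  qed
  moreover have "(\<lambda>k. u (reflection e (b k) x)) \<longlonglongrightarrow> u (\<sigma> x)"
    by (intro tendsto_u tendsto_reflection b tendsto_const unit small xh refl_in)
  ultimately have "u x \<le> u (\<sigma> x)" using tendsto_lowerbound[OF _ _ sequentially_bot] by blast
  then show "\<sigma> x \<in> \<Omega>" using u_pos[OF x(1)] \<Omega>_eq[OF refl_in[OF xh]] by simp
qed

text \<open>Strictness is an open condition: a violating sequence of planes would have a limit point
  that violates either the strict inequality in the cap or the sign of the normal derivative.\<close>

lemma cap_reflects_open:
  assumes r: "hyp_reflection e a" and s: "strict_at e a"
    and b: "b \<longlonglongrightarrow> a" "\<And>k. hyp_reflection e (b k)"
  shows "\<exists>k. cap_reflects e (b k)"
proof (rule ccontr)
  interpret hyp_reflection e a by fact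
  assume "\<not> ?thesis"
  then have "\<forall>k. \<exists>x. x \<in> \<Omega> \<and> plane_height e (b k) x > 0 \<and> reflection e (b k) x \<notin> \<Omega>"
    by (auto simp: cap_reflects_def)
  then obtain x where x: "\<And>k. x k \<in> \<Omega>" "\<And>k. plane_height e (b k) (x k) > 0" "\<And>k. reflection e (b k) (x k) \<notin> \<Omega>"
    by metis
  have "\<forall>k. x k \<in> K0" using x(1) K0 by auto
  then obtain l \<phi> where l: "l \<in> K0" "strict_mono \<phi>" "(x \<circ> \<phi>) \<longlonglongrightarrow> l"
    using compact_imp_seq_compact[OF K0(1)] unfolding seq_compact_def by metis
  have lh: "l \<in> hyp_space" using l K0 by auto
  define y where "y k = x (\<phi> k)" for k
  define d where "d k = b (\<phi> k)" for k
  have yl: "y \<longlonglongrightarrow> l" using l(3) by (simp add: y_def[abs_def] comp_def)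
  have dl: "d \<longlonglongrightarrow> a" using LIMSEQ_subseq_LIMSEQ[OF b(1) l(2)] by (simp add: d_def[abs_def] comp_def)
  have yh: "y k \<in> hyp_space" for k using x(1) sub_\<Omega> by (auto simp: y_def)
  have rd: "hyp_reflection e (d k)" for k by (simp add: d_def b)
  have ineq: "u (reflection e (d k) (y k)) < u (y k)" for k
  proof -
    have "reflection e (d k) (y k) \<in> hyp_space" by (rule hyp_reflection.refl_in[OF rd yh])
    then have "u (reflection e (d k) (y k)) \<le> 0" using x(3)[of "\<phi> k"] u_nonpos by (simp add: y_def d_def)
    moreover have "u (y k) > 0" using u_pos x(1) by (simp add: y_def)
    ultimately show ?thesis by simp
  qed
  have hpos: "plane_height e (d k) (y k) > 0" for k using x(2) by (simp add: y_def d_def)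
  have hl: "(\<lambda>k. plane_height e (d k) (y k)) \<longlonglongrightarrow> h l" by (intro tendsto_plane_height dl yl)
  then have "h l \<ge> 0"
    by (rule tendsto_lowerbound[OF _ _ sequentially_bot]) (auto intro: always_eventually less_imp_le hpos)
  have rl: "(\<lambda>k. reflection e (d k) (y k)) \<longlonglongrightarrow> \<sigma> l"
    by (intro tendsto_reflection dl yl unit small lh)
  show False
  proof (cases "h l = 0")
    case False
    then have "u l < u (\<sigma> l)" using s lh \<open>h l \<ge> 0\<close> by (simp add: strict_at_def)
    moreover have "u (\<sigma> l) \<le> u l"
      by (rule tendsto_le[OF sequentially_bot tendsto_u[OF yl lh] tendsto_u[OF rl refl_in[OF lh]]])
         (auto intro: always_eventually less_imp_le ineq)
    ultimately show False by simp
  next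
    case True
    have "\<exists>z. z \<in> closed_segment (y k) (reflection e (d k) (y k)) \<and>
        0 \<le> grad u z \<bullet> plane_normal e (d k) (y k)" for k
    proof -
      obtain z where z: "z \<in> closed_segment (y k) (reflection e (d k) (y k))"
        "u (y k) - u (reflection e (d k) (y k)) = 2 * plane_height e (d k) (y k) /
          (plane_normal e (d k) (y k) \<bullet> plane_normal e (d k) (y k)) * (grad u z \<bullet> plane_normal e (d k) (y k))"
        using hyp_reflection.segment_mean_value[OF rd C1_u yh] by metis
      have "2 * plane_height e (d k) (y k) / (plane_normal e (d k) (y k) \<bullet> plane_normal e (d k) (y k)) > 0"
        using hpos[of k] hyp_reflection.N_pos[OF rd yh, of k] by (simp add: divide_pos_pos)
      moreover have "0 < 2 * plane_height e (d k) (y k) / (plane_normal e (d k) (y k) \<bullet> plane_normal e (d k) (y k)) *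
          (grad u z \<bullet> plane_normal e (d k) (y k))"
        using z(2) ineq[of k] by linarith
      ultimately have "0 < grad u z \<bullet> plane_normal e (d k) (y k)" by (rule zero_less_mult_pos[rotated])
      then have "0 \<le> grad u z \<bullet> plane_normal e (d k) (y k)" by (rule less_imp_le)
      then show ?thesis using z(1) by blast
    qed
    then obtain z where z: "\<And>k. z k \<in> closed_segment (y k) (reflection e (d k) (y k))"
      "\<And>k. 0 \<le> grad u (z k) \<bullet> plane_normal e (d k) (y k)" by metis
    have "z \<longlonglongrightarrow> l" using tendsto_closed_segment[OF yl _ z(1)] rl refl_fixed[OF True] by simp
    then have "(\<lambda>k. grad u (z k) \<bullet> plane_normal e (d k) (y k)) \<longlonglongrightarrow> grad u l \<bullet> N l"
      by (intro tendsto_inner tendsto_grad tendsto_plane_normal dl yl lh)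
    then have "0 \<le> grad u l \<bullet> N l"
      by (rule tendsto_lowerbound[OF _ _ sequentially_bot]) (auto intro: always_eventually z(2))
    then show False using s lh True by (auto simp: strict_at_def)
  qed
qed

text \<open>The reflected maximum point lies in the cap, so strictness separates its value from that of its
  mirror image, and this persists for nearby planes.\<close>

lemma not_symmetric_open:
  assumes r: "hyp_reflection e a" and s: "strict_at e a" and p: "p \<in> hyp_space" "plane_height e a p < 0"
    and b: "b \<longlonglongrightarrow> a"
  shows "\<forall>\<^sub>F k in sequentially. \<not> symmetric_at e (b k)"
proof -
  interpret hyp_reflection e a by fact
  let ?q = "\<sigma> p"
  have q: "?q \<in> hyp_space" by (rule refl_in[OF p(1)])
  have "h ?q > 0" using h_refl[OF p(1)] \<mu>_pos[OF p(1)] p(2) by (simp add: mult_pos_neg)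
  then have lt: "u ?q < u (\<sigma> ?q)" using s q by (simp add: strict_at_def)
  have "(\<lambda>k. u (reflection e (b k) ?q)) \<longlonglongrightarrow> u (\<sigma> ?q)"
    by (intro tendsto_u tendsto_reflection b tendsto_const unit small q refl_in)
  from order_tendstoD(1)[OF this lt] show ?thesis
  proof eventually_elim
    case (elim k)
    then have "u (reflection e (b k) ?q) \<noteq> u ?q" by simp
    then show ?case using q unfolding symmetric_at_def by blast
  qed
qed

text \<open>The moving plane argument. The planes with parameter \<open>a\<close> near 1 miss the domain, and decreasing
  \<open>a\<close> moves them towards the maximum point \<open>p\<close>, which stays on the far side. The infimum \<open>m\<close> of the
  parameters down to which strictness holds is attained by \<open>cap_reflects_limit\<close>, and it cannot lie above \<open>a0\<close>
  because strictness is an open condition.\<close>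

lemma moving_planes:
  assumes r0: "hyp_reflection e a0" and p: "p \<in> \<Omega>" "\<And>y. y \<in> hyp_space \<Longrightarrow> u y \<le> u p"
    and hp0: "plane_height e a0 p < 0"
  shows "strict_at e a0"
proof -
  have ee: "e \<bullet> e = 1" and a0: "\<bar>a0\<bar> < 1" using r0 by (auto simp: hyp_reflection_def)
  have ne: "norm e = 1" using ee by (simp add: norm_eq_sqrt_inner)
  have ph: "p \<in> hyp_space" using p sub_\<Omega> by auto
  have refl: "hyp_reflection e b" if "a0 \<le> b" "b < 1" for b
    using that ee a0 by (simp add: hyp_reflection_def)
  have hp: "plane_height e b p < 0" if "a0 \<le> b" for b
    using plane_height_antimono[OF that, of e p] hp0 by simp
  obtain \<rho> where \<rho>: "\<rho> < 1" "\<And>y. y \<in> K0 \<Longrightarrow> norm y \<le> \<rho>"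
  proof -
    have "K0 \<noteq> {}" using K0(3) ne_\<Omega> by auto
    then obtain m where "m \<in> K0" "\<And>y. y \<in> K0 \<Longrightarrow> norm y \<le> norm m"
      using continuous_attains_sup[OF K0(1) _ continuous_on_norm_id] by blast
    then show ?thesis using that[of "norm m"] K0(2) by (auto simp: hyp_space_def)
  qed
  \<comment> \<open>For \<open>a = 1\<close> the height is at most \<open>- (1 - norm y)\<^sup>2 / 2\<close>; the choice of \<open>\<eta>\<close> leaves half of it.\<close>
  define \<eta> where "\<eta> = (1 - \<rho>)\<^sup>2 / 4"
  have \<eta>: "\<eta> > 0" using \<rho> by (simp add: \<eta>_def)
  define a1 where "a1 = max a0 (1 - \<eta>)"
  have a1: "a0 \<le> a1" "a1 < 1" "1 - \<eta> \<le> a1" using a0 \<eta> by (auto simp: a1_def)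
  have empty: "plane_height e a1 y < 0" if y: "y \<in> \<Omega>" for y
  proof -
    have ny: "norm y \<le> \<rho>" "norm y < 1" using \<rho>(2)[of y] K0 y sub_\<Omega> by (auto simp: hyp_space_def)
    have sq: "(norm y)\<^sup>2 \<le> 1" using ny by (simp add: abs_square_le_1)
    have alg: "E < A / 2" if "E \<le> M" "X - Y \<le> A" "Y \<le> P / 2" "P \<le> X - 2 * M" "0 < P" for E M X Y A P :: real
      using that by linarith
    have "e \<bullet> y < a1 * (1 + (norm y)\<^sup>2) / 2"
    proof (rule alg)
      show "e \<bullet> y \<le> norm y" using norm_cauchy_schwarz[of e y] ne by simp
      have "(1 - \<eta>) * (1 + (norm y)\<^sup>2) \<le> a1 * (1 + (norm y)\<^sup>2)"
        using a1 by (intro mult_right_mono) auto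
      then show "(1 + (norm y)\<^sup>2) - \<eta> * (1 + (norm y)\<^sup>2) \<le> a1 * (1 + (norm y)\<^sup>2)"
        by (simp only: left_diff_distrib mult_1)
      have "\<eta> * (1 + (norm y)\<^sup>2) \<le> \<eta> * 2" using sq \<eta> by (intro mult_left_mono) auto
      also have "\<eta> * 2 = (1 - \<rho>)\<^sup>2 / 2" by (simp add: \<eta>_def)
      finally show "\<eta> * (1 + (norm y)\<^sup>2) \<le> (1 - \<rho>)\<^sup>2 / 2" .
      have "(1 - \<rho>)\<^sup>2 \<le> (1 - norm y)\<^sup>2" using ny \<rho> by (intro power_mono) auto
      also have "(1 - norm y)\<^sup>2 = (1 + (norm y)\<^sup>2) - 2 * norm y" by (simp add: power2_eq_square algebra_simps)
      finally show "(1 - \<rho>)\<^sup>2 \<le> (1 + (norm y)\<^sup>2) - 2 * norm y" .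
      show "0 < (1 - \<rho>)\<^sup>2" using \<rho> by simp
    qed
    then show ?thesis by (simp add: plane_height_def power2_norm_eq_inner)
  qed
  define good where "good = {a. a0 \<le> a \<and> a \<le> a1 \<and> (\<forall>b. a \<le> b \<and> b \<le> a1 \<longrightarrow> strict_at e b)}"
  have "cap_reflects e a1" unfolding cap_reflects_def using empty by fastforce
  then have "strict_at e a1"
    using strict_or_symmetric[OF refl[OF a1(1,2)]] not_symmetric[OF refl[OF a1(1,2)] p hp[OF a1(1)], of a1] empty by blast
  then have a1_good: "a1 \<in> good" using a1 by (auto simp: good_def)
  define m where "m = Inf good"
  have good_ge: "a0 \<le> b" if "b \<in> good" for b using that by (simp add: good_def)
  then have bdd: "bdd_below good" by (rule bdd_belowI)
  have m: "a0 \<le> m" "m \<le> a1"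
    unfolding m_def using a1_good by (blast intro: cInf_greatest good_ge) (rule cInf_lower[OF a1_good bdd])
  have above: "strict_at e b" if b: "m < b" "b \<le> a1" for b
  proof -
    obtain a where "a \<in> good" "a < b" using cInf_lessD[of good b] a1_good b(1) by (auto simp: m_def)
    then show ?thesis using b by (auto simp: good_def)
  qed
  have m1: "m < 1" using m a1 by simp
  note rm = refl[OF m(1) m1]
  have strict_m: "strict_at e m"
  proof (cases "m = a1")
    case True
    then show ?thesis using \<open>strict_at e a1\<close> by simp
  next
    case False
    then have ma: "m < a1" using m by simp
    define b where "b k = m + (a1 - m) / real (Suc k)" for k
    have bk: "m < b k" "b k \<le> a1" for k
    proof -
      show "m < b k" using ma by (simp add: b_def)
      have "(a1 - m) / real (Suc k) \<le> (a1 - m) / 1" using ma by (intro divide_left_mono) auto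
      then show "b k \<le> a1" by (simp add: b_def)
    qed
    have "(\<lambda>k. m + (a1 - m) * inverse (real (Suc k))) \<longlonglongrightarrow> m + (a1 - m) * 0"
      by (intro tendsto_intros LIMSEQ_inverse_real_of_nat)
    then have bl: "b \<longlonglongrightarrow> m" by (simp add: b_def[abs_def] divide_inverse)
    have "cap_reflects e m" by (rule cap_reflects_limit[OF rm bl]) (rule above[OF bk])
    moreover have "\<not> symmetric_at e m"
      by (rule not_symmetric[OF rm p hp[OF m(1)], of a1]) (use ma a1 above in auto)
    ultimately show ?thesis using strict_or_symmetric[OF rm] by blast
  qed
  have "m = a0"
  proof (rule ccontr)
    assume "m \<noteq> a0"
    then have am: "a0 < m" using m by simp
    have "\<exists>b. a0 \<le> b \<and> m - (m - a0) / real (Suc k) \<le> b \<and> b < m \<and> \<not> strict_at e b" for k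
    proof (rule ccontr)
      assume no: "\<not> ?thesis"
      define t where "t = m - (m - a0) / real (Suc k)"
      have "(m - a0) / real (Suc k) \<le> (m - a0) / 1" using am by (intro divide_left_mono) auto
      then have t: "a0 \<le> t" "t < m" using am by (auto simp: t_def)
      have "strict_at e b" if "t \<le> b" "b \<le> a1" for b
      proof (cases "b < m")
        case True
        then show ?thesis using no that t by (auto simp: t_def)
      next
        case False
        then show ?thesis using strict_m above[of b] that by (cases "b = m") auto
      qed
      then have "t \<in> good" using t m by (auto simp: good_def)
      then show False using cInf_lower[OF _ bdd, of t] t by (simp add: m_def)
    qed
    then obtain b where b: "\<And>k. a0 \<le> b k" "\<And>k. m - (m - a0) / real (Suc k) \<le> b k" "\<And>k. b k < m"
      "\<And>k. \<not> strict_at e (b k)" by metis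
    have bl: "b \<longlonglongrightarrow> m"
    proof (rule tendsto_sandwich[where f = "\<lambda>k. m - (m - a0) / real (Suc k)" and h = "\<lambda>_. m"])
      have "(\<lambda>k. m - (m - a0) * inverse (real (Suc k))) \<longlonglongrightarrow> m - (m - a0) * 0"
        by (intro tendsto_intros LIMSEQ_inverse_real_of_nat)
      then show "(\<lambda>k. m - (m - a0) / real (Suc k)) \<longlonglongrightarrow> m" by (simp add: divide_inverse)
      show "\<forall>\<^sub>F k in sequentially. m - (m - a0) / real (Suc k) \<le> b k"
        by (rule always_eventually, rule allI, rule b(2))
      show "\<forall>\<^sub>F k in sequentially. b k \<le> m"
        by (rule always_eventually, rule allI, rule less_imp_le, rule b(3))
    qed (rule tendsto_const)
    have rb: "hyp_reflection e (b k)" for k using refl[of "b k"] b(1,3)[of k] m1 by simp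
    obtain k0 where k0: "\<And>k. k \<ge> k0 \<Longrightarrow> \<not> symmetric_at e (b k)"
      using not_symmetric_open[OF rm strict_m ph hp[OF m(1)] bl] unfolding eventually_sequentially by blast
    have "(\<lambda>k. b (k + k0)) \<longlonglongrightarrow> m" using bl by (rule LIMSEQ_ignore_initial_segment)
    then have "\<exists>k. cap_reflects e (b (k + k0))" by (rule cap_reflects_open[OF rm strict_m _ rb])
    then obtain k where "cap_reflects e (b (k + k0))" by blast
    then show False using strict_or_symmetric[OF rb] k0[of "k + k0"] b(4) by auto
  qed
  then show ?thesis using strict_m by simp
qed

text \<open>The bisector of \<open>q\<close> and \<open>b\<close> has \<open>b\<close> in its cap and \<open>p\<close> on the far side, and the reflection maps
  \<open>b\<close> to \<open>q\<close>. So \<open>u\<close> is larger at \<open>q\<close> than at \<open>b\<close>.\<close>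

lemma closer_point_in:
  assumes p: "p \<in> \<Omega>" "\<And>y. y \<in> hyp_space \<Longrightarrow> u y \<le> u p"
    and b: "b \<in> \<Omega>" and q: "q \<in> hyp_space" "cosh_dist p q < cosh_dist p b"
  shows "q \<in> \<Omega>"
proof -
  have bh: "b \<in> hyp_space" and ph: "p \<in> hyp_space" using b p sub_\<Omega> by auto
  have "q \<noteq> b" using q by auto
  from bisector[OF q(1) bh this] obtain e a where ea: "hyp_reflection e a" "reflection e a b = q"
    "plane_height e a b > 0" "plane_height e a p < 0" using ph q(2) by metis
  have "strict_at e a" by (rule moving_planes[OF ea(1) p ea(4)])
  then have "u b < u q" using ea bh by (auto simp: strict_at_def)
  then show ?thesis using u_pos[OF b] \<Omega>_eq[OF q(1)] by simp
qed

text \<open>By the previous lemma the domain contains with a point all points that are closer to \<open>p\<close>, and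
  openness excludes points at maximal distance since \<open>cosh_dist p\<close> has no critical point besides \<open>p\<close>.\<close>

lemma domain_is_ball: "\<exists>p\<in>hyp_space. \<exists>r>0. \<Omega> = hyp_ball p r"
proof -
  obtain p where p: "p \<in> \<Omega>" "\<And>y. y \<in> hyp_space \<Longrightarrow> u y \<le> u p" using ex_maximum by blast
  have ph: "p \<in> hyp_space" using p sub_\<Omega> by auto
  obtain B where B: "\<And>y. y \<in> K0 \<Longrightarrow> cosh_dist p y \<le> B"
    using cosh_dist_bounded_on_compact[OF ph K0(1,2)] by blast
  define S where "S = (SUP y\<in>\<Omega>. cosh_dist p y)"
  have bdd: "bdd_above (cosh_dist p ` \<Omega>)" using B K0(3) by (intro bdd_aboveI2[where M = B]) auto
  have farther: "\<exists>b\<in>\<Omega>. cosh_dist p y < cosh_dist p b" if y: "y \<in> \<Omega>" for y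
  proof (rule ccontr)
    assume no: "\<not> ?thesis"
    have yh: "y \<in> hyp_space" using y sub_\<Omega> by auto
    have no': "cosh_dist p z \<le> cosh_dist p y" if "z \<in> \<Omega>" for z
      by (rule leI, rule notI) (use no that in blast)
    have ev: "\<forall>\<^sub>F z in nhds y. z \<in> \<Omega>" using eventually_nhds_in_open[OF open_\<Omega> y] .
    have "(\<lambda>v. conformal_factor y * (dist_dir p y \<bullet> v)) = (\<lambda>v. 0)"
    proof (rule has_derivative_local_max)
      show "(cosh_dist p has_derivative (\<lambda>v. conformal_factor y * (dist_dir p y \<bullet> v))) (at y)"
        by (rule cosh_dist_has_derivative[OF ph yh])
      show "\<forall>\<^sub>F z in at y. cosh_dist p z \<le> cosh_dist p y"
        unfolding eventually_at_filter using ev by eventually_elim (simp add: no')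
    qed
    from fun_cong[OF this, of "dist_dir p y"] have "dist_dir p y \<bullet> dist_dir p y = 0"
      using conformal_factor_pos[OF yh] by simp
    then have "(cosh_dist p y)\<^sup>2 = 1" unfolding dist_dir_inner_self(1)[OF ph yh] by simp
    then have "\<not> cosh_dist p y > 1" using one_less_power[of "cosh_dist p y" 2] by linarith
    then have "y = p" using cosh_dist_gt_1[OF ph yh] by blast
    have "z = p" if z: "z \<in> \<Omega>" for z
    proof (rule ccontr)
      assume "z \<noteq> p"
      then have "cosh_dist p z > 1" using cosh_dist_gt_1[OF ph] z sub_\<Omega> by blast
      then show False using no'[OF z] \<open>y = p\<close> by simp
    qed
    then have "\<Omega> = {p}" using p(1) by blast
    then show False using open_\<Omega> not_open_singleton[of p] by simp
  qed
  have in_iff: "y \<in> \<Omega> \<longleftrightarrow> cosh_dist p y < S" if y: "y \<in> hyp_space" for y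
  proof
    assume "y \<in> \<Omega>"
    then obtain b where b: "b \<in> \<Omega>" "cosh_dist p y < cosh_dist p b" using farther by blast
    then show "cosh_dist p y < S" using cSUP_upper[OF b(1) bdd] unfolding S_def by linarith
  next
    assume "cosh_dist p y < S"
    then obtain b where "b \<in> \<Omega>" "cosh_dist p y < cosh_dist p b"
      using less_cSUP_iff[OF ne_\<Omega> bdd, of "cosh_dist p y"] unfolding S_def by blast
    then show "y \<in> \<Omega>" using closer_point_in[OF p] y by blast
  qed
  have S1: "S > 1" using in_iff[OF ph] p(1) by simp
  have "\<Omega> = hyp_ball p (arcosh S)"
  proof -
    have d: "hyp_dist p y < arcosh S \<longleftrightarrow> cosh_dist p y < S" if "y \<in> hyp_space" for y
      unfolding hyp_dist_eq_arcosh
      by (rule arcosh_less_iff_real) (use cosh_dist_ge_1[OF ph that] S1 in simp_all)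
    have "y \<in> \<Omega> \<longleftrightarrow> y \<in> hyp_ball p (arcosh S)" for y
    proof (cases "y \<in> hyp_space")
      case True
      then show ?thesis by (simp only: hyp_ball_def mem_Collect_eq d[OF True] in_iff[OF True] simp_thms)
    next
      case False
      then show ?thesis using sub_\<Omega> by (auto simp: hyp_ball_def)
    qed
    then show ?thesis by blast
  qed
  moreover have "arcosh S > 0" using S1 by simp
  ultimately show ?thesis using ph by blast
qed

end

section \<open>The symmetry theorem\<close>

theorem theorem1p2:
  fixes \<Omega> :: "(real ^ 'n) set"
    and u :: "real ^ 'n \<Rightarrow> real"
    and \<alpha> c :: real
    and x\<^sub>0 :: "real ^ 'n"
  assumes "CARD('n) \<ge> 2"
    and "open \<Omega>" "connected \<Omega>" "\<Omega> \<noteq> {}" "\<Omega> \<subseteq> hyp_space"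
    and "hyp_bounded \<Omega>"
    and "0 < \<alpha>" "\<alpha> < 1" "Ck_Holder_boundary 2 \<alpha> \<Omega>"
    and "x\<^sub>0 \<in> hyp_space"
    and "c > 0"
    and "Ck_on 1 hyp_space u"
    and "weak_hyp_poisson u (indicator \<Omega>)"
    and "\<forall>x\<in>frontier \<Omega>. u x = 0"
    and "(u \<longlongrightarrow> - c) (inf (filtercomap (\<lambda>x. hyp_dist x x\<^sub>0) at_top) (principal hyp_space))"
  shows "\<exists>p\<in>hyp_space. \<exists>r>0. \<Omega> = hyp_ball p r"
proof -
  obtain p0 R where p0: "p0 \<in> hyp_space" "\<And>x. x \<in> \<Omega> \<Longrightarrow> hyp_dist p0 x \<le> R"
    using assms(6) by (auto simp: hyp_bounded_def)
  have "cosh_dist p0 y \<le> cosh R" if y: "y \<in> \<Omega>" for y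
  proof -
    have s: "cosh_dist p0 y \<ge> 1" using cosh_dist_ge_1 p0(1) y assms(5) by blast
    have "0 \<le> hyp_dist p0 y" using s by (simp add: hyp_dist_eq_arcosh)
    then have "cosh (hyp_dist p0 y) \<le> cosh R" using p0(2)[OF y] by (simp add: cosh_real_nonneg_le_iff)
    then show ?thesis using s by (simp add: hyp_dist_eq_arcosh)
  qed
  then interpret overdetermined \<Omega> u c x\<^sub>0 p0 "cosh R"
    using assms(2,4,5,10-15) p0(1) by unfold_locales (simp_all only:, blast?)
  show ?thesis by (rule domain_is_ball)
qed

end
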